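(* Let $(\mathcal C,X,\tau)$ be a trivalent ribbon category over $\mathbb C$ with $\dim\mathcal C(4)\le5$, satisfying (QEJac-$\alpha$) for some $v$ and $\alpha$ with $v^{10}\neq1$ and $v^{12}\ne1$. Then there is a $w\in\mathbb C$ and an evaluation functor (a $\mathbb C$-linear ribbon functor sending the generating strand to $X$) $\mathsf{QExc}_{\mathbb C,v,w}\to\mathcal C$ sending the trivalent vertex to $\tau$.
   Context: For an object $X$ of a ribbon category $\mathcal C$, $\mathcal C(n)=\mathrm{Hom}(X^{\otimes n},\mathbf 1_{\mathcal C})$. A trivalent ribbon category $(\mathcal C,X,\tau)$ over a commutative ring $R$ is an $R$-linear ribbon category with a self-dual object $X$ (chosen self-duality $\mathrm{ev}:X\otimes X\to\mathbf 1_{\mathcal C}$, $\mathrm{coev}:\mathbf 1_{\mathcal C}\to X\otimes X$) such that $\mathcal C(1)=0$; $\mathcal C(0),\mathcal C(2),\mathcal C(3)$ are free of rank 1 generated respectively by the empty diagram, the strand $\mathrm{ev}$, and a "trivalent vertex" $\tau\in\mathcal C(3)$; $\mathcal C$ is generated as a ribbon category by $\tau$; and the circle $d=\mathrm{ev}\circ\mathrm{coev}$ and the bigon value $b$ ($m\circ\delta=b\,\mathrm{id}_X$) are non-zero. Then $X$ is symmetrically self-dual and $\tau$ rotationally invariant. The self-duality is only well defined up to a non-zero scalar, and may be rescaled; rescaling it rescales $b$. Diagrams as morphisms: $m=(\tau\otimes\mathrm{id}_X)(\mathrm{id}_X\otimes\mathrm{id}_X\otimes\mathrm{coev})$, $\delta=(m\otimes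 \mathrm{id}_X)(\mathrm{id}_X\otimes\mathrm{coev})$; in $\mathrm{End}(X\otimes X)$: $\mathbf 1$ the identity, $U=\mathrm{coev}\circ\mathrm{ev}$, $I=\delta\circ m$, $H=(\mathrm{id}_X\otimes m)(\delta\otimes\mathrm{id}_X)$, $S=H\circ H$, $\sigma=c_{X,X}^{-1}$ (negative crossing, over-strand from bottom right to top left), $\sigma^{-1}=c_{X,X}$. (QEJac-$\alpha$) holds for $v\in\mathbb C\setminus\{0\}$, $\alpha\in\mathbb C$ if $v^{-3}H\sigma+vI-v^{-1}H+\alpha[\sigma+v^4U+v^{-4}\mathbf 1]=0$ and the elementary relations (E): $\mathrm{ev}\circ\mathrm{coev}=d$, $m\circ\mathrm{coev}=0$, $m\circ\delta=b\,\mathrm{id}_X$, $H\circ\delta=t\delta$, $\sigma\circ\delta=-v^6\delta$, $\sigma\circ\mathrm{coev}=v^{12}\mathrm{coev}$ hold for some scalars $d,b,t$. Notation (with $\lambda$ formal): $[k\lambda+n]=w^kv^n-w^{-k}v^{-n}$, $\{k\lambda+n\}=w^kv^n+w^{-k}v^{-n}$, $\Psi_1=v-v^{-1}$, $\Psi_2=v+v^{-1}$, $\Psi_3=v^2+1+v^{-2}$, $\Psi_4=v^2+v^{-2}$, $\Psi_6=v^2-1+v^{-2}$. $\mathsf{QExc}_{R,v,w}$, defined for a $\mathbb Q$-algebra $R$ and invertible $v,w\in R$ with $[\lambda],[\lambda-1],\Psi_1,\Psi_6$ invertible, is the ribbon category with objects the non-negative integers (points on a line), whose morphisms are $R$-linear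 combinations of framed unoriented knotted trivalent graph tangles (built from cups, caps, rotationally invariant trivalent vertices and braid crossings, up to isotopy), modulo (E) with $d=-\Psi_4[\lambda+5][\lambda-6]/([\lambda][\lambda-1])$, $b=\{\lambda+2\}\{\lambda-3\}\Psi_3$, $t=\Psi_2(\Psi_2\{2\lambda-1\}+v^4-v^2-1-v^{-2}+v^{-4})$, and $$v^{-3}H\sigma+vI-v^{-1}H-\tfrac{[\lambda][\lambda-1]}{\Psi_1}\left[\sigma+v^4U+v^{-4}\mathbf 1\right]=0,$$ $$S-\tfrac{\Psi_2\Psi_6^2[\lambda][\lambda-1]}{\Psi_1^2}\sigma+\tfrac{x_1}{\Psi_1}I+\tfrac{x_2}{\Psi_1}H+\tfrac{x_4}{\Psi_1^2}U+\tfrac{x_3}{\Psi_1^2}\mathbf 1=0,$$ $$\sigma-\sigma^{-1}+\tfrac{\Psi_1}{\Psi_6}(I-H)+\tfrac{\Psi_1[\lambda][\lambda-1]}{\Psi_6}(\mathbf 1-U)=0,$$ where $x_1=w^{-2}(1-v^2-v^4)+(v^{-4}-2v^{-2}+3v^2)+w^2(v^{-2}-1-v^2)$; $x_2=w^{-2}(v^{-2}+1-v^2)+(-3v^{-2}+2v^2-v^4)+w^2(v^{-4}+v^{-2}-1)$; $x_3=w^{-4}(v^{-2}-1)+w^{-2}(-2v^{-4}-v^{-2}+2-v^4)+(v^{-6}+4v^{-4}-2v^{-2}-1+v^2+v^4)+w^2(-2v^{-6}-v^{-4}+2v^{-2}-v^2)+w^4(v^{-6}-v^{-4})$; $x_4=w^{-4}(-v^4+v^6)+w^{-2}(-v^{-2}+2v^2-v^4-2v^6)+(v^{-4}+v^{-2}-1-2v^2+4v^4+v^6)+w^2(-v^{-4}+2-v^2-2v^4)+w^4(-1+v^2)$.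 *)

theory Defs
  imports Complex_Main "HOL-Algebra.Module" "HOL-Algebra.Algebraic_Closure_Type"
begin

no_notation Polynomials.var (\<open>X\<index>\<close>)

section \<open>Linear ribbon categories\<close>

text \<open>
  Monoidal categories are not assumed strict. Each hom-set is a module in the sense of
  HOL-Algebra; the ring multiplication and unit inherited by that record type are irrelevant.
  Composition and tensor product of morphisms are written without their objects; hom-sets are
  not required to be disjoint.
\<close>

record ('r, 'o, 'm) ribbon_structure =
  objs :: "'o set"
  hom_mod :: "'o \<Rightarrow> 'o \<Rightarrow> ('r, 'm) module"
  ident :: "'o \<Rightarrow> 'm" (\<open>\<^bold>i\<^bold>d\<index>\<close>)
  cmp :: "'m \<Rightarrow> 'm \<Rightarrow> 'm" (infixr \<open>\<^bold>\<circ>\<index>\<close> 70)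
  tens_ob :: "'o \<Rightarrow> 'o \<Rightarrow> 'o" (infixl \<open>\<^bold>\<star>\<index>\<close> 75)
  tens_mor :: "'m \<Rightarrow> 'm \<Rightarrow> 'm" (infixl \<open>\<^bold>\<otimes>\<index>\<close> 75)
  unit_ob :: 'o (\<open>\<^bold>1\<index>\<close>)
  assoc :: "'o \<Rightarrow> 'o \<Rightarrow> 'o \<Rightarrow> 'm" (\<open>\<a>\<index>\<close>)  \<comment> \<open>\<open>(a b) c \<rightarrow> a (b c)\<close>\<close>
  lunit :: "'o \<Rightarrow> 'm" (\<open>\<l>\<index>\<close>)  \<comment> \<open>\<open>1 a \<rightarrow> a\<close>\<close>
  runit :: "'o \<Rightarrow> 'm" (\<open>\<r>\<index>\<close>)  \<comment> \<open>\<open>a 1 \<rightarrow> a\<close>\<close>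
  braid :: "'o \<Rightarrow> 'o \<Rightarrow> 'm" (\<open>\<c>\<index>\<close>)  \<comment> \<open>\<open>a b \<rightarrow> b a\<close>\<close>
  twist :: "'o \<Rightarrow> 'm" (\<open>\<theta>\<index>\<close>)

locale ribbon_signature =
  fixes C :: "('r, 'o, 'm) ribbon_structure" (structure)
begin

abbreviation HOM :: "'o \<Rightarrow> 'o \<Rightarrow> 'm set" where
  "HOM a b \<equiv> carrier (hom_mod C a b)"

definition inverse_mor :: "'o \<Rightarrow> 'o \<Rightarrow> 'm \<Rightarrow> 'm \<Rightarrow> bool" where
  "inverse_mor a b f g \<longleftrightarrow> f \<in> HOM a b \<and> g \<in> HOM b a \<and> g \<^bold>\<circ> f = \<^bold>i\<^bold>d a \<and> f \<^bold>\<circ> g = \<^bold>i\<^bold>d b"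

definition is_iso :: "'o \<Rightarrow> 'o \<Rightarrow> 'm \<Rightarrow> bool" where
  "is_iso a b f \<longleftrightarrow> (\<exists>g. inverse_mor a b f g)"

definition inv_mor :: "'o \<Rightarrow> 'o \<Rightarrow> 'm \<Rightarrow> 'm" where
  "inv_mor a b f = (THE g. inverse_mor a b f g)"

definition assoc_inv :: "'o \<Rightarrow> 'o \<Rightarrow> 'o \<Rightarrow> 'm" where
  "assoc_inv a b c = inv_mor ((a \<^bold>\<star> b) \<^bold>\<star> c) (a \<^bold>\<star> (b \<^bold>\<star> c)) (\<a> a b c)"

definition lunit_inv :: "'o \<Rightarrow> 'm" where
  "lunit_inv a = inv_mor (\<^bold>1 \<^bold>\<star> a) a (\<l> a)"

definition runit_inv :: "'o \<Rightarrow> 'm" where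
  "runit_inv a = inv_mor (a \<^bold>\<star> \<^bold>1) a (\<r> a)"

definition braid_inv :: "'o \<Rightarrow> 'o \<Rightarrow> 'm" where
  "braid_inv a b = inv_mor (a \<^bold>\<star> b) (b \<^bold>\<star> a) (\<c> a b)"

definition twist_inv :: "'o \<Rightarrow> 'm" where
  "twist_inv a = inv_mor a a (\<theta> a)"

definition is_dual :: "'o \<Rightarrow> 'o \<Rightarrow> 'm \<Rightarrow> 'm \<Rightarrow> bool" where
  "is_dual a a' e k \<longleftrightarrow>
     e \<in> HOM (a' \<^bold>\<star> a) \<^bold>1 \<and> k \<in> HOM \<^bold>1 (a \<^bold>\<star> a') \<and>
     \<r> a \<^bold>\<circ> (\<^bold>i\<^bold>d a \<^bold>\<otimes> e) \<^bold>\<circ> \<a> a a' a \<^bold>\<circ> (k \<^bold>\<otimes> \<^bold>i\<^bold>d a) \<^bold>\<circ> lunit_inv a = \<^bold>i\<^bold>d a \<and>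
     \<l> a' \<^bold>\<circ> (e \<^bold>\<otimes> \<^bold>i\<^bold>d a') \<^bold>\<circ> assoc_inv a' a a' \<^bold>\<circ> (\<^bold>i\<^bold>d a' \<^bold>\<otimes> k) \<^bold>\<circ> runit_inv a' = \<^bold>i\<^bold>d a'"

definition dual_mor :: "'o \<Rightarrow> 'o \<Rightarrow> 'm \<Rightarrow> 'm \<Rightarrow> 'm \<Rightarrow> 'm" where
  "dual_mor a a' e k f =
     \<l> a' \<^bold>\<circ> (e \<^bold>\<otimes> \<^bold>i\<^bold>d a') \<^bold>\<circ> ((\<^bold>i\<^bold>d a' \<^bold>\<otimes> f) \<^bold>\<otimes> \<^bold>i\<^bold>d a') \<^bold>\<circ> assoc_inv a' a a' \<^bold>\<circ> (\<^bold>i\<^bold>d a' \<^bold>\<otimes> k) \<^bold>\<circ> runit_inv a'"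

text \<open>Left-nested tensor powers, with first power \<open>a\<close> itself rather than \<open>1 a\<close>.\<close>

fun tens_power :: "'o \<Rightarrow> nat \<Rightarrow> 'o" where
  "tens_power a 0 = \<^bold>1"
| "tens_power a (Suc 0) = a"
| "tens_power a (Suc (Suc n)) = tens_power a (Suc n) \<^bold>\<star> a"

end

locale linear_category = ribbon_signature C
  for R :: "('r, 'q) ring_scheme" and C :: "('r, 'o, 'm) ribbon_structure" (structure) +
  assumes scalars: "cring R"
    and hom_module: "\<lbrakk>a \<in> objs C; b \<in> objs C\<rbrakk> \<Longrightarrow> module R (hom_mod C a b)"
    and id_in: "a \<in> objs C \<Longrightarrow> \<^bold>i\<^bold>d a \<in> HOM a a"
    and comp_in: "\<lbrakk>a \<in> objs C; b \<in> objs C; c \<in> objs C; g \<in> HOM b c; f \<in> HOM a b\<rbrakk>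
      \<Longrightarrow> g \<^bold>\<circ> f \<in> HOM a c"
    and id_comp: "\<lbrakk>a \<in> objs C; b \<in> objs C; f \<in> HOM a b\<rbrakk> \<Longrightarrow> \<^bold>i\<^bold>d b \<^bold>\<circ> f = f"
    and comp_id: "\<lbrakk>a \<in> objs C; b \<in> objs C; f \<in> HOM a b\<rbrakk> \<Longrightarrow> f \<^bold>\<circ> \<^bold>i\<^bold>d a = f"
    and comp_assoc: "\<lbrakk>a \<in> objs C; b \<in> objs C; c \<in> objs C; d \<in> objs C;
        h \<in> HOM c d; g \<in> HOM b c; f \<in> HOM a b\<rbrakk> \<Longrightarrow> (h \<^bold>\<circ> g) \<^bold>\<circ> f = h \<^bold>\<circ> (g \<^bold>\<circ> f)"
    and comp_add_left: "\<lbrakk>a \<in> objs C; b \<in> objs C; c \<in> objs C;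
        g \<in> HOM b c; g' \<in> HOM b c; f \<in> HOM a b\<rbrakk>
      \<Longrightarrow> (g \<oplus>\<^bsub>hom_mod C b c\<^esub> g') \<^bold>\<circ> f = (g \<^bold>\<circ> f) \<oplus>\<^bsub>hom_mod C a c\<^esub> (g' \<^bold>\<circ> f)"
    and comp_add_right: "\<lbrakk>a \<in> objs C; b \<in> objs C; c \<in> objs C;
        g \<in> HOM b c; f \<in> HOM a b; f' \<in> HOM a b\<rbrakk>
      \<Longrightarrow> g \<^bold>\<circ> (f \<oplus>\<^bsub>hom_mod C a b\<^esub> f') = (g \<^bold>\<circ> f) \<oplus>\<^bsub>hom_mod C a c\<^esub> (g \<^bold>\<circ> f')"
    and comp_smult_left: "\<lbrakk>a \<in> objs C; b \<in> objs C; c \<in> objs C; r \<in> carrier R;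
        g \<in> HOM b c; f \<in> HOM a b\<rbrakk>
      \<Longrightarrow> (r \<odot>\<^bsub>hom_mod C b c\<^esub> g) \<^bold>\<circ> f = r \<odot>\<^bsub>hom_mod C a c\<^esub> (g \<^bold>\<circ> f)"
    and comp_smult_right: "\<lbrakk>a \<in> objs C; b \<in> objs C; c \<in> objs C; r \<in> carrier R;
        g \<in> HOM b c; f \<in> HOM a b\<rbrakk>
      \<Longrightarrow> g \<^bold>\<circ> (r \<odot>\<^bsub>hom_mod C a b\<^esub> f) = r \<odot>\<^bsub>hom_mod C a c\<^esub> (g \<^bold>\<circ> f)"

locale monoidal_linear_category = linear_category +
  assumes unit_in: "\<^bold>1 \<in> objs C"
    and tens_ob_in: "\<lbrakk>a \<in> objs C; b \<in> objs C\<rbrakk> \<Longrightarrow> a \<^bold>\<star> b \<in> objs C"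
    and tens_in: "\<lbrakk>a \<in> objs C; b \<in> objs C; c \<in> objs C; d \<in> objs C; f \<in> HOM a b; g \<in> HOM c d\<rbrakk>
      \<Longrightarrow> f \<^bold>\<otimes> g \<in> HOM (a \<^bold>\<star> c) (b \<^bold>\<star> d)"
    and tens_id: "\<lbrakk>a \<in> objs C; b \<in> objs C\<rbrakk> \<Longrightarrow> \<^bold>i\<^bold>d a \<^bold>\<otimes> \<^bold>i\<^bold>d b = \<^bold>i\<^bold>d (a \<^bold>\<star> b)"
    and interchange: "\<lbrakk>a \<in> objs C; b \<in> objs C; c \<in> objs C; a' \<in> objs C; b' \<in> objs C; c' \<in> objs C;
        f \<in> HOM a b; g \<in> HOM b c; f' \<in> HOM a' b'; g' \<in> HOM b' c'\<rbrakk>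
      \<Longrightarrow> (g \<^bold>\<circ> f) \<^bold>\<otimes> (g' \<^bold>\<circ> f') = (g \<^bold>\<otimes> g') \<^bold>\<circ> (f \<^bold>\<otimes> f')"
    and tens_add_left: "\<lbrakk>a \<in> objs C; b \<in> objs C; c \<in> objs C; d \<in> objs C;
        f \<in> HOM a b; f' \<in> HOM a b; g \<in> HOM c d\<rbrakk>
      \<Longrightarrow> (f \<oplus>\<^bsub>hom_mod C a b\<^esub> f') \<^bold>\<otimes> g =
          (f \<^bold>\<otimes> g) \<oplus>\<^bsub>hom_mod C (a \<^bold>\<star> c) (b \<^bold>\<star> d)\<^esub> (f' \<^bold>\<otimes> g)"
    and tens_add_right: "\<lbrakk>a \<in> objs C; b \<in> objs C; c \<in> objs C; d \<in> objs C;
        f \<in> HOM a b; g \<in> HOM c d; g' \<in> HOM c d\<rbrakk>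
      \<Longrightarrow> f \<^bold>\<otimes> (g \<oplus>\<^bsub>hom_mod C c d\<^esub> g') =
          (f \<^bold>\<otimes> g) \<oplus>\<^bsub>hom_mod C (a \<^bold>\<star> c) (b \<^bold>\<star> d)\<^esub> (f \<^bold>\<otimes> g')"
    and tens_smult_left: "\<lbrakk>a \<in> objs C; b \<in> objs C; c \<in> objs C; d \<in> objs C; r \<in> carrier R;
        f \<in> HOM a b; g \<in> HOM c d\<rbrakk>
      \<Longrightarrow> (r \<odot>\<^bsub>hom_mod C a b\<^esub> f) \<^bold>\<otimes> g = r \<odot>\<^bsub>hom_mod C (a \<^bold>\<star> c) (b \<^bold>\<star> d)\<^esub> (f \<^bold>\<otimes> g)"
    and tens_smult_right: "\<lbrakk>a \<in> objs C; b \<in> objs C; c \<in> objs C; d \<in> objs C; r \<in> carrier R;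
        f \<in> HOM a b; g \<in> HOM c d\<rbrakk>
      \<Longrightarrow> f \<^bold>\<otimes> (r \<odot>\<^bsub>hom_mod C c d\<^esub> g) = r \<odot>\<^bsub>hom_mod C (a \<^bold>\<star> c) (b \<^bold>\<star> d)\<^esub> (f \<^bold>\<otimes> g)"
    and assoc_iso: "\<lbrakk>a \<in> objs C; b \<in> objs C; c \<in> objs C\<rbrakk>
      \<Longrightarrow> is_iso ((a \<^bold>\<star> b) \<^bold>\<star> c) (a \<^bold>\<star> (b \<^bold>\<star> c)) (\<a> a b c)"
    and lunit_iso: "a \<in> objs C \<Longrightarrow> is_iso (\<^bold>1 \<^bold>\<star> a) a (\<l> a)"
    and runit_iso: "a \<in> objs C \<Longrightarrow> is_iso (a \<^bold>\<star> \<^bold>1) a (\<r> a)"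
    and assoc_natural: "\<lbrakk>a \<in> objs C; b \<in> objs C; c \<in> objs C; a' \<in> objs C; b' \<in> objs C; c' \<in> objs C;
        f \<in> HOM a a'; g \<in> HOM b b'; h \<in> HOM c c'\<rbrakk>
      \<Longrightarrow> \<a> a' b' c' \<^bold>\<circ> ((f \<^bold>\<otimes> g) \<^bold>\<otimes> h) = (f \<^bold>\<otimes> (g \<^bold>\<otimes> h)) \<^bold>\<circ> \<a> a b c"
    and lunit_natural: "\<lbrakk>a \<in> objs C; b \<in> objs C; f \<in> HOM a b\<rbrakk> \<Longrightarrow> \<l> b \<^bold>\<circ> (\<^bold>i\<^bold>d \<^bold>1 \<^bold>\<otimes> f) = f \<^bold>\<circ> \<l> a"
    and runit_natural: "\<lbrakk>a \<in> objs C; b \<in> objs C; f \<in> HOM a b\<rbrakk> \<Longrightarrow> \<r> b \<^bold>\<circ> (f \<^bold>\<otimes> \<^bold>i\<^bold>d \<^bold>1) = f \<^bold>\<circ> \<r> a"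
    and pentagon: "\<lbrakk>a \<in> objs C; b \<in> objs C; c \<in> objs C; d \<in> objs C\<rbrakk>
      \<Longrightarrow> (\<^bold>i\<^bold>d a \<^bold>\<otimes> \<a> b c d) \<^bold>\<circ> \<a> a (b \<^bold>\<star> c) d \<^bold>\<circ> (\<a> a b c \<^bold>\<otimes> \<^bold>i\<^bold>d d) =
          \<a> a b (c \<^bold>\<star> d) \<^bold>\<circ> \<a> (a \<^bold>\<star> b) c d"
    and triangle: "\<lbrakk>a \<in> objs C; b \<in> objs C\<rbrakk>
      \<Longrightarrow> (\<^bold>i\<^bold>d a \<^bold>\<otimes> \<l> b) \<^bold>\<circ> \<a> a \<^bold>1 b = \<r> a \<^bold>\<otimes> \<^bold>i\<^bold>d b"

locale braided_linear_category = monoidal_linear_category +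
  assumes braid_iso: "\<lbrakk>a \<in> objs C; b \<in> objs C\<rbrakk> \<Longrightarrow> is_iso (a \<^bold>\<star> b) (b \<^bold>\<star> a) (\<c> a b)"
    and braid_natural: "\<lbrakk>a \<in> objs C; b \<in> objs C; a' \<in> objs C; b' \<in> objs C;
        f \<in> HOM a a'; g \<in> HOM b b'\<rbrakk> \<Longrightarrow> \<c> a' b' \<^bold>\<circ> (f \<^bold>\<otimes> g) = (g \<^bold>\<otimes> f) \<^bold>\<circ> \<c> a b"
    and hexagon_left: "\<lbrakk>a \<in> objs C; b \<in> objs C; c \<in> objs C\<rbrakk>
      \<Longrightarrow> \<a> b c a \<^bold>\<circ> \<c> a (b \<^bold>\<star> c) \<^bold>\<circ> \<a> a b c =
          (\<^bold>i\<^bold>d b \<^bold>\<otimes> \<c> a c) \<^bold>\<circ> \<a> b a c \<^bold>\<circ> (\<c> a b \<^bold>\<otimes> \<^bold>i\<^bold>d c)"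
    and hexagon_right: "\<lbrakk>a \<in> objs C; b \<in> objs C; c \<in> objs C\<rbrakk>
      \<Longrightarrow> assoc_inv c a b \<^bold>\<circ> \<c> (a \<^bold>\<star> b) c \<^bold>\<circ> assoc_inv a b c =
          (\<c> a c \<^bold>\<otimes> \<^bold>i\<^bold>d b) \<^bold>\<circ> assoc_inv a c b \<^bold>\<circ> (\<^bold>i\<^bold>d a \<^bold>\<otimes> \<c> b c)"

locale ribbon_category = braided_linear_category +
  assumes twist_iso: "a \<in> objs C \<Longrightarrow> is_iso a a (\<theta> a)"
    and twist_natural: "\<lbrakk>a \<in> objs C; b \<in> objs C; f \<in> HOM a b\<rbrakk> \<Longrightarrow> \<theta> b \<^bold>\<circ> f = f \<^bold>\<circ> \<theta> a"
    and twist_tens: "\<lbrakk>a \<in> objs C; b \<in> objs C\<rbrakk>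
      \<Longrightarrow> \<theta> (a \<^bold>\<star> b) = \<c> b a \<^bold>\<circ> \<c> a b \<^bold>\<circ> (\<theta> a \<^bold>\<otimes> \<theta> b)"
    and duals: "a \<in> objs C
      \<Longrightarrow> \<exists>a' \<in> objs C. \<exists>e k. is_dual a a' e k \<and> \<theta> a' = dual_mor a a' e k (\<theta> a)"

text \<open>
  A ribbon functor is a braided strong monoidal functor \<open>(F, J, J\<^sub>0)\<close> that preserves the twist;
  it automatically preserves duals, up to canonical isomorphism.
\<close>

locale ribbon_functor =
  C: ribbon_signature C + D: ribbon_signature D
  for R :: "('r, 'q) ring_scheme"
    and C :: "('r, 'o, 'm) ribbon_structure" and D :: "('r, 'p, 'n) ribbon_structure"
    and Fo :: "'o \<Rightarrow> 'p" and Fm :: "'m \<Rightarrow> 'n" and J :: "'o \<Rightarrow> 'o \<Rightarrow> 'n" and J0 :: 'n +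
  assumes F_ob: "a \<in> objs C \<Longrightarrow> Fo a \<in> objs D"
    and F_in: "\<lbrakk>a \<in> objs C; b \<in> objs C; f \<in> C.HOM a b\<rbrakk> \<Longrightarrow> Fm f \<in> D.HOM (Fo a) (Fo b)"
    and F_id: "a \<in> objs C \<Longrightarrow> Fm (\<^bold>i\<^bold>d\<^bsub>C\<^esub> a) = \<^bold>i\<^bold>d\<^bsub>D\<^esub> (Fo a)"
    and F_comp: "\<lbrakk>a \<in> objs C; b \<in> objs C; c \<in> objs C; g \<in> C.HOM b c; f \<in> C.HOM a b\<rbrakk>
      \<Longrightarrow> Fm (g \<^bold>\<circ>\<^bsub>C\<^esub> f) = Fm g \<^bold>\<circ>\<^bsub>D\<^esub> Fm f"
    and F_add: "\<lbrakk>a \<in> objs C; b \<in> objs C; f \<in> C.HOM a b; g \<in> C.HOM a b\<rbrakk>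
      \<Longrightarrow> Fm (f \<oplus>\<^bsub>hom_mod C a b\<^esub> g) = Fm f \<oplus>\<^bsub>hom_mod D (Fo a) (Fo b)\<^esub> Fm g"
    and F_smult: "\<lbrakk>a \<in> objs C; b \<in> objs C; r \<in> carrier R; f \<in> C.HOM a b\<rbrakk>
      \<Longrightarrow> Fm (r \<odot>\<^bsub>hom_mod C a b\<^esub> f) = r \<odot>\<^bsub>hom_mod D (Fo a) (Fo b)\<^esub> Fm f"
    and J_iso: "\<lbrakk>a \<in> objs C; b \<in> objs C\<rbrakk>
      \<Longrightarrow> D.is_iso (Fo a \<^bold>\<star>\<^bsub>D\<^esub> Fo b) (Fo (a \<^bold>\<star>\<^bsub>C\<^esub> b)) (J a b)"
    and J0_iso: "D.is_iso (\<^bold>1\<^bsub>D\<^esub>) (Fo (\<^bold>1\<^bsub>C\<^esub>)) J0"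
    and J_natural: "\<lbrakk>a \<in> objs C; b \<in> objs C; a' \<in> objs C; b' \<in> objs C;
        f \<in> C.HOM a a'; g \<in> C.HOM b b'\<rbrakk>
      \<Longrightarrow> Fm (f \<^bold>\<otimes>\<^bsub>C\<^esub> g) \<^bold>\<circ>\<^bsub>D\<^esub> J a b = J a' b' \<^bold>\<circ>\<^bsub>D\<^esub> (Fm f \<^bold>\<otimes>\<^bsub>D\<^esub> Fm g)"
    and J_assoc: "\<lbrakk>a \<in> objs C; b \<in> objs C; c \<in> objs C\<rbrakk>
      \<Longrightarrow> Fm (\<a>\<^bsub>C\<^esub> a b c) \<^bold>\<circ>\<^bsub>D\<^esub> J (a \<^bold>\<star>\<^bsub>C\<^esub> b) c \<^bold>\<circ>\<^bsub>D\<^esub> (J a b \<^bold>\<otimes>\<^bsub>D\<^esub> \<^bold>i\<^bold>d\<^bsub>D\<^esub> (Fo c)) =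
          J a (b \<^bold>\<star>\<^bsub>C\<^esub> c) \<^bold>\<circ>\<^bsub>D\<^esub> (\<^bold>i\<^bold>d\<^bsub>D\<^esub> (Fo a) \<^bold>\<otimes>\<^bsub>D\<^esub> J b c) \<^bold>\<circ>\<^bsub>D\<^esub> \<a>\<^bsub>D\<^esub> (Fo a) (Fo b) (Fo c)"
    and J_lunit: "a \<in> objs C
      \<Longrightarrow> Fm (\<l>\<^bsub>C\<^esub> a) \<^bold>\<circ>\<^bsub>D\<^esub> J (\<^bold>1\<^bsub>C\<^esub>) a \<^bold>\<circ>\<^bsub>D\<^esub> (J0 \<^bold>\<otimes>\<^bsub>D\<^esub> \<^bold>i\<^bold>d\<^bsub>D\<^esub> (Fo a)) = \<l>\<^bsub>D\<^esub> (Fo a)"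
    and J_runit: "a \<in> objs C
      \<Longrightarrow> Fm (\<r>\<^bsub>C\<^esub> a) \<^bold>\<circ>\<^bsub>D\<^esub> J a (\<^bold>1\<^bsub>C\<^esub>) \<^bold>\<circ>\<^bsub>D\<^esub> (\<^bold>i\<^bold>d\<^bsub>D\<^esub> (Fo a) \<^bold>\<otimes>\<^bsub>D\<^esub> J0) = \<r>\<^bsub>D\<^esub> (Fo a)"
    and F_braid: "\<lbrakk>a \<in> objs C; b \<in> objs C\<rbrakk>
      \<Longrightarrow> Fm (\<c>\<^bsub>C\<^esub> a b) \<^bold>\<circ>\<^bsub>D\<^esub> J a b = J b a \<^bold>\<circ>\<^bsub>D\<^esub> \<c>\<^bsub>D\<^esub> (Fo a) (Fo b)"
    and F_twist: "a \<in> objs C \<Longrightarrow> Fm (\<theta>\<^bsub>C\<^esub> a) = \<theta>\<^bsub>D\<^esub> (Fo a)"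


section \<open>Trivalent ribbon categories\<close>

definition free_rank1_on ::
    "('r, 'q) ring_scheme \<Rightarrow> ('r, 'm, 'z) module_scheme \<Rightarrow> 'm \<Rightarrow> bool" where
  "free_rank1_on R M g \<longleftrightarrow>
     g \<in> carrier M \<and> bij_betw (\<lambda>r. r \<odot>\<^bsub>M\<^esub> g) (carrier R) (carrier M)"

definition finite_basis ::
    "('r, 'q) ring_scheme \<Rightarrow> ('r, 'm, 'z) module_scheme \<Rightarrow> 'm set \<Rightarrow> bool" where
  "finite_basis R M B \<longleftrightarrow> finite B \<and> B \<subseteq> carrier M \<and>
     (\<forall>x \<in> carrier M. \<exists>!f. f \<in> B \<rightarrow>\<^sub>E carrier R \<and> x = (\<Oplus>\<^bsub>M\<^esub>b\<in>B. f b \<odot>\<^bsub>M\<^esub> b))"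

text \<open>For vector spaces: finite dimension at most \<open>n\<close>.\<close>

definition dim_at_most ::
    "('r, 'q) ring_scheme \<Rightarrow> ('r, 'm, 'z) module_scheme \<Rightarrow> nat \<Rightarrow> bool" where
  "dim_at_most R M n \<longleftrightarrow> (\<exists>B. finite_basis R M B \<and> card B \<le> n)"

locale trivalent_signature = ribbon_signature C
  for C :: "('r, 'o, 'm) ribbon_structure" (structure) +
  fixes X :: 'o and ev coev \<tau> :: 'm
begin

definition hom_pow :: "nat \<Rightarrow> ('r, 'm) module" where  \<comment> \<open>the space written \<open>C(n)\<close>\<close>
  "hom_pow n = hom_mod C (tens_power X n) \<^bold>1"

definition merge :: 'm where  \<comment> \<open>\<open>m : X X \<rightarrow> X\<close>\<close>
  "merge = \<l> X \<^bold>\<circ> (\<tau> \<^bold>\<otimes> \<^bold>i\<^bold>d X) \<^bold>\<circ> assoc_inv (X \<^bold>\<star> X) X X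
     \<^bold>\<circ> (\<^bold>i\<^bold>d (X \<^bold>\<star> X) \<^bold>\<otimes> coev) \<^bold>\<circ> runit_inv (X \<^bold>\<star> X)"

definition split :: 'm where  \<comment> \<open>\<open>\<delta> : X \<rightarrow> X X\<close>\<close>
  "split = (merge \<^bold>\<otimes> \<^bold>i\<^bold>d X) \<^bold>\<circ> assoc_inv X X X \<^bold>\<circ> (\<^bold>i\<^bold>d X \<^bold>\<otimes> coev) \<^bold>\<circ> runit_inv X"

definition E2 :: "('r, 'm) module" where
  "E2 = hom_mod C (X \<^bold>\<star> X) (X \<^bold>\<star> X)"

definition One2 :: 'm where "One2 = \<^bold>i\<^bold>d (X \<^bold>\<star> X)"
definition Umor :: 'm where "Umor = coev \<^bold>\<circ> ev"
definition Imor :: 'm where "Imor = split \<^bold>\<circ> merge"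
definition Hmor :: 'm where "Hmor = (\<^bold>i\<^bold>d X \<^bold>\<otimes> merge) \<^bold>\<circ> \<a> X X X \<^bold>\<circ> (split \<^bold>\<otimes> \<^bold>i\<^bold>d X)"
definition \<sigma> :: 'm where "\<sigma> = braid_inv X X"

inductive generated_ob :: "'o \<Rightarrow> bool" where
  "generated_ob \<^bold>1"
| "generated_ob X"
| "\<lbrakk>generated_ob a; generated_ob b\<rbrakk> \<Longrightarrow> generated_ob (a \<^bold>\<star> b)"

text \<open>
  The morphisms of the ribbon subcategory, linear over the scalars \<open>K\<close>, generated by \<open>\<tau>\<close> and
  the self-duality.
\<close>

inductive generated_mor :: "'r set \<Rightarrow> 'o \<Rightarrow> 'o \<Rightarrow> 'm \<Rightarrow> bool"
  for K :: "'r set" where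
  "generated_mor K (X \<^bold>\<star> X \<^bold>\<star> X) \<^bold>1 \<tau>"
| "generated_mor K (X \<^bold>\<star> X) \<^bold>1 ev"
| "generated_mor K \<^bold>1 (X \<^bold>\<star> X) coev"
| "generated_ob a \<Longrightarrow> generated_mor K a a (\<^bold>i\<^bold>d a)"
| "\<lbrakk>generated_ob a; generated_ob b; generated_ob c\<rbrakk>
    \<Longrightarrow> generated_mor K (a \<^bold>\<star> b \<^bold>\<star> c) (a \<^bold>\<star> (b \<^bold>\<star> c)) (\<a> a b c)"
| "\<lbrakk>generated_ob a; generated_ob b; generated_ob c\<rbrakk>
    \<Longrightarrow> generated_mor K (a \<^bold>\<star> (b \<^bold>\<star> c)) (a \<^bold>\<star> b \<^bold>\<star> c) (assoc_inv a b c)"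
| "generated_ob a \<Longrightarrow> generated_mor K (\<^bold>1 \<^bold>\<star> a) a (\<l> a)"
| "generated_ob a \<Longrightarrow> generated_mor K a (\<^bold>1 \<^bold>\<star> a) (lunit_inv a)"
| "generated_ob a \<Longrightarrow> generated_mor K (a \<^bold>\<star> \<^bold>1) a (\<r> a)"
| "generated_ob a \<Longrightarrow> generated_mor K a (a \<^bold>\<star> \<^bold>1) (runit_inv a)"
| "\<lbrakk>generated_ob a; generated_ob b\<rbrakk> \<Longrightarrow> generated_mor K (a \<^bold>\<star> b) (b \<^bold>\<star> a) (\<c> a b)"
| "\<lbrakk>generated_ob a; generated_ob b\<rbrakk> \<Longrightarrow> generated_mor K (b \<^bold>\<star> a) (a \<^bold>\<star> b) (braid_inv a b)"
| "generated_ob a \<Longrightarrow> generated_mor K a a (\<theta> a)"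
| "generated_ob a \<Longrightarrow> generated_mor K a a (twist_inv a)"
| "\<lbrakk>generated_mor K a b f; generated_mor K b c g\<rbrakk> \<Longrightarrow> generated_mor K a c (g \<^bold>\<circ> f)"
| "\<lbrakk>generated_mor K a b f; generated_mor K c d g\<rbrakk> \<Longrightarrow> generated_mor K (a \<^bold>\<star> c) (b \<^bold>\<star> d) (f \<^bold>\<otimes> g)"
| "\<lbrakk>generated_ob a; generated_ob b\<rbrakk> \<Longrightarrow> generated_mor K a b \<zero>\<^bsub>hom_mod C a b\<^esub>"
| "\<lbrakk>generated_mor K a b f; generated_mor K a b g\<rbrakk> \<Longrightarrow> generated_mor K a b (f \<oplus>\<^bsub>hom_mod C a b\<^esub> g)"
| "\<lbrakk>r \<in> K; generated_mor K a b f\<rbrakk> \<Longrightarrow> generated_mor K a b (r \<odot>\<^bsub>hom_mod C a b\<^esub> f)"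

end

text \<open>
  Symmetry of the self-duality and rotational invariance of \<open>\<tau>\<close> are consequences of these axioms.
  Being generated by \<open>\<tau>\<close> constrains the morphisms between tensor products of \<open>X\<close>; it is
  not required that \<open>C\<close> has no further objects.
\<close>

locale trivalent_ribbon_category = ribbon_category R C + trivalent_signature C X ev coev \<tau>
  for R :: "('r, 'q) ring_scheme" and C :: "('r, 'o, 'm) ribbon_structure" (structure)
    and X :: 'o and ev coev \<tau> :: 'm +
  assumes X_in: "X \<in> objs C"
    and self_dual: "is_dual X X ev coev"
    and hom_pow_1: "carrier (hom_pow 1) = {\<zero>\<^bsub>hom_pow 1\<^esub>}"
    and hom_pow_0: "free_rank1_on R (hom_pow 0) (\<^bold>i\<^bold>d \<^bold>1)"
    and hom_pow_2: "free_rank1_on R (hom_pow 2) ev"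
    and hom_pow_3: "free_rank1_on R (hom_pow 3) \<tau>"
    and generated: "\<lbrakk>generated_ob a; generated_ob b; f \<in> HOM a b\<rbrakk> \<Longrightarrow> generated_mor (carrier R) a b f"
    and circle_nonzero:
      "\<exists>d \<in> carrier R. d \<noteq> \<zero>\<^bsub>R\<^esub> \<and> ev \<^bold>\<circ> coev = d \<odot>\<^bsub>hom_mod C \<^bold>1 \<^bold>1\<^esub> \<^bold>i\<^bold>d \<^bold>1"
    and bigon_nonzero:
      "\<exists>b \<in> carrier R. b \<noteq> \<zero>\<^bsub>R\<^esub> \<and> merge \<^bold>\<circ> split = b \<odot>\<^bsub>hom_mod C X X\<^esub> \<^bold>i\<^bold>d X"


section \<open>The relation QEJac over the complex numbers\<close>

locale complex_trivalent_signature = trivalent_signature C X ev coev \<tau>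
  for C :: "(complex, 'o, 'm) ribbon_structure" (structure) and X :: 'o and ev coev \<tau> :: 'm
begin

definition elementary_relations :: "complex \<Rightarrow> complex \<Rightarrow> complex \<Rightarrow> complex \<Rightarrow> bool" where
  "elementary_relations v d b t \<longleftrightarrow>
     ev \<^bold>\<circ> coev = d \<odot>\<^bsub>hom_mod C \<^bold>1 \<^bold>1\<^esub> \<^bold>i\<^bold>d \<^bold>1 \<and>
     merge \<^bold>\<circ> coev = \<zero>\<^bsub>hom_mod C \<^bold>1 X\<^esub> \<and>
     merge \<^bold>\<circ> split = b \<odot>\<^bsub>hom_mod C X X\<^esub> \<^bold>i\<^bold>d X \<and>
     Hmor \<^bold>\<circ> split = t \<odot>\<^bsub>hom_mod C X (X \<^bold>\<star> X)\<^esub> split \<and>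
     \<sigma> \<^bold>\<circ> split = (- (v ^ 6)) \<odot>\<^bsub>hom_mod C X (X \<^bold>\<star> X)\<^esub> split \<and>
     \<sigma> \<^bold>\<circ> coev = (v ^ 12) \<odot>\<^bsub>hom_mod C \<^bold>1 (X \<^bold>\<star> X)\<^esub> coev"

definition QEJac :: "complex \<Rightarrow> complex \<Rightarrow> bool" where
  "QEJac v \<alpha> \<longleftrightarrow> v \<noteq> 0 \<and>
     (v powi (-3)) \<odot>\<^bsub>E2\<^esub> (Hmor \<^bold>\<circ> \<sigma>) \<oplus>\<^bsub>E2\<^esub> v \<odot>\<^bsub>E2\<^esub> Imor \<oplus>\<^bsub>E2\<^esub> (- (v powi (-1))) \<odot>\<^bsub>E2\<^esub> Hmor
       \<oplus>\<^bsub>E2\<^esub> \<alpha> \<odot>\<^bsub>E2\<^esub> (\<sigma> \<oplus>\<^bsub>E2\<^esub> (v ^ 4) \<odot>\<^bsub>E2\<^esub> Umor \<oplus>\<^bsub>E2\<^esub> (v powi (-4)) \<odot>\<^bsub>E2\<^esub> One2)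
     = \<zero>\<^bsub>E2\<^esub> \<and>
     (\<exists>d b t. elementary_relations v d b t)"

end


section \<open>The category QExc over the complex numbers\<close>

text \<open>
  Formal linear combinations of tangle diagrams, built by composition (vertical stacking,
  \<open>f \<cdot> g\<close> is \<open>f\<close> on top of \<open>g\<close>) and juxtaposition \<open>f \<parallel> g\<close>. \<open>Neg\<close> is the negative crossing
  written \<open>\<sigma>\<close> (over-strand from bottom right to top left) and \<open>Pos\<close> its inverse, which
  is the braiding.
\<close>

datatype tangle =
    Strands nat
  | Cap
  | Cup
  | Vertex
  | Neg
  | Pos
  | Stack tangle tangle (infixr \<open>\<cdot>\<close> 70)
  | Beside tangle tangle (infixr \<open>\<parallel>\<close> 75)
  | Null nat nat
  | Plus tangle tangle (infixl \<open>+\<^sub>t\<close> 65)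
  | Scale complex tangle (infixr \<open>*\<^sub>t\<close> 68)

inductive arity :: "tangle \<Rightarrow> nat \<Rightarrow> nat \<Rightarrow> bool" where
  "arity (Strands n) n n"
| "arity Cap 2 0"
| "arity Cup 0 2"
| "arity Vertex 3 0"
| "arity Neg 2 2"
| "arity Pos 2 2"
| "\<lbrakk>arity f l n; arity g m l\<rbrakk> \<Longrightarrow> arity (f \<cdot> g) m n"
| "\<lbrakk>arity f m n; arity g m' n'\<rbrakk> \<Longrightarrow> arity (f \<parallel> g) (m + m') (n + n')"
| "arity (Null m n) m n"
| "\<lbrakk>arity f m n; arity g m n\<rbrakk> \<Longrightarrow> arity (f +\<^sub>t g) m n"
| "arity f m n \<Longrightarrow> arity (c *\<^sub>t f) m n"

definition t_merge :: tangle where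
  "t_merge = (Vertex \<parallel> Strands 1) \<cdot> (Strands 2 \<parallel> Cup)"
definition t_split :: tangle where
  "t_split = (t_merge \<parallel> Strands 1) \<cdot> (Strands 1 \<parallel> Cup)"
definition t_U :: tangle where "t_U = Cup \<cdot> Cap"
definition t_I :: tangle where "t_I = t_split \<cdot> t_merge"
definition t_H :: tangle where "t_H = (Strands 1 \<parallel> t_merge) \<cdot> (t_split \<parallel> Strands 1)"
definition t_S :: tangle where "t_S = t_H \<cdot> t_H"

text \<open>
  Axioms of a strict linear monoidal category. (Ill-typed instances are discarded by the rule
  \<open>step\<close> of \<open>qexc_eq\<close> below.)
\<close>

inductive monoidal_axiom :: "tangle \<Rightarrow> tangle \<Rightarrow> bool" where
  "monoidal_axiom ((f \<cdot> g) \<cdot> h) (f \<cdot> (g \<cdot> h))"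
| "monoidal_axiom (Strands n \<cdot> f) f"
| "monoidal_axiom (f \<cdot> Strands n) f"
| "monoidal_axiom ((f \<parallel> g) \<parallel> h) (f \<parallel> (g \<parallel> h))"
| "monoidal_axiom (Strands 0 \<parallel> f) f"
| "monoidal_axiom (f \<parallel> Strands 0) f"
| "monoidal_axiom (Strands m \<parallel> Strands n) (Strands (m + n))"
| "\<lbrakk>arity f b c; arity g a b; arity f' b' c'; arity g' a' b'\<rbrakk>
    \<Longrightarrow> monoidal_axiom ((f \<cdot> g) \<parallel> (f' \<cdot> g')) ((f \<parallel> f') \<cdot> (g \<parallel> g'))"

inductive linear_axiom :: "tangle \<Rightarrow> tangle \<Rightarrow> bool" where
  "linear_axiom ((f +\<^sub>t g) +\<^sub>t h) (f +\<^sub>t (g +\<^sub>t h))"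
| "linear_axiom (f +\<^sub>t g) (g +\<^sub>t f)"
| "linear_axiom (Null m n +\<^sub>t f) f"
| "linear_axiom (0 *\<^sub>t f) (Null m n)"
| "linear_axiom (1 *\<^sub>t f) f"
| "linear_axiom ((c * d) *\<^sub>t f) (c *\<^sub>t d *\<^sub>t f)"
| "linear_axiom ((c + d) *\<^sub>t f) ((c *\<^sub>t f) +\<^sub>t (d *\<^sub>t f))"
| "linear_axiom (c *\<^sub>t (f +\<^sub>t g)) ((c *\<^sub>t f) +\<^sub>t (c *\<^sub>t g))"
| "linear_axiom ((f +\<^sub>t g) \<cdot> h) ((f \<cdot> h) +\<^sub>t (g \<cdot> h))"
| "linear_axiom (f \<cdot> (g +\<^sub>t h)) ((f \<cdot> g) +\<^sub>t (f \<cdot> h))"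
| "linear_axiom ((c *\<^sub>t f) \<cdot> g) (c *\<^sub>t (f \<cdot> g))"
| "linear_axiom (f \<cdot> (c *\<^sub>t g)) (c *\<^sub>t (f \<cdot> g))"
| "linear_axiom ((f +\<^sub>t g) \<parallel> h) ((f \<parallel> h) +\<^sub>t (g \<parallel> h))"
| "linear_axiom (f \<parallel> (g +\<^sub>t h)) ((f \<parallel> g) +\<^sub>t (f \<parallel> h))"
| "linear_axiom ((c *\<^sub>t f) \<parallel> g) (c *\<^sub>t (f \<parallel> g))"
| "linear_axiom (f \<parallel> (c *\<^sub>t g)) (c *\<^sub>t (f \<parallel> g))"

text \<open>
  Isotopy of framed unoriented trivalent tangles, as moves on blackboard-framed diagrams:
  straightening, rotation of the vertex, second and third Reidemeister moves, equality of the
  two curls with the same writhe (framed first Reidemeister move), and passing a strand over or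
  under a cap or a vertex. The remaining moves (passing a strand across a cup, for instance)
  follow.
\<close>

inductive isotopy_move :: "tangle \<Rightarrow> tangle \<Rightarrow> bool" where
  zigzag_left: "isotopy_move ((Cap \<parallel> Strands 1) \<cdot> (Strands 1 \<parallel> Cup)) (Strands 1)"
| zigzag_right: "isotopy_move ((Strands 1 \<parallel> Cap) \<cdot> (Cup \<parallel> Strands 1)) (Strands 1)"
| rotate_vertex: "isotopy_move (Cap \<cdot> (Strands 1 \<parallel> t_merge)) Vertex"
| R2_left: "isotopy_move (Neg \<cdot> Pos) (Strands 2)"
| R2_right: "isotopy_move (Pos \<cdot> Neg) (Strands 2)"
| R3: "isotopy_move
    ((Neg \<parallel> Strands 1) \<cdot> (Strands 1 \<parallel> Neg) \<cdot> (Neg \<parallel> Strands 1))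
    ((Strands 1 \<parallel> Neg) \<cdot> (Neg \<parallel> Strands 1) \<cdot> (Strands 1 \<parallel> Neg))"
| framed_R1: "isotopy_move
    ((Strands 1 \<parallel> Cap) \<cdot> (Neg \<parallel> Strands 1) \<cdot> (Strands 1 \<parallel> Cup))
    ((Cap \<parallel> Strands 1) \<cdot> (Strands 1 \<parallel> Neg) \<cdot> (Cup \<parallel> Strands 1))"
| slide_cap: "x \<in> {Neg, Pos} \<Longrightarrow> isotopy_move
    ((Cap \<parallel> Strands 1) \<cdot> (Strands 1 \<parallel> x) \<cdot> (x \<parallel> Strands 1))
    (Strands 1 \<parallel> Cap)"
| slide_vertex: "x \<in> {Neg, Pos} \<Longrightarrow> isotopy_move
    ((Vertex \<parallel> Strands 1) \<cdot> (Strands 2 \<parallel> x) \<cdot> (Strands 1 \<parallel> x \<parallel> Strands 1) \<cdot> (x \<parallel> Strands 2))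
    (Strands 1 \<parallel> Vertex)"

text \<open>\<open>qnum v w k n\<close> is \<open>[k\<lambda>+n]\<close> and \<open>qsum v w k n\<close> is \<open>{k\<lambda>+n}\<close>.\<close>

definition qnum :: "complex \<Rightarrow> complex \<Rightarrow> int \<Rightarrow> int \<Rightarrow> complex" where
  "qnum v w k n = w powi k * v powi n - w powi (-k) * v powi (-n)"
definition qsum :: "complex \<Rightarrow> complex \<Rightarrow> int \<Rightarrow> int \<Rightarrow> complex" where
  "qsum v w k n = w powi k * v powi n + w powi (-k) * v powi (-n)"

definition "\<Psi>1" :: "complex \<Rightarrow> complex" where "\<Psi>1 v = v - v powi (-1)"
definition "\<Psi>2" :: "complex \<Rightarrow> complex" where "\<Psi>2 v = v + v powi (-1)"
definition "\<Psi>3" :: "complex \<Rightarrow> complex" where "\<Psi>3 v = v^2 + 1 + v powi (-2)"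
definition "\<Psi>4" :: "complex \<Rightarrow> complex" where "\<Psi>4 v = v^2 + v powi (-2)"
definition "\<Psi>6" :: "complex \<Rightarrow> complex" where "\<Psi>6 v = v^2 - 1 + v powi (-2)"

definition qexc_admissible :: "complex \<Rightarrow> complex \<Rightarrow> bool" where
  "qexc_admissible v w \<longleftrightarrow> v \<noteq> 0 \<and> w \<noteq> 0 \<and>
     qnum v w 1 0 \<noteq> 0 \<and> qnum v w 1 (-1) \<noteq> 0 \<and> \<Psi>1 v \<noteq> 0 \<and> \<Psi>6 v \<noteq> 0"

definition qexc_d :: "complex \<Rightarrow> complex \<Rightarrow> complex" where
  "qexc_d v w = - (\<Psi>4 v * qnum v w 1 5 * qnum v w 1 (-6)) / (qnum v w 1 0 * qnum v w 1 (-1))"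
definition qexc_b :: "complex \<Rightarrow> complex \<Rightarrow> complex" where
  "qexc_b v w = qsum v w 1 2 * qsum v w 1 (-3) * \<Psi>3 v"
definition qexc_t :: "complex \<Rightarrow> complex \<Rightarrow> complex" where
  "qexc_t v w = \<Psi>2 v * (\<Psi>2 v * qsum v w 2 (-1) + v^4 - v^2 - 1 - v powi (-2) + v powi (-4))"

definition qexc_x1 :: "complex \<Rightarrow> complex \<Rightarrow> complex" where
  "qexc_x1 v w = w powi (-2) * (1 - v^2 - v^4)
     + (v powi (-4) - 2 * v powi (-2) + 3 * v^2)
     + w^2 * (v powi (-2) - 1 - v^2)"
definition qexc_x2 :: "complex \<Rightarrow> complex \<Rightarrow> complex" where
  "qexc_x2 v w = w powi (-2) * (v powi (-2) + 1 - v^2)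
     + (- 3 * v powi (-2) + 2 * v^2 - v^4)
     + w^2 * (v powi (-4) + v powi (-2) - 1)"
definition qexc_x3 :: "complex \<Rightarrow> complex \<Rightarrow> complex" where
  "qexc_x3 v w = w powi (-4) * (v powi (-2) - 1)
     + w powi (-2) * (- 2 * v powi (-4) - v powi (-2) + 2 - v^4)
     + (v powi (-6) + 4 * v powi (-4) - 2 * v powi (-2) - 1 + v^2 + v^4)
     + w^2 * (- 2 * v powi (-6) - v powi (-4) + 2 * v powi (-2) - v^2)
     + w^4 * (v powi (-6) - v powi (-4))"
definition qexc_x4 :: "complex \<Rightarrow> complex \<Rightarrow> complex" where
  "qexc_x4 v w = w powi (-4) * (- (v^4) + v^6)
     + w powi (-2) * (- (v powi (-2)) + 2 * v^2 - v^4 - 2 * v^6)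
     + (v powi (-4) + v powi (-2) - 1 - 2 * v^2 + 4 * v^4 + v^6)
     + w^2 * (- (v powi (-4)) + 2 - v^2 - 2 * v^4)
     + w^4 * (- 1 + v^2)"

inductive skein :: "complex \<Rightarrow> complex \<Rightarrow> tangle \<Rightarrow> tangle \<Rightarrow> bool" for v w :: complex where
  skein_circle: "skein v w (Cap \<cdot> Cup) (qexc_d v w *\<^sub>t Strands 0)"
| skein_lollipop: "skein v w (t_merge \<cdot> Cup) (Null 0 1)"
| skein_bigon: "skein v w (t_merge \<cdot> t_split) (qexc_b v w *\<^sub>t Strands 1)"
| skein_triangle: "skein v w (t_H \<cdot> t_split) (qexc_t v w *\<^sub>t t_split)"
| skein_vertex_twist: "skein v w (Neg \<cdot> t_split) (- (v^6) *\<^sub>t t_split)"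
| skein_curl: "skein v w (Neg \<cdot> Cup) (v^12 *\<^sub>t Cup)"
| skein_jacobi: "skein v w
    ((v powi (-3) *\<^sub>t t_H \<cdot> Neg) +\<^sub>t (v *\<^sub>t t_I) +\<^sub>t (- (v powi (-1)) *\<^sub>t t_H)
      +\<^sub>t (- (qnum v w 1 0 * qnum v w 1 (-1) / \<Psi>1 v) *\<^sub>t
            (Neg +\<^sub>t (v^4 *\<^sub>t t_U) +\<^sub>t (v powi (-4) *\<^sub>t Strands 2))))
    (Null 2 2)"
| skein_square: "skein v w
    (t_S +\<^sub>t (- (\<Psi>2 v * (\<Psi>6 v)^2 * qnum v w 1 0 * qnum v w 1 (-1) / (\<Psi>1 v)^2) *\<^sub>t Neg)
      +\<^sub>t (qexc_x1 v w / \<Psi>1 v *\<^sub>t t_I) +\<^sub>t (qexc_x2 v w / \<Psi>1 v *\<^sub>t t_H)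
      +\<^sub>t (qexc_x4 v w / (\<Psi>1 v)^2 *\<^sub>t t_U) +\<^sub>t (qexc_x3 v w / (\<Psi>1 v)^2 *\<^sub>t Strands 2))
    (Null 2 2)"
| skein_crossing: "skein v w
    (Neg +\<^sub>t (- 1 *\<^sub>t Pos)
      +\<^sub>t (\<Psi>1 v / \<Psi>6 v *\<^sub>t (t_I +\<^sub>t (- 1 *\<^sub>t t_H)))
      +\<^sub>t (\<Psi>1 v * qnum v w 1 0 * qnum v w 1 (-1) / \<Psi>6 v *\<^sub>t (Strands 2 +\<^sub>t (- 1 *\<^sub>t t_U))))
    (Null 2 2)"

inductive qexc_eq :: "complex \<Rightarrow> complex \<Rightarrow> nat \<Rightarrow> nat \<Rightarrow> tangle \<Rightarrow> tangle \<Rightarrow> bool"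
  for v w :: complex where
  step: "\<lbrakk>monoidal_axiom f g \<or> linear_axiom f g \<or> isotopy_move f g \<or> skein v w f g;
          arity f m n; arity g m n\<rbrakk> \<Longrightarrow> qexc_eq v w m n f g"
| refl: "arity f m n \<Longrightarrow> qexc_eq v w m n f f"
| sym: "qexc_eq v w m n f g \<Longrightarrow> qexc_eq v w m n g f"
| trans: "\<lbrakk>qexc_eq v w m n f g; qexc_eq v w m n g h\<rbrakk> \<Longrightarrow> qexc_eq v w m n f h"
| cong_stack: "\<lbrakk>qexc_eq v w l n f f'; qexc_eq v w m l g g'\<rbrakk> \<Longrightarrow> qexc_eq v w m n (f \<cdot> g) (f' \<cdot> g')"
| cong_beside: "\<lbrakk>qexc_eq v w m n f f'; qexc_eq v w k l g g'\<rbrakk>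
    \<Longrightarrow> qexc_eq v w (m + k) (n + l) (f \<parallel> g) (f' \<parallel> g')"
| cong_plus: "\<lbrakk>qexc_eq v w m n f f'; qexc_eq v w m n g g'\<rbrakk> \<Longrightarrow> qexc_eq v w m n (f +\<^sub>t g) (f' +\<^sub>t g')"
| cong_scale: "qexc_eq v w m n f f' \<Longrightarrow> qexc_eq v w m n (c *\<^sub>t f) (c *\<^sub>t f')"

definition qexc_rel :: "complex \<Rightarrow> complex \<Rightarrow> nat \<Rightarrow> nat \<Rightarrow> tangle rel" where
  "qexc_rel v w m n = {(f, g). qexc_eq v w m n f g}"

definition qexc_class :: "complex \<Rightarrow> complex \<Rightarrow> nat \<Rightarrow> nat \<Rightarrow> tangle \<Rightarrow> tangle set" where
  "qexc_class v w m n f = qexc_rel v w m n `` {f}"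

definition qexc_hom :: "complex \<Rightarrow> complex \<Rightarrow> nat \<Rightarrow> nat \<Rightarrow> (complex, tangle set) module" where
  "qexc_hom v w m n = \<lparr>carrier = {f. arity f m n} // qexc_rel v w m n,
     monoid.mult = undefined, one = undefined,
     ring.zero = qexc_class v w m n (Null m n),
     add = (\<lambda>A B. \<Union>f\<in>A. \<Union>g\<in>B. qexc_class v w m n (f +\<^sub>t g)),
     module.smult = (\<lambda>c A. \<Union>f\<in>A. qexc_class v w m n (c *\<^sub>t f))\<rparr>"

text \<open>One strand, respectively \<open>m\<close> strands, passing \<open>n\<close> strands on their right.\<close>

primrec t_braid1 :: "nat \<Rightarrow> tangle" where
  "t_braid1 0 = Strands 1"
| "t_braid1 (Suc n) = (Strands n \<parallel> Pos) \<cdot> (t_braid1 n \<parallel> Strands 1)"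

primrec t_braid :: "nat \<Rightarrow> nat \<Rightarrow> tangle" where
  "t_braid 0 n = Strands n"
| "t_braid (Suc m) n = (t_braid m n \<parallel> Strands 1) \<cdot> (Strands m \<parallel> t_braid1 n)"

definition t_twist1 :: tangle where
  "t_twist1 = (Strands 1 \<parallel> Cap) \<cdot> (Pos \<parallel> Strands 1) \<cdot> (Strands 1 \<parallel> Cup)"

primrec t_twist :: "nat \<Rightarrow> tangle" where
  "t_twist 0 = Strands 0"
| "t_twist (Suc n) = t_braid 1 n \<cdot> t_braid n 1 \<cdot> (t_twist n \<parallel> t_twist1)"

text \<open>
  In the composition and tensor product, the inner unions range over all \<open>m\<close>, \<open>n\<close>, but the class
  of an ill-typed diagram is empty, so only the arity of \<open>f \<cdot> g\<close> (or \<open>f \<parallel> g\<close>) contributes.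
\<close>

definition QExc :: "complex \<Rightarrow> complex \<Rightarrow> (complex, nat, tangle set) ribbon_structure" where
  "QExc v w = \<lparr>objs = UNIV,
     hom_mod = qexc_hom v w,
     ident = (\<lambda>n. qexc_class v w n n (Strands n)),
     cmp = (\<lambda>A B. \<Union>f\<in>A. \<Union>g\<in>B. \<Union>m n. qexc_class v w m n (f \<cdot> g)),
     tens_ob = (+),
     tens_mor = (\<lambda>A B. \<Union>f\<in>A. \<Union>g\<in>B. \<Union>m n. qexc_class v w m n (f \<parallel> g)),
     unit_ob = 0,
     assoc = (\<lambda>a b c. qexc_class v w (a + b + c) (a + b + c) (Strands (a + b + c))),
     lunit = (\<lambda>a. qexc_class v w a a (Strands a)),
     runit = (\<lambda>a. qexc_class v w a a (Strands a)),
     braid = (\<lambda>a b. qexc_class v w (a + b) (b + a) (t_braid a b)),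
     twist = (\<lambda>a. qexc_class v w a a (t_twist a))\<rparr>"

text \<open>
  Evaluation functors send the generating strand (the object 1) to \<open>X\<close>. The images of the cap
  and the cup are not prescribed: they form some self-duality of \<open>X\<close>, possibly a rescaling of
  the chosen one.
\<close>

definition evaluation_functor ::
    "complex \<Rightarrow> complex \<Rightarrow> (complex, 'o, 'm) ribbon_structure \<Rightarrow> 'o \<Rightarrow>
     (nat \<Rightarrow> 'o) \<Rightarrow> (tangle set \<Rightarrow> 'm) \<Rightarrow> (nat \<Rightarrow> nat \<Rightarrow> 'm) \<Rightarrow> 'm \<Rightarrow> bool" where
  "evaluation_functor v w C X Fo Fm J J0 \<longleftrightarrow>
     ribbon_functor (ring_of_type_algebra :: complex ring) (QExc v w) C Fo Fm J J0 \<and> Fo 1 = X"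

text \<open>
  The vertex is sent to \<open>\<tau> : X X X \<rightarrow> 1\<close>, modulo the structure isomorphisms of the functor
  \<open>X X X \<cong> F(1) F(1) F(1) \<rightarrow> F(3)\<close> and \<open>1 \<rightarrow> F(0)\<close>.
\<close>

definition sends_vertex_to ::
    "complex \<Rightarrow> complex \<Rightarrow> (complex, 'o, 'm) ribbon_structure \<Rightarrow> 'm \<Rightarrow>
     (nat \<Rightarrow> 'o) \<Rightarrow> (tangle set \<Rightarrow> 'm) \<Rightarrow> (nat \<Rightarrow> nat \<Rightarrow> 'm) \<Rightarrow> 'm \<Rightarrow> bool" where
  "sends_vertex_to v w C \<tau> Fo Fm J J0 \<longleftrightarrow>
     Fm (qexc_class v w 3 0 Vertex) \<^bold>\<circ>\<^bsub>C\<^esub> J 2 1 \<^bold>\<circ>\<^bsub>C\<^esub> (J 1 1 \<^bold>\<otimes>\<^bsub>C\<^esub> \<^bold>i\<^bold>d\<^bsub>C\<^esub> (Fo 1)) = J0 \<^bold>\<circ>\<^bsub>C\<^esub> \<tau>"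

end

theory Submission
  imports Defs
begin

text \<open>
  The tensor powers of \<open>X\<close> form a strict ribbon category in which tangle diagrams can be evaluated,
  so it suffices to find the skein relations inside \<open>End(X X)\<close>. As \<open>C(4)\<close> has dimension at most 5,
  the six elements \<open>1, U, I, H, \<sigma>, \<sigma>\<^sup>-\<^sup>1\<close> are linearly dependent. Rotation by a quarter turn exchanges
  \<open>1\<close> with \<open>U\<close>, \<open>I\<close> with \<open>H\<close> and \<open>\<sigma>\<close> with \<open>\<sigma>\<^sup>-\<^sup>1\<close>, and (QEJac) rewrites \<open>H \<sigma>\<close> and \<open>H \<sigma>\<^sup>-\<^sup>1\<close>; hence
  composing a relation with \<open>H\<close> and taking the antisymmetric part under rotation gives a relation
  again. From any dependency one obtains in this way a non-zero relation
  \<open>x (\<sigma> - \<sigma>\<^sup>-\<^sup>1) + y (I - H) + z (1 - U) = 0\<close>, and composing it with \<open>\<sigma>\<^sup>\<plusminus>\<^sup>1\<close> one with \<open>x \<noteq> 0\<close>. A further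
  composition with \<open>H\<close> fixes \<open>x : y\<close> to be \<open>b + \<alpha> (v\<^sup>3 - v\<^sup>-\<^sup>3)\<close> to
  \<open>v\<^sup>6 - v\<^sup>-\<^sup>6 + v\<^sup>4 - v\<^sup>-\<^sup>4 + v\<^sup>2 - v\<^sup>-\<^sup>2\<close>, and closing off with the split fixes \<open>z\<close>. The first of these
  coefficients vanishes only if \<open>d = - \<Psi>\<^sub>4\<close>; there would then be two independent relations of this
  kind, whose closures with the cup contradict the assumptions on \<open>v\<close>. The square relation is the
  composition of the crossing relation with \<open>H\<close>.

  Closing off (QEJac) expresses \<open>b\<close> and \<open>t\<close> by \<open>\<alpha>\<close> and \<open>d\<close>. Since \<open>d \<noteq> - \<Psi>\<^sub>4\<close>, the formula for \<open>d\<close>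
  can be solved for \<open>w\<close>, and rescaling the self-duality by a cube root normalises \<open>\<alpha>\<close>.
\<close>

section \<open>Strict linear monoidal categories on the natural numbers\<close>

text \<open>The obstacle is that composing a relation with \<open>H\<close> leaves the span of the
  six diagrams: the coefficient of \<open>H\<close> becomes one of \<open>H @@ H\<close>. The
  square, however, has four-fold symmetry (\<open>rot_square\<close>), so it drops out of the
  antisymmetric part. Once z is eliminated by closing with the split, composition with
  \<open>H\<close> sends (x, y) to (- \<alpha> (v^3 - v^-3) x, b y - c x) with c = v^6 - v^-6 + v^4
  - v^-4 + v^2 - v^-2. Subtracting this from b (x, y) removes y, which is the origin of the ratio x
  : y. The exception d = - Psi4 comes from v^8 + v^-8 - v^2 - v^-2 = (v^5 - v^-5) (v^3 - v^-3):
  closing (QEJac) with the cup therefore says (v^5 - v^-5) (b + \<alpha> (v^3 - v^-3)) = - \<alpha>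
  (d + Psi4). The condition v^10 \<noteq> 1 keeps \<alpha> and v^5 - v^-5 away from zero; v^12
  \<noteq> 1 does the same for v^3 + v^-3, v^6 - v^-6, Psi1 and Psi6.\<close>

text \<open>
  Hom-sets need not be disjoint. Packing a morphism with its source and target makes composition
  and tensor product functions of the arrows alone.
\<close>

datatype ('o, 'm) arrow = Arrow (src: 'o) (tgt: 'o) (mor: 'm)

text \<open>The equations for \<open>src\<close> and \<open>tgt\<close> carry no typing hypotheses,
  so the simplifier computes the arity of any diagram, and thereby settles composability conditions,
  by evaluation.\<close>

locale strict_linear_monoidal =
  fixes arr :: "(nat, 'm) arrow \<Rightarrow> bool"
    and idn :: "nat \<Rightarrow> (nat, 'm) arrow"
    and comp :: "(nat, 'm) arrow \<Rightarrow> (nat, 'm) arrow \<Rightarrow> (nat, 'm) arrow" (infixr \<open>@@\<close> 70)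
    and tens :: "(nat, 'm) arrow \<Rightarrow> (nat, 'm) arrow \<Rightarrow> (nat, 'm) arrow" (infixr \<open>**\<close> 75)
    and nul :: "nat \<Rightarrow> nat \<Rightarrow> (nat, 'm) arrow"
    and plus :: "(nat, 'm) arrow \<Rightarrow> (nat, 'm) arrow \<Rightarrow> (nat, 'm) arrow" (infixl \<open>+\<^sub>a\<close> 65)
    and scale :: "complex \<Rightarrow> (nat, 'm) arrow \<Rightarrow> (nat, 'm) arrow" (infixr \<open>*\<^sub>a\<close> 68)
  assumes src_idn [simp]: "src (idn n) = n" and tgt_idn [simp]: "tgt (idn n) = n"
    and arr_idn [simp]: "arr (idn n)"
    and src_comp [simp]: "src (f @@ g) = src g" and tgt_comp [simp]: "tgt (f @@ g) = tgt f"
    and arr_comp [simp]: "\<lbrakk>arr f; arr g; src f = tgt g\<rbrakk> \<Longrightarrow> arr (f @@ g)"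
    and src_tens [simp]: "src (f ** g) = src f + src g"
    and tgt_tens [simp]: "tgt (f ** g) = tgt f + tgt g"
    and arr_tens [simp]: "\<lbrakk>arr f; arr g\<rbrakk> \<Longrightarrow> arr (f ** g)"
    and src_nul [simp]: "src (nul m n) = m" and tgt_nul [simp]: "tgt (nul m n) = n"
    and arr_nul [simp]: "arr (nul m n)"
    and src_plus [simp]: "src (f +\<^sub>a g) = src f" and tgt_plus [simp]: "tgt (f +\<^sub>a g) = tgt f"
    and arr_plus [simp]: "\<lbrakk>arr f; arr g; src f = src g; tgt f = tgt g\<rbrakk> \<Longrightarrow> arr (f +\<^sub>a g)"
    and src_scale [simp]: "src (c *\<^sub>a f) = src f" and tgt_scale [simp]: "tgt (c *\<^sub>a f) = tgt f"
    and arr_scale [simp]: "arr f \<Longrightarrow> arr (c *\<^sub>a f)"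
    and comp_assoc: "\<lbrakk>arr f; arr g; arr h; src f = tgt g; src g = tgt h\<rbrakk>
      \<Longrightarrow> (f @@ g) @@ h = f @@ g @@ h"
    and idn_comp: "\<lbrakk>arr f; tgt f = n\<rbrakk> \<Longrightarrow> idn n @@ f = f"
    and comp_idn: "\<lbrakk>arr f; src f = n\<rbrakk> \<Longrightarrow> f @@ idn n = f"
    and tens_assoc: "\<lbrakk>arr f; arr g; arr h\<rbrakk> \<Longrightarrow> (f ** g) ** h = f ** g ** h"
    and idn0_tens: "arr f \<Longrightarrow> idn 0 ** f = f"
    and tens_idn0: "arr f \<Longrightarrow> f ** idn 0 = f"
    and idn_tens_idn: "idn m ** idn n = idn (m + n)"
    and interchange: "\<lbrakk>arr f; arr g; arr f'; arr g'; src f = tgt g; src f' = tgt g'\<rbrakk>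
      \<Longrightarrow> (f @@ g) ** (f' @@ g') = (f ** f') @@ (g ** g')"
    and plus_assoc: "\<lbrakk>arr f; arr g; arr h; src f = src g; tgt f = tgt g; src f = src h; tgt f = tgt h\<rbrakk>
      \<Longrightarrow> (f +\<^sub>a g) +\<^sub>a h = f +\<^sub>a (g +\<^sub>a h)"
    and plus_comm: "\<lbrakk>arr f; arr g; src f = src g; tgt f = tgt g\<rbrakk> \<Longrightarrow> f +\<^sub>a g = g +\<^sub>a f"
    and nul_plus: "\<lbrakk>arr f; src f = m; tgt f = n\<rbrakk> \<Longrightarrow> nul m n +\<^sub>a f = f"
    and scale_0: "\<lbrakk>arr f; src f = m; tgt f = n\<rbrakk> \<Longrightarrow> 0 *\<^sub>a f = nul m n"
    and scale_1: "arr f \<Longrightarrow> 1 *\<^sub>a f = f"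
    and scale_mult: "arr f \<Longrightarrow> (c * d) *\<^sub>a f = c *\<^sub>a d *\<^sub>a f"
    and scale_add: "arr f \<Longrightarrow> (c + d) *\<^sub>a f = c *\<^sub>a f +\<^sub>a d *\<^sub>a f"
    and scale_plus: "\<lbrakk>arr f; arr g; src f = src g; tgt f = tgt g\<rbrakk>
      \<Longrightarrow> c *\<^sub>a (f +\<^sub>a g) = c *\<^sub>a f +\<^sub>a c *\<^sub>a g"
    and plus_comp: "\<lbrakk>arr f; arr g; arr h; src f = src g; tgt f = tgt g; src f = tgt h\<rbrakk>
      \<Longrightarrow> (f +\<^sub>a g) @@ h = f @@ h +\<^sub>a g @@ h"
    and comp_plus: "\<lbrakk>arr f; arr g; arr h; src f = src g; tgt f = tgt g; src h = tgt f\<rbrakk>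
      \<Longrightarrow> h @@ (f +\<^sub>a g) = h @@ f +\<^sub>a h @@ g"
    and scale_comp: "\<lbrakk>arr f; arr g; src f = tgt g\<rbrakk> \<Longrightarrow> (c *\<^sub>a f) @@ g = c *\<^sub>a (f @@ g)"
    and comp_scale: "\<lbrakk>arr f; arr g; src f = tgt g\<rbrakk> \<Longrightarrow> f @@ (c *\<^sub>a g) = c *\<^sub>a (f @@ g)"
    and plus_tens: "\<lbrakk>arr f; arr g; arr h; src f = src g; tgt f = tgt g\<rbrakk>
      \<Longrightarrow> (f +\<^sub>a g) ** h = f ** h +\<^sub>a g ** h"
    and tens_plus: "\<lbrakk>arr f; arr g; arr h; src f = src g; tgt f = tgt g\<rbrakk>
      \<Longrightarrow> h ** (f +\<^sub>a g) = h ** f +\<^sub>a h ** g"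
    and scale_tens: "\<lbrakk>arr f; arr g\<rbrakk> \<Longrightarrow> (c *\<^sub>a f) ** g = c *\<^sub>a (f ** g)"
    and tens_scale: "\<lbrakk>arr f; arr g\<rbrakk> \<Longrightarrow> f ** (c *\<^sub>a g) = c *\<^sub>a (f ** g)"
begin

lemma tens_eq_left_first:
  "\<lbrakk>arr f; arr g; src f = a; tgt g = d\<rbrakk> \<Longrightarrow> f ** g = (f ** idn d) @@ (idn a ** g)"
  by (metis interchange comp_idn idn_comp arr_idn src_idn tgt_idn)

lemma tens_eq_right_first:
  "\<lbrakk>arr f; arr g; tgt f = b; src g = c\<rbrakk> \<Longrightarrow> f ** g = (idn b ** g) @@ (f ** idn c)"
  by (metis interchange comp_idn idn_comp arr_idn src_idn tgt_idn)

lemma exchange: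
  "\<lbrakk>arr f; arr g; src f = a; tgt f = b; src g = c; tgt g = d\<rbrakk>
    \<Longrightarrow> (f ** idn d) @@ (idn a ** g) = (idn b ** g) @@ (f ** idn c)"
  using tens_eq_left_first tens_eq_right_first by metis

lemma tens_idn_comp:
  "\<lbrakk>arr f; arr g; src f = tgt g\<rbrakk> \<Longrightarrow> (f @@ g) ** idn n = (f ** idn n) @@ (g ** idn n)"
  by (metis interchange comp_idn arr_idn src_idn tgt_idn)

lemma idn_tens_comp:
  "\<lbrakk>arr f; arr g; src f = tgt g\<rbrakk> \<Longrightarrow> idn n ** (f @@ g) = (idn n ** f) @@ (idn n ** g)"
  by (metis interchange comp_idn arr_idn src_idn tgt_idn)

lemma idn_tens_idn_tens: "arr f \<Longrightarrow> idn m ** idn n ** f = idn (m + n) ** f"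
  by (metis tens_assoc idn_tens_idn arr_idn)

lemma scale_nul: "c *\<^sub>a nul m n = nul m n"
proof -
  have "c *\<^sub>a nul m n = (c * 0) *\<^sub>a nul m n"
    by (subst scale_mult) (simp_all add: scale_0)
  then show ?thesis by (simp add: scale_0)
qed

lemma nul_comp: "\<lbrakk>arr f; tgt f = m; src f = l\<rbrakk> \<Longrightarrow> nul m n @@ f = nul l n"
  using scale_comp[of "nul m n" f 0] by (simp add: scale_0)

lemma comp_nul: "\<lbrakk>arr f; src f = m; tgt f = n\<rbrakk> \<Longrightarrow> f @@ nul l m = nul l n"
  using comp_scale[of f "nul l m" 0] by (simp add: scale_0)

lemma nul_tens:
  assumes "arr f" shows "nul m n ** f = nul (m + src f) (n + tgt f)"
proof -
  have "nul m n ** f = 0 *\<^sub>a (nul m n ** f)"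
    using scale_tens[of "nul m n" f 0] assms by (simp add: scale_nul)
  then show ?thesis using assms by (simp add: scale_0)
qed

lemma tens_nul:
  assumes "arr f" shows "f ** nul m n = nul (src f + m) (tgt f + n)"
proof -
  have "f ** nul m n = 0 *\<^sub>a (f ** nul m n)"
    using tens_scale[of f "nul m n" 0] assms by (simp add: scale_nul)
  then show ?thesis using assms by (simp add: scale_0)
qed

lemma scale_eq_nul:
  assumes "arr f" "c \<noteq> 0" "c *\<^sub>a f = nul (src f) (tgt f)"
  shows "f = nul (src f) (tgt f)"
proof -
  have "f = (inverse c * c) *\<^sub>a f" using assms by (simp add: scale_1)
  also have "\<dots> = inverse c *\<^sub>a nul (src f) (tgt f)" by (subst scale_mult) (simp_all add: assms)
  finally show ?thesis by (simp add: scale_nul)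
qed

lemma scale_inject:
  assumes "arr f" "f \<noteq> nul (src f) (tgt f)" "c *\<^sub>a f = c' *\<^sub>a f"
  shows "c = c'"
proof (rule ccontr)
  assume "c \<noteq> c'"
  have "(c - c') *\<^sub>a f = c *\<^sub>a f +\<^sub>a (- c') *\<^sub>a f"
    using scale_add[of f c "- c'"] assms(1) by simp
  also have "\<dots> = (c' + - c') *\<^sub>a f"
    using assms(1) by (subst scale_add) (simp_all add: assms(3))
  finally have "(c - c') *\<^sub>a f = nul (src f) (tgt f)" using assms(1) by (simp add: scale_0)
  then show False using scale_eq_nul[of f "c - c'"] \<open>c \<noteq> c'\<close> assms by simp
qed

end

section \<open>Graphical calculus of a self-dual object with a trivalent vertex\<close>

text \<open>The generating object is kept in the form \<open>1\<close>, so that arities are numerals.\<close>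

declare One_nat_def [simp del]

text \<open>Rotation invariance of the vertex and the framed first Reidemeister move are not
  assumed. They will follow from the slides, the braid relation and the scalars by which the
  crossing acts on cup and split.\<close>

locale trivalent_calculus = strict_linear_monoidal where arr = arr
  for arr :: "(nat, 'm) arrow \<Rightarrow> bool" +
  fixes cap cup vtx N P :: "(nat, 'm) arrow" and v d b t \<alpha> :: complex
  assumes src_cap [simp]: "src cap = 2" and tgt_cap [simp]: "tgt cap = 0" and arr_cap [simp]: "arr cap"
    and src_cup [simp]: "src cup = 0" and tgt_cup [simp]: "tgt cup = 2" and arr_cup [simp]: "arr cup"
    and src_vtx [simp]: "src vtx = 3" and tgt_vtx [simp]: "tgt vtx = 0" and arr_vtx [simp]: "arr vtx"
    and src_N [simp]: "src N = 2" and tgt_N [simp]: "tgt N = 2" and arr_N [simp]: "arr N"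
    and src_P [simp]: "src P = 2" and tgt_P [simp]: "tgt P = 2" and arr_P [simp]: "arr P"
    and zigzag_left: "(cap ** idn 1) @@ (idn 1 ** cup) = idn 1"
    and zigzag_right: "(idn 1 ** cap) @@ (cup ** idn 1) = idn 1"
    and NP: "N @@ P = idn 2" and PN: "P @@ N = idn 2"
    and reidemeister3: "(N ** idn 1) @@ (idn 1 ** N) @@ (N ** idn 1) =
      (idn 1 ** N) @@ (N ** idn 1) @@ (idn 1 ** N)"
    and slide_cap: "x \<in> {N, P} \<Longrightarrow> (cap ** idn 1) @@ (idn 1 ** x) @@ (x ** idn 1) = idn 1 ** cap"
    and slide_vtx: "x \<in> {N, P} \<Longrightarrow>
      (vtx ** idn 1) @@ (idn 2 ** x) @@ (idn 1 ** x ** idn 1) @@ (x ** idn 2) = idn 1 ** vtx"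
    and hom_2_0: "\<lbrakk>arr f; src f = 2; tgt f = 0\<rbrakk> \<Longrightarrow> \<exists>c. f = c *\<^sub>a cap"
    and cap_nonzero: "cap \<noteq> nul 2 0"
    and hom_3_0: "\<lbrakk>arr f; src f = 3; tgt f = 0\<rbrakk> \<Longrightarrow> \<exists>c. f = c *\<^sub>a vtx"
    and vtx_nonzero: "vtx \<noteq> nul 3 0"
    and v_nonzero: "v \<noteq> 0" and d_nonzero: "d \<noteq> 0" and b_nonzero: "b \<noteq> 0"
begin

definition merge :: "(nat, 'm) arrow" where "merge = (vtx ** idn 1) @@ (idn 2 ** cup)"
definition split :: "(nat, 'm) arrow" where "split = (merge ** idn 1) @@ (idn 1 ** cup)"
definition U :: "(nat, 'm) arrow" where "U = cup @@ cap"
definition I :: "(nat, 'm) arrow" where "I = split @@ merge"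
definition H :: "(nat, 'm) arrow" where "H = (idn 1 ** merge) @@ (split ** idn 1)"

lemma merge_type [simp]: "src merge = 2" "tgt merge = 1" "arr merge"
  by (simp_all add: merge_def)

lemma split_type [simp]: "src split = 1" "tgt split = 2" "arr split"
  by (simp_all add: split_def)

lemma UIH_type [simp]:
  "src U = 2" "tgt U = 2" "arr U" "src I = 2" "tgt I = 2" "arr I" "src H = 2" "tgt H = 2" "arr H"
  by (simp_all add: U_def I_def H_def)

lemma idn_Suc_0: "idn (Suc 0) = idn 1"
  by (simp add: One_nat_def)

text \<open>These rules bring a diagram to a right-nested stack of layers, each an elementary piece
  between identity strands, so that most isotopies become syntactic equalities. Pieces far apart
  still have to be moved past each other with \<open>exchange\<close>.\<close>

lemmas layers = tens_idn_comp idn_tens_comp tens_assoc idn_tens_idn idn_tens_idn_tens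
  comp_assoc idn0_tens tens_idn0 idn_comp comp_idn idn_Suc_0

lemma comp_rewrite:
  "\<lbrakk>f @@ g = h; arr f; arr g; arr r; src f = tgt g; src g = tgt r\<rbrakk> \<Longrightarrow> f @@ g @@ r = h @@ r"
  using comp_assoc by metis

section \<open>Bending outputs into inputs\<close>

definition bend :: "(nat, 'm) arrow \<Rightarrow> (nat, 'm) arrow" where
  "bend f = (idn (tgt f - 1) ** cap) @@ (f ** idn 1)"

lemma bend_type [simp]:
  "src (bend f) = src f + 1" "tgt (bend f) = tgt f - 1"
  "\<lbrakk>arr f; tgt f \<ge> 1\<rbrakk> \<Longrightarrow> arr (bend f)"
  by (simp_all add: bend_def)

text \<open>The new cup slides down past \<open>f\<close> and meets the cap of \<open>bend f\<close>
  in a zigzag.\<close>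

lemma unbend:
  assumes f [simp]: "arr f" and n [simp]: "tgt f = n + 1"
  shows "(bend f ** idn 1) @@ (idn (src f) ** cup) = f"
proof -
  have "(bend f ** idn 1) @@ (idn (src f) ** cup) =
      (idn n ** cap ** idn 1) @@ (f ** idn 2) @@ (idn (src f) ** cup)"
    by (simp add: bend_def layers)
  also have "(f ** idn 2) @@ (idn (src f) ** cup) = (idn (n + 1) ** cup) @@ f"
    using exchange[of f cup "src f" "n + 1" 0 2] by (simp add: layers)
  also have "(idn n ** cap ** idn 1) @@ (idn (n + 1) ** cup) @@ f
      = ((idn n ** cap ** idn 1) @@ (idn (n + 1) ** cup)) @@ f"
    by (simp add: comp_assoc)
  also have "(idn n ** cap ** idn 1) @@ (idn (n + 1) ** cup)
      = idn n ** ((cap ** idn 1) @@ (idn 1 ** cup))"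
    by (simp add: layers)
  finally show ?thesis by (simp add: zigzag_left layers)
qed

lemma bend_inject:
  assumes "arr f" "arr g" "src f = src g" "tgt f = tgt g" "tgt f \<ge> 1" "bend f = bend g"
  shows "f = g"
proof -
  obtain n where n: "tgt f = n + 1" using assms(5) by (metis add.commute le_Suc_ex)
  have "f = (bend f ** idn 1) @@ (idn (src f) ** cup)"
    by (rule unbend[symmetric]) (fact assms n)+
  also have "\<dots> = (bend g ** idn 1) @@ (idn (src g) ** cup)"
    by (simp only: assms)
  also have "\<dots> = g"
    by (rule unbend[of g n]) (use assms n in auto)
  finally show ?thesis .
qed

lemma bend_scale: "\<lbrakk>arr f; tgt f \<ge> 1\<rbrakk> \<Longrightarrow> bend (c *\<^sub>a f) = c *\<^sub>a bend f"
  by (simp add: bend_def scale_tens comp_scale)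

lemma bend_plus:
  "\<lbrakk>arr f; arr g; src f = src g; tgt f = tgt g; tgt g \<ge> 1\<rbrakk> \<Longrightarrow> bend (f +\<^sub>a g) = bend f +\<^sub>a bend g"
  by (simp add: bend_def plus_tens comp_plus)

lemma bend_idn: "bend (idn 1) = cap"
  by (simp add: bend_def layers)

lemma cap_merge_left: "cap @@ (merge ** idn 1) = vtx"
proof -
  have "cap @@ (merge ** idn 1) = (cap @@ (vtx ** idn 2)) @@ (idn 2 ** cup ** idn 1)"
    by (simp add: merge_def layers)
  also have "cap @@ (vtx ** idn 2) = vtx @@ (idn 3 ** cap)"
    using exchange[of vtx cap 3 0 2 0] by (simp add: layers)
  also have "(vtx @@ (idn 3 ** cap)) @@ (idn 2 ** cup ** idn 1)
      = vtx @@ (idn 2 ** ((idn 1 ** cap) @@ (cup ** idn 1)))"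
    by (simp add: layers)
  finally show ?thesis by (simp add: zigzag_right layers)
qed

lemma bend_merge: "bend merge = vtx"
  using cap_merge_left by (simp add: bend_def layers)

lemma bend_split: "bend split = merge"
proof -
  have "bend split = ((idn 1 ** cap) @@ (merge ** idn 2)) @@ (idn 1 ** cup ** idn 1)"
    by (simp add: bend_def split_def layers)
  also have "(idn 1 ** cap) @@ (merge ** idn 2) = merge @@ (idn 2 ** cap)"
    using exchange[of merge cap 2 1 2 0] by (simp add: layers)
  also have "(merge @@ (idn 2 ** cap)) @@ (idn 1 ** cup ** idn 1)
      = merge @@ (idn 1 ** ((idn 1 ** cap) @@ (cup ** idn 1)))"
    by (simp add: layers)
  finally show ?thesis by (simp add: zigzag_right layers)
qed

lemma scale_cap_inject: "c *\<^sub>a cap = c' *\<^sub>a cap \<Longrightarrow> c = c'"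
  using scale_inject[of cap] cap_nonzero by simp

lemma scale_vtx_inject: "c *\<^sub>a vtx = c' *\<^sub>a vtx \<Longrightarrow> c = c'"
  using scale_inject[of vtx] vtx_nonzero by simp

text \<open>Here and in the next three lemmas a scalar is read off after moving the diagram, by
  bending or composing, to \<open>cap\<close> or \<open>vtx\<close>, the two diagrams known to be
  nonzero.\<close>

lemma scale_idn1_inject: "c *\<^sub>a idn 1 = c' *\<^sub>a idn 1 \<Longrightarrow> c = c'"
proof (rule scale_cap_inject)
  assume "c *\<^sub>a idn 1 = c' *\<^sub>a idn 1"
  then have "bend (c *\<^sub>a idn 1) = bend (c' *\<^sub>a idn 1)" by simp
  then show "c *\<^sub>a cap = c' *\<^sub>a cap" by (simp add: bend_scale bend_idn)
qed

lemma scale_idn0_inject: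
  assumes "c *\<^sub>a idn 0 = c' *\<^sub>a idn 0"
  shows "c = c'"
proof (rule scale_cap_inject)
  have "c *\<^sub>a cap = (c *\<^sub>a idn 0) @@ cap" for c by (simp add: scale_comp layers)
  from this[of c] this[of c'] show "c *\<^sub>a cap = c' *\<^sub>a cap" using assms by simp
qed

lemma scale_split_inject: "c *\<^sub>a split = c' *\<^sub>a split \<Longrightarrow> c = c'"
proof -
  assume eq: "c *\<^sub>a split = c' *\<^sub>a split"
  have "c *\<^sub>a vtx = bend (bend (c *\<^sub>a split))" for c
    by (simp add: bend_scale bend_split bend_merge)
  from this[of c] this[of c'] show ?thesis using eq scale_vtx_inject by simp
qed

lemma scale_cup_inject: "c *\<^sub>a cup = c' *\<^sub>a cup \<Longrightarrow> c = c'"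
proof -
  assume eq: "c *\<^sub>a cup = c' *\<^sub>a cup"
  have "c *\<^sub>a idn 1 = bend (c *\<^sub>a cup)" for c
    by (simp add: bend_scale bend_def[of cup] zigzag_right idn_Suc_0)
  from this[of c] this[of c'] show ?thesis using eq scale_idn1_inject by simp
qed

lemma hom_2_1: "\<lbrakk>arr f; src f = 2; tgt f = 1\<rbrakk> \<Longrightarrow> \<exists>c. f = c *\<^sub>a merge"
proof -
  assume f: "arr f" "src f = 2" "tgt f = 1"
  then obtain c where "bend f = c *\<^sub>a vtx" using hom_3_0[of "bend f"] by auto
  then have "bend f = bend (c *\<^sub>a merge)" by (simp add: bend_scale bend_merge)
  then show ?thesis using f bend_inject[of f "c *\<^sub>a merge"] by auto
qed

end

locale elementary_calculus = trivalent_calculus where arr = arr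
  for arr :: "(nat, 'm) arrow \<Rightarrow> bool" +
  assumes circle: "cap @@ cup = d *\<^sub>a idn 0"
    and lollipop: "merge @@ cup = nul 0 1"
    and bigon: "merge @@ split = b *\<^sub>a idn 1"
    and triangle: "H @@ split = t *\<^sub>a split"
    and N_split: "N @@ split = (- (v^6)) *\<^sub>a split"
    and N_cup: "N @@ cup = (v^12) *\<^sub>a cup"
begin

lemma comp_inverse_scalar:
  assumes "x @@ y = idn 2" "y @@ f = c *\<^sub>a f" "c \<noteq> 0" "arr f" "tgt f = 2"
    and [simp]: "arr x" "arr y" "src x = 2" "src y = 2" "tgt y = 2"
  shows "x @@ f = inverse c *\<^sub>a f"
proof -
  have "x @@ f = (inverse c * c) *\<^sub>a (x @@ f)" using assms by (simp add: scale_1)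
  also have "\<dots> = inverse c *\<^sub>a (x @@ y @@ f)"
    using assms by (subst scale_mult) (simp_all add: comp_scale)
  also have "x @@ y @@ f = (x @@ y) @@ f" using assms(4,5) by (simp add: comp_assoc)
  also have "\<dots> = f" using assms(4,5) by (simp only: assms(1) idn_comp)
  finally show ?thesis .
qed

lemma comp_inverse_scalar':
  assumes "x @@ y = idn 2" "f @@ x = c *\<^sub>a f" "c \<noteq> 0" "arr f" "src f = 2"
    and [simp]: "arr x" "arr y" "src x = 2" "tgt x = 2" "tgt y = 2"
  shows "f @@ y = inverse c *\<^sub>a f"
proof -
  have "f @@ y = (inverse c * c) *\<^sub>a (f @@ y)" using assms by (simp add: scale_1)
  also have "\<dots> = inverse c *\<^sub>a ((f @@ x) @@ y)"
    using assms by (subst scale_mult) (simp_all add: scale_comp)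
  also have "(f @@ x) @@ y = f @@ x @@ y" using assms(4,5) by (simp add: comp_assoc)
  also have "\<dots> = f" using assms(4,5) by (simp only: assms(1) comp_idn)
  finally show ?thesis .
qed

lemma P_cup: "P @@ cup = inverse (v^12) *\<^sub>a cup"
  using comp_inverse_scalar[OF PN N_cup] v_nonzero by simp

lemma P_split: "P @@ split = inverse (- (v^6)) *\<^sub>a split"
  using comp_inverse_scalar[OF PN N_split] v_nonzero by simp

text \<open>Precomposition with \<open>N\<close> preserves the line spanned by \<open>merge\<close>,
  hence is a scalar. Pairing with \<open>split\<close> compares it with the known scalar on
  \<open>split\<close>, because \<open>b\<close> is nonzero. The circle value plays the same part in
  \<open>cap_N\<close>.\<close>

lemma merge_N: "merge @@ N = (- (v^6)) *\<^sub>a merge"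
proof -
  obtain c where c: "merge @@ N = c *\<^sub>a merge" using hom_2_1[of "merge @@ N"] by auto
  have "(c * b) *\<^sub>a idn 1 = (merge @@ N) @@ split"
    by (simp add: c scale_comp bigon scale_mult)
  also have "\<dots> = merge @@ N @@ split" by (simp add: comp_assoc)
  also have "\<dots> = (- (v^6) * b) *\<^sub>a idn 1"
    unfolding N_split by (simp add: comp_scale bigon scale_mult[symmetric])
  finally have "c * b = - (v^6) * b" by (rule scale_idn1_inject)
  then have "c = - (v^6)" using b_nonzero by (simp only: mult_cancel_right simp_thms)
  then show ?thesis using c by simp
qed

lemma cap_N: "cap @@ N = (v^12) *\<^sub>a cap"
proof -
  obtain c where c: "cap @@ N = c *\<^sub>a cap" using hom_2_0[of "cap @@ N"] by auto
  have "(c * d) *\<^sub>a idn 0 = (cap @@ N) @@ cup"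
    by (simp add: c scale_comp circle scale_mult)
  also have "\<dots> = cap @@ N @@ cup" by (simp add: comp_assoc)
  also have "\<dots> = (v^12 * d) *\<^sub>a idn 0"
    unfolding N_cup by (simp add: comp_scale circle scale_mult[symmetric])
  finally have "c * d = v^12 * d" by (rule scale_idn0_inject)
  then have "c = v^12" using d_nonzero by (simp only: mult_cancel_right simp_thms)
  then show ?thesis using c by simp
qed

lemma merge_P: "merge @@ P = inverse (- (v^6)) *\<^sub>a merge"
  using comp_inverse_scalar'[OF NP merge_N] v_nonzero by simp

lemma cap_P: "cap @@ P = inverse (v^12) *\<^sub>a cap"
  using comp_inverse_scalar'[OF NP cap_N] v_nonzero by simp

lemma vtx_N_left: "vtx @@ (N ** idn 1) = (- (v^6)) *\<^sub>a vtx"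
proof -
  have "vtx @@ (N ** idn 1) = cap @@ ((merge @@ N) ** idn 1)"
    by (subst (1) cap_merge_left[symmetric]) (simp add: layers)
  also have "\<dots> = (- (v^6)) *\<^sub>a (cap @@ (merge ** idn 1))"
    unfolding merge_N by (simp add: scale_tens comp_scale)
  finally show ?thesis unfolding cap_merge_left .
qed

text \<open>The braid relation forces the scalars by which \<open>N\<close> acts on the two sides of the vertex to agree.\<close>

lemma vtx_N_right: "vtx @@ (idn 1 ** N) = (- (v^6)) *\<^sub>a vtx"
proof -
  obtain c where c: "vtx @@ (idn 1 ** N) = c *\<^sub>a vtx"
    using hom_3_0[of "vtx @@ (idn 1 ** N)"] by auto
  define e where "e = - (v^6)"
  have e: "vtx @@ (N ** idn 1) = e *\<^sub>a vtx" using vtx_N_left by (simp add: e_def)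
  have step_N: "(x *\<^sub>a vtx) @@ (N ** idn 1) = (x * e) *\<^sub>a vtx" for x
    by (simp add: scale_comp e scale_mult)
  have step_N': "(x *\<^sub>a vtx) @@ (idn 1 ** N) = (x * c) *\<^sub>a vtx" for x
    by (simp add: scale_comp c scale_mult)
  have "((vtx @@ (N ** idn 1)) @@ (idn 1 ** N)) @@ (N ** idn 1) =
      ((vtx @@ (idn 1 ** N)) @@ (N ** idn 1)) @@ (idn 1 ** N)"
    using arg_cong[OF reidemeister3, of "\<lambda>f. vtx @@ f"] by (simp add: comp_assoc)
  then have "(e * c * e) *\<^sub>a vtx = (c * e * c) *\<^sub>a vtx"
    by (simp only: e c step_N step_N')
  then have *: "e * c * e = c * e * c" by (rule scale_vtx_inject)
  have "c \<noteq> 0"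
  proof
    assume "c = 0"
    have "vtx = vtx @@ (idn 1 ** (N @@ P))" unfolding NP by (simp add: layers)
    also have "\<dots> = (vtx @@ (idn 1 ** N)) @@ (idn 1 ** P)" by (simp add: layers)
    also have "\<dots> = nul 3 0" unfolding c \<open>c = 0\<close> by (simp add: nul_comp scale_0)
    finally show False using vtx_nonzero by simp
  qed
  moreover have "(c * e) * (c - e) = 0" using * by (auto simp add: algebra_simps)
  moreover have "e \<noteq> 0" using v_nonzero by (simp add: e_def)
  ultimately have "c = e" by simp
  then show ?thesis using c e_def by simp
qed

text \<open>Half of a slide: moving one of the two crossings of \<open>slide_cap\<close> to the
  other side inverts it. In this form curls turn into crossings acting on \<open>cup\<close>, and
  crossings can be rotated.\<close>

lemma cap_slide_inverse:
  assumes "x = N \<and> y = P \<or> x = P \<and> y = N"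
  shows "(idn 1 ** cap) @@ (x ** idn 1) = (cap ** idn 1) @@ (idn 1 ** y)"
proof -
  have [simp]: "arr x" "arr y" "src x = 2" "tgt x = 2" "src y = 2" "tgt y = 2" using assms by auto
  have yx: "y @@ x = idn 2" using assms NP PN by auto
  have "(idn 1 ** cap) @@ (x ** idn 1) = ((cap ** idn 1) @@ (idn 1 ** y) @@ (y ** idn 1)) @@ (x ** idn 1)"
    using slide_cap[of y] assms by auto
  also have "\<dots> = (cap ** idn 1) @@ (idn 1 ** y) @@ ((y @@ x) ** idn 1)"
    by (simp add: layers)
  finally show ?thesis by (simp add: yx layers)
qed

lemma curl_N: "(idn 1 ** cap) @@ (N ** idn 1) @@ (idn 1 ** cup) = inverse (v^12) *\<^sub>a idn 1"
proof -
  have "(idn 1 ** cap) @@ (N ** idn 1) @@ (idn 1 ** cup) = (cap ** idn 1) @@ (idn 1 ** (P @@ cup))"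
    using comp_rewrite[OF cap_slide_inverse[of N P], of "idn 1 ** cup"] by (simp add: layers)
  also have "\<dots> = inverse (v^12) *\<^sub>a ((cap ** idn 1) @@ (idn 1 ** cup))"
    by (simp add: P_cup tens_scale comp_scale)
  finally show ?thesis by (simp add: zigzag_left)
qed

lemma curl_P: "(idn 1 ** cap) @@ (P ** idn 1) @@ (idn 1 ** cup) = (v^12) *\<^sub>a idn 1"
proof -
  have "(idn 1 ** cap) @@ (P ** idn 1) @@ (idn 1 ** cup) = (cap ** idn 1) @@ (idn 1 ** (N @@ cup))"
    using comp_rewrite[OF cap_slide_inverse[of P N], of "idn 1 ** cup"] by (simp add: layers)
  also have "\<dots> = (v^12) *\<^sub>a ((cap ** idn 1) @@ (idn 1 ** cup))"
    by (simp add: N_cup tens_scale comp_scale)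
  finally show ?thesis by (simp add: zigzag_left)
qed

lemma framed_reidemeister1:
  "(idn 1 ** cap) @@ (N ** idn 1) @@ (idn 1 ** cup) = (cap ** idn 1) @@ (idn 1 ** N) @@ (cup ** idn 1)"
proof -
  have "(cap ** idn 1) @@ (idn 1 ** N) @@ (cup ** idn 1) = (idn 1 ** cap) @@ ((P @@ cup) ** idn 1)"
    using comp_rewrite[OF cap_slide_inverse[of P N, symmetric], of "cup ** idn 1"] by (simp add: layers)
  also have "\<dots> = inverse (v^12) *\<^sub>a ((idn 1 ** cap) @@ (cup ** idn 1))"
    by (simp add: P_cup scale_tens comp_scale)
  finally show ?thesis by (simp add: zigzag_right curl_N)
qed

text \<open>Rotation invariance of the vertex. The leftmost strand is carried across the vertex by
  \<open>slide_vtx\<close>; this leaves a curl, worth v^-12, and two crossings at the vertex, worth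
  - v^6 each, and these factors cancel.\<close>

lemma cap_merge_right: "cap @@ (idn 1 ** merge) = vtx"
proof -
  let ?N3 = "(idn 2 ** N ** idn 1) @@ (idn 1 ** N ** idn 2) @@ (N ** idn 3)"
  have "cap @@ (idn 1 ** merge) = cap @@ ((idn 1 ** vtx) ** idn 1) @@ (idn 3 ** cup)"
    by (simp add: merge_def layers)
  also have "\<dots> = (cap @@ (vtx ** idn 2)) @@ ?N3 @@ (idn 3 ** cup)"
    by (subst slide_vtx[of N, symmetric]) (simp_all add: layers)
  also have "cap @@ (vtx ** idn 2) = vtx @@ (idn 3 ** cap)"
    using exchange[of vtx cap 3 0 2 0] by (simp add: layers)
  also have "(vtx @@ (idn 3 ** cap)) @@ ?N3 @@ (idn 3 ** cup) =
      vtx @@ (idn 3 ** cap) @@ (idn 2 ** N ** idn 1) @@ ((idn 1 ** N) @@ (N ** idn 1)) ** idn 2 @@ (idn 3 ** cup)"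
    by (simp add: layers)
  also have "((idn 1 ** N) @@ (N ** idn 1)) ** idn 2 @@ (idn 3 ** cup) =
      (idn 3 ** cup) @@ (idn 1 ** N) @@ (N ** idn 1)"
    using exchange[of "(idn 1 ** N) @@ (N ** idn 1)" cup 3 3 0 2] by (simp add: layers)
  also have "vtx @@ (idn 3 ** cap) @@ (idn 2 ** N ** idn 1) @@ (idn 3 ** cup) @@ (idn 1 ** N) @@ (N ** idn 1) =
      vtx @@ (idn 2 ** ((idn 1 ** cap) @@ (N ** idn 1) @@ (idn 1 ** cup))) @@ (idn 1 ** N) @@ (N ** idn 1)"
    by (simp add: layers)
  also have "\<dots> = inverse (v^12) *\<^sub>a ((vtx @@ (idn 1 ** N)) @@ (N ** idn 1))"
    by (simp add: curl_N tens_scale comp_scale scale_comp layers)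
  also have "\<dots> = (inverse (v^12) * (- (v^6) * - (v^6))) *\<^sub>a vtx"
    by (simp add: vtx_N_right vtx_N_left scale_comp scale_mult[symmetric])
  also have "inverse (v^12) * (- (v^6) * - (v^6)) = 1"
    using v_nonzero by (simp add: power_add[symmetric])
  finally show ?thesis by (simp add: scale_1)
qed

text \<open>The mirror image of the definition of \<open>split\<close>. It holds because, by
  \<open>cap_merge_right\<close>, the vertex may be bent on either side.\<close>

lemma split_eq: "(idn 1 ** merge) @@ (cup ** idn 1) = split"
proof (rule bend_inject)
  have "bend ((idn 1 ** merge) @@ (cup ** idn 1)) =
      (idn 1 ** (cap @@ (merge ** idn 1))) @@ (cup ** idn 2)"
    by (simp add: bend_def layers)
  also have "\<dots> = ((idn 1 ** cap) @@ (idn 2 ** merge)) @@ (cup ** idn 2)"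
    unfolding cap_merge_left by (subst cap_merge_right[symmetric]) (simp add: layers)
  also have "\<dots> = (idn 1 ** cap) @@ (idn 2 ** merge) @@ (cup ** idn 2)"
    by (simp add: layers)
  also have "(idn 2 ** merge) @@ (cup ** idn 2) = (cup ** idn 1) @@ merge"
    using exchange[of cup merge 0 2 2 1] by (simp add: layers)
  also have "(idn 1 ** cap) @@ (cup ** idn 1) @@ merge = merge"
    using comp_rewrite[OF zigzag_right, of merge] by (simp add: layers)
  finally show "bend ((idn 1 ** merge) @@ (cup ** idn 1)) = bend split"
    by (simp add: bend_split)
qed simp_all

text \<open>Both sides are the vertex with all three legs turned upwards; the two cups trade their
  order and \<open>split_eq\<close> recognises the result.\<close>

lemma split_cup: "(split ** idn 1) @@ cup = (idn 1 ** split) @@ cup"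
proof -
  have "(idn 1 ** split) @@ cup = (idn 1 ** merge ** idn 1) @@ (idn 2 ** cup) @@ cup"
    by (simp add: split_def layers)
  also have "(idn 2 ** cup) @@ cup = (cup ** idn 2) @@ cup"
    using exchange[of cup cup 0 2 0 2] by (simp add: layers)
  also have "(idn 1 ** merge ** idn 1) @@ (cup ** idn 2) @@ cup =
      (((idn 1 ** merge) @@ (cup ** idn 1)) ** idn 1) @@ cup"
    by (simp add: layers)
  finally show ?thesis by (simp add: split_eq)
qed

text \<open>The rung of \<open>H\<close> can be read from either side: it may as well leave the
  right strand and end on the left one.\<close>

lemma H_eq: "H = (merge ** idn 1) @@ (idn 1 ** split)"
proof -
  have "H = ((idn 1 ** merge) @@ (merge ** idn 2)) @@ (idn 1 ** cup ** idn 1)"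
    by (simp add: H_def split_def layers)
  also have "(idn 1 ** merge) @@ (merge ** idn 2) = (merge ** idn 1) @@ (idn 2 ** merge)"
    using exchange[of merge merge 2 1 2 1] by (simp add: layers)
  also have "((merge ** idn 1) @@ (idn 2 ** merge)) @@ (idn 1 ** cup ** idn 1) =
      (merge ** idn 1) @@ (idn 1 ** ((idn 1 ** merge) @@ (cup ** idn 1)))"
    by (simp add: layers)
  finally show ?thesis by (simp add: split_eq)
qed

lemma H_cup: "H @@ cup = b *\<^sub>a cup"
proof -
  have "H @@ cup = (idn 1 ** merge) @@ (idn 1 ** split) @@ cup"
    by (simp add: H_def comp_assoc split_cup)
  also have "\<dots> = (idn 1 ** (merge @@ split)) @@ cup"
    by (simp add: layers)
  finally show ?thesis by (simp add: bigon tens_scale scale_comp layers)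
qed

section \<open>Rotation by a quarter turn\<close>

definition rot :: "(nat, 'm) arrow \<Rightarrow> (nat, 'm) arrow" where
  "rot f = (idn 2 ** cap) @@ (idn 1 ** f ** idn 1) @@ (cup ** idn 2)"

lemma rot_type [simp]:
  "src (rot f) = 2" "tgt (rot f) = 2" "\<lbrakk>arr f; src f = 2; tgt f = 2\<rbrakk> \<Longrightarrow> arr (rot f)"
  by (simp_all add: rot_def)

lemma rot_scale: "\<lbrakk>arr f; src f = 2; tgt f = 2\<rbrakk> \<Longrightarrow> rot (c *\<^sub>a f) = c *\<^sub>a rot f"
  by (simp add: rot_def scale_tens tens_scale comp_scale scale_comp)

lemma rot_plus:
  "\<lbrakk>arr f; src f = 2; tgt f = 2; arr g; src g = 2; tgt g = 2\<rbrakk> \<Longrightarrow> rot (f +\<^sub>a g) = rot f +\<^sub>a rot g"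
  by (simp add: rot_def plus_tens tens_plus plus_comp comp_plus)

text \<open>The cap meets only the upper factor and the cup only the lower one, so each half can be
  bent on its own before the halves are joined.\<close>

lemma rot_comp:
  assumes [simp]: "arr f" "arr g" "src g = 2" "tgt f = 2" "src f = tgt g"
  shows "rot (f @@ g) =
    (idn 1 ** ((idn 1 ** cap) @@ (f ** idn 1))) @@ (((idn 1 ** g) @@ (cup ** idn 1)) ** idn 1)"
  by (simp add: rot_def layers)

lemma rot_idn: "rot (idn 2) = U"
  using exchange[of cup cap 0 2 2 0] by (simp add: rot_def U_def layers)

lemma rot_U: "rot U = idn 2"
  by (simp add: U_def rot_comp zigzag_right layers)

lemma bend_split': "(idn 1 ** cap) @@ (split ** idn 1) = merge"
  using bend_split by (simp add: bend_def idn_Suc_0)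

lemma rot_I: "rot I = H"
  by (simp add: I_def rot_comp split_eq bend_split') (simp add: H_def)

text \<open>This does not follow formally from \<open>rot_I\<close>, since two quarter turns make a
  half turn and not the identity. Rotation invariance of the vertex moves \<open>merge\<close> and
  \<open>split\<close> to the legs where they meet the cap and the cup.\<close>

lemma rot_H: "rot H = I"
proof -
  have "rot H = (idn 1 ** ((idn 1 ** cap) @@ (idn 1 ** merge ** idn 1))) @@
      ((idn 1 ** split ** idn 1) @@ (cup ** idn 1)) ** idn 1"
    unfolding H_def by (subst rot_comp) (simp_all add: layers)
  also have "(idn 1 ** cap) @@ (idn 1 ** merge ** idn 1) = idn 1 ** (cap @@ (merge ** idn 1))"
    by (simp add: layers)
  also have "\<dots> = (idn 1 ** cap) @@ (idn 2 ** merge)"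
    unfolding cap_merge_left by (subst cap_merge_right[symmetric]) (simp add: layers)
  also have "(idn 1 ** split ** idn 1) @@ (cup ** idn 1) = ((idn 1 ** split) @@ cup) ** idn 1"
    by (simp add: layers)
  also have "\<dots> = (split ** idn 2) @@ (cup ** idn 1)"
    unfolding split_cup[symmetric] by (simp add: layers)
  also have "(idn 1 ** ((idn 1 ** cap) @@ (idn 2 ** merge))) @@ ((split ** idn 2) @@ (cup ** idn 1)) ** idn 1
      = (idn 2 ** cap) @@ ((idn 3 ** merge) @@ (split ** idn 3)) @@ (cup ** idn 2)"
    by (simp add: layers)
  also have "(idn 3 ** merge) @@ (split ** idn 3) = (split ** idn 2) @@ (idn 2 ** merge)"
    using exchange[of split "idn 1 ** merge" 1 2 3 2] by (simp add: layers)
  also have "(idn 2 ** cap) @@ ((split ** idn 2) @@ (idn 2 ** merge)) @@ (cup ** idn 2)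
      = ((idn 2 ** cap) @@ (split ** idn 2)) @@ (idn 2 ** merge) @@ (cup ** idn 2)"
    by (simp add: layers)
  also have "(idn 2 ** cap) @@ (split ** idn 2) = split @@ (idn 1 ** cap)"
    using exchange[of split cap 1 2 2 0] by (simp add: layers)
  also have "(idn 2 ** merge) @@ (cup ** idn 2) = (cup ** idn 1) @@ merge"
    using exchange[of cup merge 0 2 2 1] by (simp add: layers)
  also have "(split @@ (idn 1 ** cap)) @@ (cup ** idn 1) @@ merge
      = split @@ ((idn 1 ** cap) @@ (cup ** idn 1)) @@ merge"
    by (simp add: layers)
  finally show ?thesis by (simp add: zigzag_right I_def layers)
qed

text \<open>Carrying the crossing through the cap inverts it; what remains straightens by a
  zigzag.\<close>

lemma rot_crossing:
  assumes "x = N \<and> y = P \<or> x = P \<and> y = N"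
  shows "rot x = y"
proof -
  have [simp]: "arr x" "arr y" "src x = 2" "tgt x = 2" "src y = 2" "tgt y = 2" using assms by auto
  have "rot x = (idn 1 ** ((idn 1 ** cap) @@ (x ** idn 1))) @@ (cup ** idn 2)"
    by (simp add: rot_def layers)
  also have "\<dots> = (idn 1 ** cap ** idn 1) @@ (idn 2 ** y) @@ (cup ** idn 2)"
    unfolding cap_slide_inverse[OF assms] by (simp add: layers)
  also have "(idn 2 ** y) @@ (cup ** idn 2) = (cup ** idn 2) @@ y"
    using exchange[of cup y 0 2 2 2] by (simp add: layers)
  also have "(idn 1 ** cap ** idn 1) @@ (cup ** idn 2) @@ y =
      (((idn 1 ** cap) @@ (cup ** idn 1)) ** idn 1) @@ y"
    by (simp add: layers)
  finally show ?thesis by (simp add: zigzag_right layers)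
qed

text \<open>The closed square with four legs has four-fold symmetry. This is what removes
  \<open>H @@ H\<close> when a relation is antisymmetrised.\<close>

lemma rot_square: "rot (H @@ H) = H @@ H"
proof -
  have "(idn 1 ** H) @@ (cup ** idn 1) =
      (idn 2 ** merge) @@ (((idn 1 ** split) @@ cup) ** idn 1)"
    by (simp add: H_def layers)
  also have "\<dots> = ((idn 2 ** merge) @@ (split ** idn 2)) @@ (cup ** idn 1)"
    unfolding split_cup[symmetric] by (simp add: layers)
  also have "(idn 2 ** merge) @@ (split ** idn 2) = (split ** idn 1) @@ (idn 1 ** merge)"
    using exchange[of split merge 1 2 2 1] by (simp add: layers)
  also have "((split ** idn 1) @@ (idn 1 ** merge)) @@ (cup ** idn 1) = (split ** idn 1) @@ split"
    by (simp add: comp_assoc split_eq)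
  finally have 1: "(idn 1 ** H) @@ (cup ** idn 1) = (split ** idn 1) @@ split" .
  have "(idn 1 ** cap) @@ (H ** idn 1) =
      ((idn 1 ** cap) @@ (merge ** idn 2)) @@ (idn 1 ** split ** idn 1)"
    by (simp add: H_eq layers)
  also have "(idn 1 ** cap) @@ (merge ** idn 2) = merge @@ (idn 2 ** cap)"
    using exchange[of merge cap 2 1 2 0] by (simp add: layers)
  also have "(merge @@ (idn 2 ** cap)) @@ (idn 1 ** split ** idn 1) =
      merge @@ (idn 1 ** ((idn 1 ** cap) @@ (split ** idn 1)))"
    by (simp add: layers)
  finally have 2: "(idn 1 ** cap) @@ (H ** idn 1) = merge @@ (idn 1 ** merge)"
    by (simp add: bend_split')
  have "rot (H @@ H) = (idn 1 ** merge) @@ ((idn 2 ** merge) @@ (split ** idn 2)) @@ (split ** idn 1)"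
    by (simp add: rot_comp 1 2) (simp add: layers)
  also have "(idn 2 ** merge) @@ (split ** idn 2) = (split ** idn 1) @@ (idn 1 ** merge)"
    using exchange[of split merge 1 2 2 1] by (simp add: layers)
  finally show ?thesis by (simp add: H_def comp_assoc)
qed

end

section \<open>Consequences of the quantum Jacobi relation\<close>

text \<open>Gaussian elimination: a pivot \<open>j\<close> clears the coordinate \<open>k\<close>
  from all other vectors, which costs one vector for one coordinate.\<close>

lemma exists_linear_relation:
  fixes x :: "'i \<Rightarrow> 'k \<Rightarrow> 'a::field"
  assumes "finite K" "card K < card A"
  shows "\<exists>a. (\<exists>i\<in>A. a i \<noteq> 0) \<and> (\<forall>k\<in>K. (\<Sum>i\<in>A. a i * x i k) = 0)"
  using assms
proof (induction K arbitrary: A x rule: finite_induct)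
  case empty
  then have "A \<noteq> {}" by auto
  then show ?case by (intro exI[of _ "\<lambda>_. 1"]) auto
next
  case (insert k K)
  from insert.prems have fin: "finite A" using card.infinite by fastforce
  show ?case
  proof (cases "\<exists>j\<in>A. x j k \<noteq> 0")
    case False
    from insert.prems insert.hyps have "card K < card A" by simp
    then obtain a where "\<exists>i\<in>A. a i \<noteq> 0" "\<forall>l\<in>K. (\<Sum>i\<in>A. a i * x i l) = 0"
      using insert.IH[of A x] by blast
    moreover have "(\<Sum>i\<in>A. a i * x i k) = 0" using False by (intro sum.neutral) auto
    ultimately show ?thesis by blast
  next
    case True
    then obtain j where j: "j \<in> A" "x j k \<noteq> 0" by blast
    have "card K < card (A - {j})" using insert.prems insert.hyps fin j by simp
    then obtain a where a: "\<exists>i\<in>A - {j}. a i \<noteq> 0"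
        "\<forall>l\<in>K. (\<Sum>i\<in>A - {j}. a i * (x i l - x i k / x j k * x j l)) = 0"
      using insert.IH[of "A - {j}" "\<lambda>i l. x i l - x i k / x j k * x j l"] by blast
    \<comment> \<open>Gives back the multiples of vector \<open>j\<close> that the elimination had
      subtracted from the others.\<close>
    define c where "c = - (\<Sum>i\<in>A - {j}. a i * (x i k / x j k))"
    have sum_c: "(\<Sum>i\<in>A. (a(j := c)) i * x i l) = c * x j l + (\<Sum>i\<in>A - {j}. a i * x i l)" for l
      using fin j by (subst sum.remove[of _ j]) (auto intro!: sum.cong)
    have "(\<Sum>i\<in>A. (a(j := c)) i * x i l) =
        (\<Sum>i\<in>A - {j}. a i * (x i l - x i k / x j k * x j l))" for l
      unfolding sum_c by (simp add: c_def sum_distrib_right sum_subtractf right_diff_distrib mult.assoc)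
    moreover have "(\<Sum>i\<in>A - {j}. a i * (x i k - x i k / x j k * x j k)) = 0"
      using j by simp
    ultimately have "\<forall>l\<in>insert k K. (\<Sum>i\<in>A. (a(j := c)) i * x i l) = 0" using a by simp
    moreover have "\<exists>i\<in>A. (a(j := c)) i \<noteq> 0" using a by auto
    ultimately show ?thesis by blast
  qed
qed

text \<open>The dimension bound enters as a family of at most five linear functionals that jointly
  separate the points of C(4); in the application they are the coordinates of a basis.\<close>

locale exceptional_calculus = elementary_calculus where arr = arr
  for arr :: "(nat, 'm) arrow \<Rightarrow> bool" +
  fixes K :: "'k set" and \<phi> :: "'k \<Rightarrow> (nat, 'm) arrow \<Rightarrow> complex"
  assumes jacobi: "inverse v ^ 3 *\<^sub>a (H @@ N) +\<^sub>a v *\<^sub>a I +\<^sub>a (- inverse v) *\<^sub>a H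
      +\<^sub>a \<alpha> *\<^sub>a (N +\<^sub>a (v^4) *\<^sub>a U +\<^sub>a (inverse v ^ 4) *\<^sub>a idn 2) = nul 2 2"
    and finite_K: "finite K" and card_K: "card K \<le> 5"
    and \<phi>_plus: "\<lbrakk>k \<in> K; arr f; src f = 4; tgt f = 0; arr g; src g = 4; tgt g = 0\<rbrakk>
      \<Longrightarrow> \<phi> k (f +\<^sub>a g) = \<phi> k f + \<phi> k g"
    and \<phi>_scale: "\<lbrakk>k \<in> K; arr f; src f = 4; tgt f = 0\<rbrakk> \<Longrightarrow> \<phi> k (c *\<^sub>a f) = c * \<phi> k f"
    and \<phi>_separates: "\<lbrakk>arr f; src f = 4; tgt f = 0; \<forall>k\<in>K. \<phi> k f = 0\<rbrakk> \<Longrightarrow> f = nul 4 0"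
begin

text \<open>Bending twice identifies End(X X) with C(4), where the functionals live.\<close>

abbreviation co :: "'k \<Rightarrow> (nat, 'm) arrow \<Rightarrow> complex" where
  "co k f \<equiv> \<phi> k (bend (bend f))"

lemma co_plus:
  "\<lbrakk>k \<in> K; arr f; src f = 2; tgt f = 2; arr g; src g = 2; tgt g = 2\<rbrakk>
    \<Longrightarrow> co k (f +\<^sub>a g) = co k f + co k g"
  by (simp add: bend_plus \<phi>_plus)

lemma co_scale: "\<lbrakk>k \<in> K; arr f; src f = 2; tgt f = 2\<rbrakk> \<Longrightarrow> co k (c *\<^sub>a f) = c * co k f"
  by (simp add: bend_scale \<phi>_scale)

lemma co_nul: "k \<in> K \<Longrightarrow> co k (nul 2 2) = 0"
  using co_scale[of k "nul 2 2" 0] by (simp add: scale_nul)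

lemma bend_nul: "n \<ge> 1 \<Longrightarrow> bend (nul m n) = nul (m + 1) (n - 1)"
  using bend_scale[of "nul m n" 0] by (simp add: scale_0)

lemma co_separates:
  assumes "arr f" "src f = 2" "tgt f = 2" "\<And>k. k \<in> K \<Longrightarrow> co k f = 0"
  shows "f = nul 2 2"
proof (rule bend_inject)
  show "bend f = bend (nul 2 2)"
  proof (rule bend_inject)
    show "bend (bend f) = bend (bend (nul 2 2))"
      using \<phi>_separates[of "bend (bend f)"] assms by (simp add: bend_nul)
  qed (simp_all add: assms)
qed (simp_all add: assms)

lemmas co_simps = co_plus co_scale co_nul

text \<open>The order pairs each diagram with its quarter turn, so that rotation exchanges
  neighbouring coefficients and fixes the last one.\<close>

definition comb where
  "comb a0 a1 a2 a3 a4 a5 a6 = a0 *\<^sub>a idn 2 +\<^sub>a a1 *\<^sub>a U +\<^sub>a a2 *\<^sub>a I +\<^sub>a a3 *\<^sub>a H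
    +\<^sub>a a4 *\<^sub>a N +\<^sub>a a5 *\<^sub>a P +\<^sub>a a6 *\<^sub>a (H @@ H)"

definition rel where
  "rel a0 a1 a2 a3 a4 a5 a6 \<longleftrightarrow> comb a0 a1 a2 a3 a4 a5 a6 = nul 2 2"

definition arel where "arel x y z \<longleftrightarrow> rel z (- z) y (- y) x (- x) 0"

lemma comb_type [simp]:
  "src (comb a0 a1 a2 a3 a4 a5 a6) = 2" "tgt (comb a0 a1 a2 a3 a4 a5 a6) = 2"
  "arr (comb a0 a1 a2 a3 a4 a5 a6)"
  by (simp_all add: comb_def)

lemma co_comb:
  "k \<in> K \<Longrightarrow> co k (comb a0 a1 a2 a3 a4 a5 a6) =
    a0 * co k (idn 2) + a1 * co k U + a2 * co k I + a3 * co k H + a4 * co k N + a5 * co k P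
      + a6 * co k (H @@ H)"
  by (simp add: comb_def co_simps)

text \<open>Turns a relation between diagrams into scalar equations, one for each coordinate, so
  that relations can be combined by arithmetic in the complex numbers.\<close>

lemma rel_iff:
  "rel a0 a1 a2 a3 a4 a5 a6 \<longleftrightarrow> (\<forall>k\<in>K.
    a0 * co k (idn 2) + a1 * co k U + a2 * co k I + a3 * co k H + a4 * co k N + a5 * co k P
      + a6 * co k (H @@ H) = 0)" (is "?L \<longleftrightarrow> ?R")
proof
  assume ?L
  then show ?R using co_comb[symmetric] co_nul unfolding rel_def by simp
next
  assume ?R
  then show ?L unfolding rel_def by (intro co_separates) (simp_all add: co_comb)
qed

lemma rel_plus:
  assumes "rel a0 a1 a2 a3 a4 a5 a6" "rel b0 b1 b2 b3 b4 b5 b6"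
  shows "rel (a0 + b0) (a1 + b1) (a2 + b2) (a3 + b3) (a4 + b4) (a5 + b5) (a6 + b6)"
  unfolding rel_iff
proof
  fix k assume k: "k \<in> K"
  let ?A = "a0 * co k (idn 2) + a1 * co k U + a2 * co k I + a3 * co k H + a4 * co k N
      + a5 * co k P + a6 * co k (H @@ H)"
  let ?B = "b0 * co k (idn 2) + b1 * co k U + b2 * co k I + b3 * co k H + b4 * co k N
      + b5 * co k P + b6 * co k (H @@ H)"
  have "?A = 0" "?B = 0" using assms k unfolding rel_iff by blast+
  then have "?A + ?B = 0" by simp
  then show "(a0 + b0) * co k (idn 2) + (a1 + b1) * co k U + (a2 + b2) * co k I
      + (a3 + b3) * co k H + (a4 + b4) * co k N + (a5 + b5) * co k P + (a6 + b6) * co k (H @@ H) = 0"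
    by (simp only: distrib_right add_ac)
qed

lemma rel_scale:
  assumes "rel a0 a1 a2 a3 a4 a5 a6"
  shows "rel (c * a0) (c * a1) (c * a2) (c * a3) (c * a4) (c * a5) (c * a6)"
  unfolding rel_iff
proof
  fix k assume "k \<in> K"
  then have "c * (a0 * co k (idn 2) + a1 * co k U + a2 * co k I + a3 * co k H + a4 * co k N
      + a5 * co k P + a6 * co k (H @@ H)) = 0"
    using assms unfolding rel_iff by simp
  then show "c * a0 * co k (idn 2) + c * a1 * co k U + c * a2 * co k I + c * a3 * co k H
      + c * a4 * co k N + c * a5 * co k P + c * a6 * co k (H @@ H) = 0"
    by (simp add: algebra_simps)
qed

lemma rel_rot:
  assumes "rel a0 a1 a2 a3 a4 a5 a6"
  shows "rel a1 a0 a3 a2 a5 a4 a6"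
proof -
  have "rot (comb a0 a1 a2 a3 a4 a5 a6) = a0 *\<^sub>a U +\<^sub>a a1 *\<^sub>a idn 2 +\<^sub>a a2 *\<^sub>a H +\<^sub>a a3 *\<^sub>a I
    +\<^sub>a a4 *\<^sub>a P +\<^sub>a a5 *\<^sub>a N +\<^sub>a a6 *\<^sub>a (H @@ H)"
    by (simp add: comb_def rot_plus rot_scale rot_idn rot_U rot_I rot_H rot_square
        rot_crossing[of N P] rot_crossing[of P N])
  moreover have "rot (nul 2 2) = nul 2 2"
    using rot_scale[of "nul 2 2" 0] by (simp add: scale_nul scale_0)
  ultimately have *: "a0 *\<^sub>a U +\<^sub>a a1 *\<^sub>a idn 2 +\<^sub>a a2 *\<^sub>a H +\<^sub>a a3 *\<^sub>a I
    +\<^sub>a a4 *\<^sub>a P +\<^sub>a a5 *\<^sub>a N +\<^sub>a a6 *\<^sub>a (H @@ H) = nul 2 2"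
    using assms by (simp add: rel_def)
  show ?thesis
    unfolding rel_iff
  proof
    fix k assume "k \<in> K"
    then show "a1 * co k (idn 2) + a0 * co k U + a3 * co k I + a2 * co k H + a5 * co k N
      + a4 * co k P + a6 * co k (H @@ H) = 0"
      using arg_cong[OF *, of "co k"] by (simp add: co_simps add_ac)
  qed
qed

text \<open>The relation minus its quarter turn. The coefficient of \<open>H @@ H\<close> cancels
  because rotation fixes it.\<close>

lemma rel_antisym:
  assumes "rel a0 a1 a2 a3 a4 a5 a6"
  shows "arel (a4 - a5) (a2 - a3) (a0 - a1)"
  using rel_plus[OF assms rel_scale[OF rel_rot[OF assms], of "-1"]] by (simp add: arel_def)

lemma arel_plus: "\<lbrakk>arel x y z; arel x' y' z'\<rbrakk> \<Longrightarrow> arel (x + x') (y + y') (z + z')"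
  using rel_plus[of z "- z" y "- y" x "- x" 0 z' "- z'" y' "- y'" x' "- x'" 0]
  by (simp add: arel_def add_ac)

lemma arel_scale: "arel x y z \<Longrightarrow> arel (c * x) (c * y) (c * z)"
  using rel_scale[of z "- z" y "- y" x "- x" 0 c] by (simp add: arel_def)

section \<open>Closing off relations with the cup and the split\<close>

lemma cap_split: "cap @@ split = nul 1 0"
proof -
  have "cap @@ split = (cap @@ (merge ** idn 1)) @@ (idn 1 ** cup)"
    by (simp add: split_def comp_assoc)
  also have "\<dots> = (cap @@ (idn 1 ** merge)) @@ (idn 1 ** cup)"
    by (simp only: cap_merge_left cap_merge_right)
  also have "\<dots> = cap @@ (idn 1 ** (merge @@ cup))"
    by (simp add: layers)
  finally show ?thesis by (simp add: lollipop tens_nul comp_nul)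
qed

text \<open>\<open>cup\<close> is an eigenvector of all basic diagrams. The eigenvalue zero is also
  written as a scalar multiple, so that the coefficients of a whole relation can be collected in one
  scalar.\<close>

lemma comp_cup:
  "U @@ cup = d *\<^sub>a cup" "I @@ cup = 0 *\<^sub>a cup" "N @@ cup = (v^12) *\<^sub>a cup"
  "P @@ cup = (inverse v ^ 12) *\<^sub>a cup" "(H @@ H) @@ cup = (b * b) *\<^sub>a cup"
  "(H @@ N) @@ cup = (v^12 * b) *\<^sub>a cup"
  by (simp_all add: U_def I_def comp_assoc circle lollipop comp_scale comp_idn comp_nul scale_0
      H_cup N_cup P_cup scale_mult power_inverse)

lemma comp_split:
  "U @@ split = 0 *\<^sub>a split" "I @@ split = b *\<^sub>a split" "P @@ split = (- (inverse v ^ 6)) *\<^sub>a split"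
  "(H @@ H) @@ split = (t * t) *\<^sub>a split" "(H @@ N) @@ split = (- (v^6) * t) *\<^sub>a split"
  by (simp_all add: U_def I_def comp_assoc cap_split bigon comp_scale comp_idn comp_nul scale_0
      triangle N_split P_split scale_mult power_inverse del: mult_minus_left)

lemma rel_cup:
  assumes "rel a0 a1 a2 a3 a4 a5 a6"
  shows "a0 + a1 * d + a3 * b + a4 * v^12 + a5 * inverse v ^ 12 + a6 * (b * b) = 0"
proof (rule scale_cup_inject)
  have "comb a0 a1 a2 a3 a4 a5 a6 @@ cup =
      (a0 + a1 * d + a2 * 0 + a3 * b + a4 * v^12 + a5 * inverse v ^ 12 + a6 * (b * b)) *\<^sub>a cup"
    by (simp only: scale_add scale_mult arr_cup arr_scale)
       (simp add: comb_def plus_comp scale_comp idn_comp comp_cup H_cup scale_mult)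
  then show "(a0 + a1 * d + a3 * b + a4 * v^12 + a5 * inverse v ^ 12 + a6 * (b * b)) *\<^sub>a cup = 0 *\<^sub>a cup"
    using assms by (simp add: rel_def nul_comp scale_0)
qed

lemma rel_split:
  assumes "rel a0 a1 a2 a3 a4 a5 a6"
  shows "a0 + a2 * b + a3 * t - a4 * v^6 - a5 * inverse v ^ 6 + a6 * (t * t) = 0"
proof (rule scale_split_inject)
  have "comb a0 a1 a2 a3 a4 a5 a6 @@ split =
      (a0 + a1 * 0 + a2 * b + a3 * t + a4 * (- (v^6)) + a5 * (- (inverse v ^ 6)) + a6 * (t * t)) *\<^sub>a split"
    by (simp only: scale_add scale_mult arr_scale split_type)
       (simp add: comb_def plus_comp scale_comp idn_comp comp_split triangle N_split scale_mult)
  then show "(a0 + a2 * b + a3 * t - a4 * v^6 - a5 * inverse v ^ 6 + a6 * (t * t)) *\<^sub>a split = 0 *\<^sub>a split"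
    using assms by (simp add: rel_def nul_comp scale_0)
qed

lemma jacobi_cup:
  "inverse v ^ 3 * (v^12 * b) - inverse v * b + \<alpha> * (v^12 + v^4 * d + inverse v ^ 4) = 0"
proof (rule scale_cup_inject)
  have "(inverse v ^ 3 * (v^12 * b) + v * 0 + (- inverse v) * b + \<alpha> * (v^12 + v^4 * d + inverse v ^ 4)) *\<^sub>a cup =
    (inverse v ^ 3 *\<^sub>a (H @@ N) +\<^sub>a v *\<^sub>a I +\<^sub>a (- inverse v) *\<^sub>a H
      +\<^sub>a \<alpha> *\<^sub>a (N +\<^sub>a (v^4) *\<^sub>a U +\<^sub>a (inverse v ^ 4) *\<^sub>a idn 2)) @@ cup"
    by (simp only: scale_add scale_mult arr_cup arr_scale)
       (simp add: plus_comp scale_comp idn_comp comp_cup H_cup scale_mult)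
  then show "(inverse v ^ 3 * (v^12 * b) - inverse v * b + \<alpha> * (v^12 + v^4 * d + inverse v ^ 4)) *\<^sub>a cup = 0 *\<^sub>a cup"
    by (simp add: jacobi nul_comp scale_0)
qed

lemma jacobi_split:
  "inverse v ^ 3 * (- (v^6) * t) + v * b - inverse v * t + \<alpha> * (- (v^6) + inverse v ^ 4) = 0"
proof (rule scale_split_inject)
  have "(inverse v ^ 3 * (- (v^6) * t) + v * b + (- inverse v) * t + \<alpha> * (- (v^6) + v^4 * 0 + inverse v ^ 4)) *\<^sub>a split =
    (inverse v ^ 3 *\<^sub>a (H @@ N) +\<^sub>a v *\<^sub>a I +\<^sub>a (- inverse v) *\<^sub>a H
      +\<^sub>a \<alpha> *\<^sub>a (N +\<^sub>a (v^4) *\<^sub>a U +\<^sub>a (inverse v ^ 4) *\<^sub>a idn 2)) @@ split"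
    by (simp only: scale_add scale_mult arr_scale split_type)
       (simp add: plus_comp scale_comp idn_comp comp_split N_split triangle scale_mult del: mult_minus_left)
  then show "(inverse v ^ 3 * (- (v^6) * t) + v * b - inverse v * t + \<alpha> * (- (v^6) + inverse v ^ 4)) *\<^sub>a split = 0 *\<^sub>a split"
    by (simp add: jacobi nul_comp scale_0)
qed

section \<open>Composing relations with \<open>H\<close> and with the crossings\<close>

lemma U_P: "U @@ P = (inverse v ^ 12) *\<^sub>a U" and I_P: "I @@ P = (- (inverse v ^ 6)) *\<^sub>a I"
  and U_N: "U @@ N = (v ^ 12) *\<^sub>a U" and I_N: "I @@ N = (- (v ^ 6)) *\<^sub>a I"
  by (simp_all add: U_def I_def comp_assoc cap_P cap_N merge_P merge_N comp_scale power_inverse)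

lemma H_U: "H @@ U = b *\<^sub>a U" and H_I: "H @@ I = t *\<^sub>a I"
proof -
  have "H @@ U = (H @@ cup) @@ cap" by (simp add: U_def comp_assoc)
  then show "H @@ U = b *\<^sub>a U" by (simp add: H_cup U_def scale_comp)
  have "H @@ I = (H @@ split) @@ merge" by (simp add: I_def comp_assoc)
  then show "H @@ I = t *\<^sub>a I" by (simp add: triangle I_def scale_comp)
qed

lemma co_HN:
  assumes "k \<in> K"
  shows "co k (H @@ N) = - (v^4 * co k I) + v^2 * co k H
    - \<alpha> * (v^3 * co k N + v^7 * co k U + inverse v * co k (idn 2))"
proof -
  \<comment> \<open>With a letter \<open>u\<close> and the equation \<open>v * u = 1\<close> the
    claim becomes polynomial, as the Groebner basis method requires; the same device recurs
    below.\<close>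
  define u where "u = inverse v"
  have "v * u = 1" using v_nonzero by (simp add: u_def)
  moreover have "u^3 * co k (H @@ N) + v * co k I - u * co k H
      + \<alpha> * (co k N + v^4 * co k U + u ^ 4 * co k (idn 2)) = 0"
    using arg_cong[OF jacobi, of "co k"] assms by (simp add: u_def co_simps algebra_simps)
  ultimately have "co k (H @@ N) = - (v^4 * co k I) + v^2 * co k H
      - \<alpha> * (v^3 * co k N + v^7 * co k U + u * co k (idn 2))"
    by Groebner_Basis.algebra
  then show ?thesis by (simp add: u_def)
qed

text \<open>Composing the Jacobi relation with \<open>P\<close> turns its \<open>H @@ N\<close> into
  \<open>H\<close> and its \<open>H\<close> into \<open>H @@ P\<close>, for which it is then
  solved.\<close>

lemma co_HP:
  assumes "k \<in> K"
  shows "co k (H @@ P) = inverse v ^ 2 * co k H - inverse v ^ 4 * co k I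
    + \<alpha> * (v * co k (idn 2) + inverse v ^ 7 * co k U + inverse v ^ 3 * co k P)"
proof -
  define u where "u = inverse v"
  have "u ^ 3 *\<^sub>a H +\<^sub>a v *\<^sub>a (- (u ^ 6)) *\<^sub>a I +\<^sub>a (- u) *\<^sub>a (H @@ P)
      +\<^sub>a \<alpha> *\<^sub>a (idn 2 +\<^sub>a (v^4) *\<^sub>a (u ^ 12) *\<^sub>a U +\<^sub>a (u ^ 4) *\<^sub>a P) =
    (u ^ 3 *\<^sub>a (H @@ N) +\<^sub>a v *\<^sub>a I +\<^sub>a (- u) *\<^sub>a H
      +\<^sub>a \<alpha> *\<^sub>a (N +\<^sub>a (v^4) *\<^sub>a U +\<^sub>a (u ^ 4) *\<^sub>a idn 2)) @@ P"
    by (simp add: plus_comp scale_comp idn_comp comp_assoc NP comp_idn U_P[folded u_def] I_P[folded u_def])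
  also have "\<dots> = nul 2 2" unfolding jacobi[folded u_def] by (simp add: nul_comp)
  finally have 0: "u ^ 3 *\<^sub>a H +\<^sub>a v *\<^sub>a (- (u ^ 6)) *\<^sub>a I +\<^sub>a (- u) *\<^sub>a (H @@ P)
      +\<^sub>a \<alpha> *\<^sub>a (idn 2 +\<^sub>a (v^4) *\<^sub>a (u ^ 12) *\<^sub>a U +\<^sub>a (u ^ 4) *\<^sub>a P) = nul 2 2" .
  have "v * u = 1" using v_nonzero by (simp add: u_def)
  moreover have "u ^ 3 * co k H - v * u ^ 6 * co k I - u * co k (H @@ P)
      + \<alpha> * (co k (idn 2) + v^4 * u ^ 12 * co k U + u ^ 4 * co k P) = 0"
    using arg_cong[OF 0, of "co k"] assms by (simp add: co_simps algebra_simps)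
  ultimately have "co k (H @@ P) = u^2 * co k H - u^4 * co k I
      + \<alpha> * (v * co k (idn 2) + u^7 * co k U + u^3 * co k P)"
    by Groebner_Basis.algebra
  then show ?thesis by (simp add: u_def)
qed

text \<open>\<open>U\<close> and \<open>I\<close> are eigenvectors of composition with
  \<open>H\<close>, and both products with a crossing are known. The input must be free of the
  square, since \<open>H @@ H @@ H\<close> has no expression in the basic diagrams.\<close>

lemma rel_H:
  assumes "rel a0 a1 a2 a3 a4 a5 0"
  defines "u \<equiv> inverse v"
  shows "rel (\<alpha> * v * a5 - \<alpha> * u * a4) (b * a1 - \<alpha> * v^7 * a4 + \<alpha> * u^7 * a5)
    (t * a2 - v^4 * a4 - u^4 * a5) (a0 + v^2 * a4 + u^2 * a5) (- \<alpha> * v^3 * a4) (\<alpha> * u^3 * a5) a3"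
  unfolding rel_iff
proof
  fix k assume k: "k \<in> K"
  have "a0 *\<^sub>a H +\<^sub>a a1 *\<^sub>a b *\<^sub>a U +\<^sub>a a2 *\<^sub>a t *\<^sub>a I +\<^sub>a a3 *\<^sub>a (H @@ H)
      +\<^sub>a a4 *\<^sub>a (H @@ N) +\<^sub>a a5 *\<^sub>a (H @@ P) +\<^sub>a 0 *\<^sub>a (H @@ H @@ H) = H @@ comb a0 a1 a2 a3 a4 a5 0"
    by (simp add: comb_def comp_plus comp_scale comp_idn H_U H_I)
  also have "\<dots> = nul 2 2" using assms by (simp add: rel_def comp_nul)
  finally have 0: "a0 *\<^sub>a H +\<^sub>a a1 *\<^sub>a b *\<^sub>a U +\<^sub>a a2 *\<^sub>a t *\<^sub>a I +\<^sub>a a3 *\<^sub>a (H @@ H)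
      +\<^sub>a a4 *\<^sub>a (H @@ N) +\<^sub>a a5 *\<^sub>a (H @@ P) +\<^sub>a 0 *\<^sub>a (H @@ H @@ H) = nul 2 2" .
  have 1: "a0 * co k H + a1 * b * co k U + a2 * t * co k I + a3 * co k (H @@ H)
      + a4 * co k (H @@ N) + a5 * co k (H @@ P) = 0"
    using k arg_cong[OF 0, of "co k"] by (simp add: co_simps mult.assoc)
  have 2: "co k (H @@ N) = - (v^4 * co k I) + v^2 * co k H
      - \<alpha> * (v^3 * co k N + v^7 * co k U + u * co k (idn 2))"
    using co_HN[OF k] by (simp add: u_def)
  have 3: "co k (H @@ P) = u^2 * co k H - u^4 * co k I
      + \<alpha> * (v * co k (idn 2) + u^7 * co k U + u^3 * co k P)"
    using co_HP[OF k] by (simp add: u_def)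
  show "(\<alpha> * v * a5 - \<alpha> * u * a4) * co k (idn 2) + (b * a1 - \<alpha> * v^7 * a4 + \<alpha> * u^7 * a5) * co k U +
      (t * a2 - v^4 * a4 - u^4 * a5) * co k I + (a0 + v^2 * a4 + u^2 * a5) * co k H +
      (- \<alpha> * v^3 * a4) * co k N + (\<alpha> * u^3 * a5) * co k P + a3 * co k (H @@ H) = 0"
    using 1 unfolding 2 3 by (simp add: algebra_simps)
qed

text \<open>The input contains no crossing, because \<open>N @@ N\<close> would lead out of the list
  of basic diagrams.\<close>

lemma rel_N:
  assumes "rel a0 a1 a2 a3 0 0 0"
  shows "rel (- \<alpha> * inverse v * a3) (v^12 * a1 - \<alpha> * v^7 * a3) (- (v^6) * a2 - v^4 * a3) (v^2 * a3)
    (a0 - \<alpha> * v^3 * a3) 0 0"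
  unfolding rel_iff
proof
  fix k assume k: "k \<in> K"
  have "a0 *\<^sub>a N +\<^sub>a a1 *\<^sub>a (v^12) *\<^sub>a U +\<^sub>a a2 *\<^sub>a (- (v^6)) *\<^sub>a I +\<^sub>a a3 *\<^sub>a (H @@ N)
      +\<^sub>a 0 *\<^sub>a (N @@ N) +\<^sub>a 0 *\<^sub>a (P @@ N) +\<^sub>a 0 *\<^sub>a (H @@ H @@ N) = comb a0 a1 a2 a3 0 0 0 @@ N"
    by (simp add: comb_def plus_comp scale_comp idn_comp U_N I_N comp_assoc)
  also have "\<dots> = nul 2 2" using assms by (simp add: rel_def nul_comp)
  finally have 0: "a0 *\<^sub>a N +\<^sub>a a1 *\<^sub>a (v^12) *\<^sub>a U +\<^sub>a a2 *\<^sub>a (- (v^6)) *\<^sub>a I +\<^sub>a a3 *\<^sub>a (H @@ N)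
      +\<^sub>a 0 *\<^sub>a (N @@ N) +\<^sub>a 0 *\<^sub>a (P @@ N) +\<^sub>a 0 *\<^sub>a (H @@ H @@ N) = nul 2 2" .
  show "- \<alpha> * inverse v * a3 * co k (idn 2) + (v^12 * a1 - \<alpha> * v^7 * a3) * co k U
      + (- (v^6) * a2 - v^4 * a3) * co k I + v^2 * a3 * co k H + (a0 - \<alpha> * v^3 * a3) * co k N
      + 0 * co k P + 0 * co k (H @@ H) = 0"
    using k arg_cong[OF 0, of "co k"] by (simp add: co_simps co_HN algebra_simps)
qed

lemma rel_P:
  assumes "rel a0 a1 a2 a3 0 0 0"
  shows "rel (\<alpha> * v * a3) (inverse v ^ 12 * a1 + \<alpha> * inverse v ^ 7 * a3)
    (- (inverse v ^ 6) * a2 - inverse v ^ 4 * a3) (inverse v ^ 2 * a3)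
    0 (a0 + \<alpha> * inverse v ^ 3 * a3) 0"
  unfolding rel_iff
proof
  fix k assume k: "k \<in> K"
  have "a0 *\<^sub>a P +\<^sub>a a1 *\<^sub>a (inverse v ^ 12) *\<^sub>a U +\<^sub>a a2 *\<^sub>a (- (inverse v ^ 6)) *\<^sub>a I +\<^sub>a a3 *\<^sub>a (H @@ P)
      +\<^sub>a 0 *\<^sub>a (N @@ P) +\<^sub>a 0 *\<^sub>a (P @@ P) +\<^sub>a 0 *\<^sub>a (H @@ H @@ P) = comb a0 a1 a2 a3 0 0 0 @@ P"
    by (simp add: comb_def plus_comp scale_comp idn_comp U_P I_P comp_assoc)
  also have "\<dots> = nul 2 2" using assms by (simp add: rel_def nul_comp)
  finally have 0: "a0 *\<^sub>a P +\<^sub>a a1 *\<^sub>a (inverse v ^ 12) *\<^sub>a U +\<^sub>a a2 *\<^sub>a (- (inverse v ^ 6)) *\<^sub>a I +\<^sub>a a3 *\<^sub>a (H @@ P)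
      +\<^sub>a 0 *\<^sub>a (N @@ P) +\<^sub>a 0 *\<^sub>a (P @@ P) +\<^sub>a 0 *\<^sub>a (H @@ H @@ P) = nul 2 2" .
  show "\<alpha> * v * a3 * co k (idn 2) + (inverse v ^ 12 * a1 + \<alpha> * inverse v ^ 7 * a3) * co k U
      + (- (inverse v ^ 6) * a2 - inverse v ^ 4 * a3) * co k I + inverse v ^ 2 * a3 * co k H + 0 * co k N
      + (a0 + \<alpha> * inverse v ^ 3 * a3) * co k P + 0 * co k (H @@ H) = 0"
    using k arg_cong[OF 0, of "co k"] by (simp add: co_simps co_HP algebra_simps del: power_inverse)
qed

text \<open>On \<open>split\<close> the identity acts by 1 and \<open>U\<close> by 0, so closing off
  isolates z: an antisymmetric relation is determined by x and y.\<close>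

lemma arel_split:
  assumes "arel x y z"
  shows "z = (v^6 - inverse v ^ 6) * x - (b - t) * y"
  using rel_split[OF assms[unfolded arel_def]] by Groebner_Basis.algebra

lemma arel_cup:
  assumes "arel x y z"
  shows "z * (1 - d) - y * b + x * (v^12 - inverse v ^ 12) = 0"
  using rel_cup[OF assms[unfolded arel_def]] by (simp add: algebra_simps)

text \<open>The third coefficient may stay anonymous, as \<open>arel_split\<close> recovers it from
  the other two.\<close>

lemma arel_H:
  assumes "arel x y z"
  defines "u \<equiv> inverse v"
  shows "\<exists>z'. arel (- \<alpha> * (v^3 - u^3) * x) (t * y - (v^4 - u^4 + v^2 - u^2) * x - z) z'"
proof -
  have *: "- \<alpha> * v ^ 3 * x - \<alpha> * u ^ 3 * - x = - \<alpha> * (v^3 - u^3) * x"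
    "t * y - v ^ 4 * x - u ^ 4 * - x - (z + v\<^sup>2 * x + u\<^sup>2 * - x) = t * y - (v^4 - u^4 + v^2 - u^2) * x - z"
    by (simp_all add: algebra_simps)
  show ?thesis
    using rel_antisym[OF rel_H[OF assms(1)[unfolded arel_def]], folded u_def, unfolded *] by blast
qed

end

section \<open>Existence and non-degeneracy of the crossing relation\<close>

locale admissible_calculus = exceptional_calculus where arr = arr
  for arr :: "(nat, 'm) arrow \<Rightarrow> bool" +
  assumes v10: "v^10 \<noteq> 1" and v12: "v^12 \<noteq> 1"
begin

text \<open>For \<alpha> = 0 the Jacobi relation closed with the cup reads b (v^9 - v^-1) =
  0.\<close>

lemma alpha_nonzero: "\<alpha> \<noteq> 0"
proof
  assume "\<alpha> = 0"
  then have "b * (inverse v ^ 3 * v^12 - inverse v) = 0"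
    using jacobi_cup by (simp add: algebra_simps)
  then have "inverse v ^ 3 * v^12 = inverse v" using b_nonzero by simp
  then have "v * (inverse v ^ 3 * v^12) = 1" using v_nonzero by simp
  moreover have "v * (inverse v ^ 3 * v^12) = v^10"
    using v_nonzero by (simp add: field_simps power_add[symmetric] flip: power_Suc)
  ultimately show False using v10 by simp
qed

text \<open>Vanishing would mean v^6 = - 1.\<close>

lemma v_cube_sum: "v^3 + inverse v ^ 3 \<noteq> 0"
proof
  define u where "u = inverse v"
  have vu: "v * u = 1" using v_nonzero by (simp add: u_def)
  assume "v^3 + inverse v ^ 3 = 0"
  then have "v^3 + u^3 = 0" by (simp add: u_def)
  with vu have "v^12 = 1" by Groebner_Basis.algebra
  then show False using v12 by simp
qed

text \<open>A dependency that is not rotation symmetric yields its antisymmetric part. A symmetric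
  one has none, but its composite with \<open>H\<close> does: otherwise the three coefficients would
  give x = 0, then z = 0 and t = 0, and closing with the split would give b y = 0.\<close>

lemma exists_arel: "\<exists>x y z. arel x y z \<and> (x \<noteq> 0 \<or> y \<noteq> 0 \<or> z \<noteq> 0)"
proof -
  obtain a where a: "\<exists>i\<in>{0,1,2,3,4,5::nat}. a i \<noteq> 0"
      "\<forall>k\<in>K. (\<Sum>i\<in>{0,1,2,3,4,5}. a i * co k ([idn 2, U, I, H, N, P] ! i)) = 0"
    using exists_linear_relation[OF finite_K, of "{0,1,2,3,4,5::nat}"
        "\<lambda>i k. co k ([idn 2, U, I, H, N, P] ! i)"] card_K by auto
  have r: "rel (a 0) (a 1) (a 2) (a 3) (a 4) (a 5) 0"
    using a(2) unfolding rel_iff by (simp add: add_ac)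
  have r': "arel (a 4 - a 5) (a 2 - a 3) (a 0 - a 1)" by (rule rel_antisym[OF r])
  show ?thesis
  proof (cases "a 4 = a 5 \<and> a 2 = a 3 \<and> a 0 = a 1")
    case False
    then have "a 4 - a 5 \<noteq> 0 \<or> a 2 - a 3 \<noteq> 0 \<or> a 0 - a 1 \<noteq> 0" by auto
    then show ?thesis using r' by blast
  next
    case True
    define u where "u = inverse v"
    define x y z where "x = a 4" and "y = a 2" and "z = a 0"
    have r: "rel z z y y x x 0" using r True by (simp add: x_def y_def z_def)
    have nz: "x \<noteq> 0 \<or> y \<noteq> 0 \<or> z \<noteq> 0" using a(1) True by (auto simp: x_def y_def z_def)
    have r2: "arel (- \<alpha> * v^3 * x - \<alpha> * u^3 * x) (t * y - v^4 * x - u^4 * x - (z + v^2 * x + u^2 * x))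
        (\<alpha> * v * x - \<alpha> * u * x - (b * z - \<alpha> * v^7 * x + \<alpha> * u^7 * x))"
      using rel_antisym[OF rel_H[OF r]] by (simp only: u_def)
    have "- \<alpha> * v^3 * x - \<alpha> * u^3 * x \<noteq> 0 \<or>
        t * y - v^4 * x - u^4 * x - (z + v^2 * x + u^2 * x) \<noteq> 0 \<or>
        \<alpha> * v * x - \<alpha> * u * x - (b * z - \<alpha> * v^7 * x + \<alpha> * u^7 * x) \<noteq> 0"
    proof (rule ccontr)
      assume "\<not> ?thesis"
      then have e: "- \<alpha> * v^3 * x - \<alpha> * u^3 * x = 0"
          "t * y - v^4 * x - u^4 * x - (z + v^2 * x + u^2 * x) = 0"
          "\<alpha> * v * x - \<alpha> * u * x - (b * z - \<alpha> * v^7 * x + \<alpha> * u^7 * x) = 0"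
        by blast+
      have "\<alpha> * (v^3 + u^3) * x = 0" using e(1) by Groebner_Basis.algebra
      then have x: "x = 0" using alpha_nonzero v_cube_sum by (simp add: u_def)
      then have z: "z = 0" using e(3) b_nonzero by simp
      then have y: "y \<noteq> 0" using nz x by simp
      then have t: "t = 0" using e(2) x z by simp
      show False using rel_split[OF r] x z t y b_nonzero by simp
    qed
    then show ?thesis using r2 by blast
  qed
qed

text \<open>In a nontrivial relation with x = 0 also y is nonzero, as y determines z. After
  composing with \<open>N\<close> and \<open>P\<close>, antisymmetrisation produces the crossing
  coefficients z + \<alpha> v^3 y and - (z - \<alpha> v^-3 y); their sum \<alpha> (v^3 + v^-3) y is
  nonzero, so one of them is.\<close>

lemma exists_arel_crossing: "\<exists>x y z. arel x y z \<and> x \<noteq> 0"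
proof (rule ccontr)
  assume no: "\<not> ?thesis"
  obtain x y z where r: "arel x y z" and nz: "x \<noteq> 0 \<or> y \<noteq> 0 \<or> z \<noteq> 0" using exists_arel by blast
  have x: "x = 0" using r no by blast
  have y: "y \<noteq> 0" using nz arel_split[OF r] x by auto
  have r0: "rel z (- z) y (- y) 0 0 0" using r x by (simp add: arel_def)
  have "z - \<alpha> * v^3 * - y - 0 = 0"
    using rel_antisym[OF rel_N[OF r0]] no by blast
  moreover have "0 - (z + \<alpha> * inverse v ^ 3 * - y) = 0"
    using rel_antisym[OF rel_P[OF r0]] no by blast
  ultimately have "\<alpha> * (v^3 + inverse v ^ 3) * y = 0" by (simp add: algebra_simps)
  then show False using alpha_nonzero v_cube_sum y by simp
qed

text \<open>At a zero of Psi4 the coefficient - v (v^2 + v^-2) of \<open>t\<close> in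
  \<open>jacobi_split\<close> disappears, which determines \<open>b\<close>. With this value
  \<open>jacobi_cup\<close> collapses to \<alpha> d = 0.\<close>

lemma Psi4_nonzero: "v^2 + inverse v ^ 2 \<noteq> 0"
proof
  define u where "u = inverse v"
  have vu: "v * u = 1" using v_nonzero by (simp add: u_def)
  assume "v^2 + inverse v ^ 2 = 0"
  then have 0: "v^2 + u^2 = 0" by (simp add: u_def)
  have 1: "u^3 * (v^12 * b) - u * b + \<alpha> * (v^12 + v^4 * d + u^4) = 0"
    and 2: "u^3 * (- (v^6) * t) + v * b - u * t + \<alpha> * (- (v^6) + u^4) = 0"
    using jacobi_cup jacobi_split by (simp_all add: u_def)
  have "u^3 * (- (v^6) * t) - u * t = 0" using vu 0 by Groebner_Basis.algebra
  then have "b = \<alpha> * (v^5 - u^5)" using 2 vu by Groebner_Basis.algebra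
  then have "\<alpha> * d = 0" using 1 0 vu by Groebner_Basis.algebra
  then show False using alpha_nonzero d_nonzero by simp
qed

text \<open>Multiplied by v^4 the expression is (v^4 - 1) (v^2 + v^-2) (v^4 + v^2 + 1). The outer
  factors vanish only at twelfth roots of unity, and the middle one is Psi4.\<close>

lemma bigon_coefficient_nonzero:
  "v^6 - inverse v ^ 6 + v^4 - inverse v ^ 4 + v^2 - inverse v ^ 2 \<noteq> 0"
proof
  define u where "u = inverse v"
  have vu: "v * u = 1" using v_nonzero by (simp add: u_def)
  assume "v^6 - inverse v ^ 6 + v^4 - inverse v ^ 4 + v^2 - inverse v ^ 2 = 0"
  then have "v^6 - u^6 + v^4 - u^4 + v^2 - u^2 = 0" by (simp add: u_def)
  then have "(v^4 - 1) * (v^2 + u^2) * (v^4 + v^2 + 1) = 0" using vu by Groebner_Basis.algebra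
  moreover have "v^2 + u^2 \<noteq> 0" using Psi4_nonzero by (simp add: u_def)
  ultimately consider "v^4 = 1" | "v^4 + v^2 + 1 = 0" by auto
  then have "v^12 = 1" by cases Groebner_Basis.algebra+
  then show False using v12 by simp
qed

text \<open>Take b times the relation minus its composite with \<open>H\<close>. After z is
  substituted from \<open>arel_split\<close>, all occurrences of y, b and t in the second
  coefficient cancel, and division by x leaves constants.\<close>

lemma crossing_relation:
  defines "u \<equiv> inverse v"
  shows "\<exists>z. arel (b + \<alpha> * (v^3 - u^3)) (v^6 - u^6 + v^4 - u^4 + v^2 - u^2) z"
proof -
  obtain x y z where r: "arel x y z" and x: "x \<noteq> 0" using exists_arel_crossing by blast
  have z: "z = (v^6 - u^6) * x - (b - t) * y" using arel_split[OF r] by (simp add: u_def)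
  obtain z' where "arel (- \<alpha> * (v^3 - u^3) * x) (t * y - (v^4 - u^4 + v^2 - u^2) * x - z) z'"
    using arel_H[OF r] by (auto simp: u_def)
  from arel_plus[OF arel_scale[OF this, of "- inverse x"] arel_scale[OF r, of "b * inverse x"]]
  have "arel (- inverse x * (- \<alpha> * (v^3 - u^3) * x) + b * inverse x * x)
      (- inverse x * (t * y - (v^4 - u^4 + v^2 - u^2) * x - z) + b * inverse x * y)
      (- inverse x * z' + b * inverse x * z)" .
  moreover have "- inverse x * (t * y - (v^4 - u^4 + v^2 - u^2) * x - z) + b * inverse x * y
      = v^6 - u^6 + v^4 - u^4 + v^2 - u^2"
    unfolding z using x by (simp add: field_simps)
  moreover have "- inverse x * (- \<alpha> * (v^3 - u^3) * x) + b * inverse x * x = b + \<alpha> * (v^3 - u^3)"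
    using x by (simp add: field_simps)
  ultimately have "arel (b + \<alpha> * (v^3 - u^3)) (v^6 - u^6 + v^4 - u^4 + v^2 - u^2)
      (- inverse x * z' + b * inverse x * z)"
    by (simp only:)
  then show ?thesis by blast
qed

text \<open>If it vanished, \<open>crossing_relation\<close> would be a relation with x = 0 and y
  nonzero, and could clear y from a relation with x = 1. Closing the latter with split and cup gives
  z = v^6 - v^-6 and d = 1 + v^6 + v^-6, which is then confronted with
  \<open>jacobi_cup\<close>.\<close>

lemma crossing_coefficient_nonzero: "b + \<alpha> * (v^3 - inverse v ^ 3) \<noteq> 0"
proof
  define u where "u = inverse v"
  have vu: "v * u = 1" using v_nonzero by (simp add: u_def)
  assume "b + \<alpha> * (v^3 - inverse v ^ 3) = 0"
  then have b: "b + \<alpha> * (v^3 - u^3) = 0" by (simp add: u_def)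
  define c where "c = v^6 - u^6 + v^4 - u^4 + v^2 - u^2"
  have c: "c \<noteq> 0" using bigon_coefficient_nonzero by (simp add: c_def u_def)
  have "\<exists>z. arel (b + \<alpha> * (v^3 - u^3)) c z"
    using crossing_relation unfolding c_def u_def .
  then obtain z1 where r1: "arel 0 c z1" unfolding b by blast
  obtain x y z where r: "arel x y z" and x: "x \<noteq> 0" using exists_arel_crossing by blast
  have "inverse x * x + - (y / (c * x)) * 0 = 1" "inverse x * y + - (y / (c * x)) * c = 0"
    using x c by (simp_all add: field_simps)
  with arel_plus[OF arel_scale[OF r, of "inverse x"] arel_scale[OF r1, of "- (y / (c * x))"]]
  have "arel 1 0 (inverse x * z + - (y / (c * x)) * z1)" by (simp only:)
  then obtain z2 where r2: "arel 1 0 z2" by blast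
  have "z2 = v^6 - u^6" using arel_split[OF r2] by (simp add: u_def)
  moreover have "z2 * (1 - d) + (v^12 - u^12) = 0" using arel_cup[OF r2] by (simp add: u_def)
  ultimately have "(v^6 - u^6) * (1 - d + v^6 + u^6) = 0" by Groebner_Basis.algebra
  moreover have "v^6 - u^6 \<noteq> 0"
  proof
    assume "v^6 - u^6 = 0"
    with vu have "v^12 = 1" by Groebner_Basis.algebra
    then show False using v12 by simp
  qed
  ultimately have d: "1 - d + v^6 + u^6 = 0" by simp
  have 1: "u^3 * (v^12 * b) - u * b + \<alpha> * (v^12 + v^4 * d + u^4) = 0"
    using jacobi_cup by (simp add: u_def)
  have b: "b = - \<alpha> * (v^3 - u^3)" and d: "d = 1 + v^6 + u^6" using b d by (simp_all add: algebra_simps)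
  have "\<alpha> * ((u^3 * v^12 - u) * (u^3 - v^3) + v^12 + v^4 * (1 + v^6 + u^6) + u^4) = 0"
    using 1 unfolding b d by (simp add: algebra_simps)
  then have "(u^3 * v^12 - u) * (u^3 - v^3) + v^12 + v^4 * (1 + v^6 + u^6) + u^4 = 0"
    using alpha_nonzero by simp
  \<comment> \<open>Up to a power of v the left side is 1 + v^6 + v^-6 + v^2 + v^-2, and this is a
    product of cyclotomic polynomials: the twelfth in v and the fifth in v^2.\<close>
  then have "(v^4 - v^2 + 1) * (v^8 + v^6 + v^4 + v^2 + 1) = 0" using vu by Groebner_Basis.algebra
  then consider "v^4 - v^2 + 1 = 0" | "v^8 + v^6 + v^4 + v^2 + 1 = 0" by auto
  then show False
  proof cases
    case 1
    then have "v^12 = 1" by Groebner_Basis.algebra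
    then show False using v12 by simp
  next
    case 2
    then have "v^10 = 1" by Groebner_Basis.algebra
    then show False using v10 by simp
  qed
qed

end

section \<open>The parameter of the exceptional series\<close>

lemma complex_cube_root: "\<exists>s :: complex. s ^ 3 = z"
proof
  have "rcis (root 3 (cmod z)) (Arg z / 3) ^ 3 = rcis (cmod z) (Arg z)"
    by (simp add: DeMoivre2)
  then show "rcis (root 3 (cmod z)) (Arg z / 3) ^ 3 = z" by (simp add: rcis_cmod_Arg)
qed

text \<open>Integer powers give way to natural powers of inverses, which polynomial arithmetic can
  treat as further variables.\<close>

lemma qnum_simps:
  "qnum v w 1 0 = w - inverse w" "qnum v w 1 (-1) = w * inverse v - inverse w * v"
  "qnum v w 1 5 = w * v^5 - inverse w * inverse v ^ 5"
  "qnum v w 1 (-6) = w * inverse v ^ 6 - inverse w * v ^ 6"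
  "qsum v w 1 2 = w * v^2 + inverse w * inverse v ^ 2"
  "qsum v w 1 (-3) = w * inverse v ^ 3 + inverse w * v ^ 3"
  "qsum v w 2 (-1) = w^2 * inverse v + inverse w ^ 2 * v"
  by (simp_all add: qnum_def qsum_def power_int_minus power_inverse)

lemma Psi_simps:
  "\<Psi>1 v = v - inverse v" "\<Psi>2 v = v + inverse v" "\<Psi>3 v = v^2 + 1 + inverse v ^ 2"
  "\<Psi>4 v = v^2 + inverse v ^ 2" "\<Psi>6 v = v^2 - 1 + inverse v ^ 2"
  by (simp_all add: "\<Psi>1_def" "\<Psi>2_def" "\<Psi>3_def" "\<Psi>4_def" "\<Psi>6_def" power_int_minus power_inverse)

text \<open>A root of x^2 - y x + 1, whose two roots have product 1.\<close>

lemma exists_reciprocal_sum: "\<exists>x :: complex. x \<noteq> 0 \<and> x + inverse x = y"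
proof -
  define x where "x = (y + csqrt (y^2 - 4)) / 2"
  have "(csqrt (y^2 - 4))^2 = y^2 - 4" by simp
  then have x: "x * (y - x) = 1" by (simp add: x_def field_simps power2_eq_square)
  then have "x \<noteq> 0" by auto
  moreover have "inverse x = y - x" using x \<open>x \<noteq> 0\<close> by (metis inverse_unique)
  ultimately show ?thesis by (intro exI[of _ x]) simp
qed

lemma divide_combination:
  fixes a :: "'a::field"
  shows "\<lbrakk>p \<noteq> 0; a * p - b * c = e\<rbrakk> \<Longrightarrow> a - b * (c / p) = e / p"
  by (auto simp: field_simps)

context admissible_calculus
begin

lemma Psi1_nonzero: "v - inverse v \<noteq> 0" and Psi6_nonzero: "v^2 - 1 + inverse v ^ 2 \<noteq> 0"
  and v5: "v^5 - inverse v ^ 5 \<noteq> 0" and v6: "v^6 - inverse v ^ 6 \<noteq> 0"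
proof -
  define u where "u = inverse v"
  have vu: "v * u = 1" using v_nonzero by (simp add: u_def)
  have "v^12 = 1" if "v - u = 0" using that vu by Groebner_Basis.algebra
  then show "v - inverse v \<noteq> 0" using v12 by (auto simp: u_def)
  have "v^12 = 1" if "v^2 - 1 + u^2 = 0" using that vu by Groebner_Basis.algebra
  then show "v^2 - 1 + inverse v ^ 2 \<noteq> 0" using v12 by (auto simp: u_def)
  have "v^10 = 1" if "v^5 - u^5 = 0" using that vu by Groebner_Basis.algebra
  then show "v^5 - inverse v ^ 5 \<noteq> 0" using v10 by (auto simp: u_def)
  have "v^12 = 1" if "v^6 - u^6 = 0" using that vu by Groebner_Basis.algebra
  then show "v^6 - inverse v ^ 6 \<noteq> 0" using v12 by (auto simp: u_def)
qed

text \<open>Put y = w^2 v^-1 + w^-2 v. Then [\<lambda>][\<lambda>-1] = y - (v + v^-1) and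
  [\<lambda>+5][\<lambda>-6] = y - (v^11 + v^-11), so the formula for \<open>d\<close> is a linear
  equation for y with leading coefficient d + Psi4.\<close>

lemma exists_parameter:
  "\<exists>w s. s \<noteq> 0 \<and> qexc_admissible v w \<and> d = qexc_d v w \<and>
    \<alpha> = s^3 * (- (qnum v w 1 0 * qnum v w 1 (-1) / \<Psi>1 v))"
proof -
  define u where "u = inverse v"
  have vu: "v * u = 1" using v_nonzero by (simp add: u_def)
  define p4 where "p4 = v^2 + u^2"
  have p4: "p4 \<noteq> 0" using Psi4_nonzero by (simp add: p4_def u_def)
  have v5: "v^5 - u^5 \<noteq> 0" and v6: "v^6 - u^6 \<noteq> 0" and p1: "v - u \<noteq> 0"
    using v5 v6 Psi1_nonzero by (simp_all add: u_def)
  have d4: "d + p4 \<noteq> 0"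
  proof
    assume "d + p4 = 0"
    then have d: "d = - p4" by (simp add: add_eq_0_iff2)
    have "u^3 * (v^12 * b) - u * b + \<alpha> * (v^12 + v^4 * d + u^4) = 0"
      using jacobi_cup by (simp add: u_def)
    then have "v^4 * (v^5 - u^5) * (b + \<alpha> * (v^3 - u^3)) = 0"
      unfolding d p4_def using vu by Groebner_Basis.algebra
    then show False using v5 v_nonzero crossing_coefficient_nonzero by (simp add: u_def)
  qed
  define y where "y = (d * (v + u) + p4 * (v^11 + u^11)) / (d + p4)"
  have y: "y * (d + p4) = d * (v + u) + p4 * (v^11 + u^11)"
    using d4 by (simp add: y_def)
  obtain x where x: "x \<noteq> 0" "x + inverse x = y" using exists_reciprocal_sum by blast
  \<comment> \<open>Chosen so that the two summands w^2 v^-1 and w^-2 v of \<open>y\<close> are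
    \<open>x\<close> and its inverse.\<close>
  define w where "w = csqrt (x * v)"
  have w2: "w^2 = x * v" by (simp add: w_def)
  then have w0: "w \<noteq> 0" using x v_nonzero by auto
  define q where "q = inverse w"
  have wq: "w * q = 1" using w0 by (simp add: q_def)
  define L where "L = (w - q) * (w * u - q * v)"
  have "x * (q^2 * v) = 1" using w2 wq by Groebner_Basis.algebra
  then have "inverse x = q^2 * v" by (rule inverse_unique)
  moreover have "x = w^2 * u" using w2 vu by Groebner_Basis.algebra
  ultimately have y': "y = w^2 * u + q^2 * v" using x by simp
  have Ly: "L = y - (v + u)" unfolding L_def y' using wq by Groebner_Basis.algebra
  \<comment> \<open>Uses (v^11 + v^-11) - (v + v^-1) = (v^6 - v^-6) (v^5 - v^-5). Hence the
    denominator of \<open>qexc_d\<close> cannot vanish.\<close>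
  have "L * (d + p4) = p4 * (v^6 - u^6) * (v^5 - u^5)"
    unfolding Ly using y vu by Groebner_Basis.algebra
  then have L: "L \<noteq> 0" using p4 v5 v6 by auto
  have "d * L = - (p4 * (w * v^5 - q * u^5) * (w * u^6 - q * v^6))"
    using y vu wq unfolding Ly y' by Groebner_Basis.algebra
  then have "d = qexc_d v w"
    using L unfolding qexc_d_def qnum_simps Psi_simps L_def q_def u_def p4_def by (simp add: field_simps)
  moreover have "qexc_admissible v w"
    using v_nonzero w0 L p1 Psi6_nonzero
    unfolding qexc_admissible_def qnum_simps Psi_simps L_def q_def u_def by auto
  \<comment> \<open>The cube appears because rescaling the self-duality by \<open>s\<close>
    multiplies \<alpha> by s^-3.\<close>
  moreover obtain s where s: "s^3 = \<alpha> / (- (L / (v - u)))" using complex_cube_root by blast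
  then have "\<alpha> = s^3 * (- (L / (v - u)))" using L p1 by simp
  then have "\<alpha> = s^3 * (- (qnum v w 1 0 * qnum v w 1 (-1) / \<Psi>1 v))"
    unfolding qnum_simps Psi_simps L_def q_def u_def .
  moreover from this have "s \<noteq> 0" using alpha_nonzero by auto
  ultimately show ?thesis by blast
qed

end

section \<open>The skein relations of QExc with normalised self-duality\<close>

locale qexc_calculus = admissible_calculus where arr = arr
  for arr :: "(nat, 'm) arrow \<Rightarrow> bool" +
  fixes w :: complex
  assumes admissible: "qexc_admissible v w"
    and d_eq: "d = qexc_d v w"
    and alpha_eq: "\<alpha> = - (qnum v w 1 0 * qnum v w 1 (-1) / \<Psi>1 v)"
begin

definition L where "L = qnum v w 1 0 * qnum v w 1 (-1)"

abbreviation u where "u \<equiv> inverse v"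
abbreviation q where "q \<equiv> inverse w"

lemma vu: "v * u = 1" using v_nonzero by simp

lemma wq: "w * q = 1" using admissible by (simp add: qexc_admissible_def)

lemma L_nonzero: "L \<noteq> 0" using admissible by (simp add: qexc_admissible_def L_def)

lemma L_poly: "L = (w - q) * (w * u - q * v)" by (simp add: L_def qnum_simps)

lemma alpha_Psi1: "\<alpha> * (v - u) = - L"
  using Psi1_nonzero by (simp add: alpha_eq L_def Psi_simps)

lemma d_L: "d * L = - ((v^2 + u^2) * (w * v^5 - q * u^5) * (w * u^6 - q * v^6))"
  using L_nonzero by (simp add: d_eq qexc_d_def L_def qnum_simps Psi_simps)

text \<open>Multiplying \<open>jacobi_cup\<close> by v - v^-1 trades \<alpha> for
  \<open>- L\<close>, and \<open>d * L\<close> is polynomial by \<open>d_L\<close>. The equation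
  then determines \<open>b\<close>, whose coefficient is (v - v^-1) v^4 (v^5 - v^-5).\<close>

lemma b_eq: "b = (w * v^2 + q * u^2) * (w * u^3 + q * v^3) * (v^2 + 1 + u^2)"
proof -
  define u' q' where "u' = u" and "q' = q"
  have vu: "v * u' = 1" and wq: "w * q' = 1" using vu wq by (simp_all add: u'_def q'_def)
  have "u'^3 * (v^12 * b) - u' * b + \<alpha> * (v^12 + v^4 * d + u'^4) = 0"
    using jacobi_cup by (simp add: u'_def)
  then have "(v - u') * (u'^3 * v^12 - u') * b + (\<alpha> * (v - u')) * (v^12 + v^4 * d + u'^4) = 0"
    by Groebner_Basis.algebra
  then have "(v - u') * (u'^3 * v^12 - u') * b = L * (v^12 + u'^4) + v^4 * (d * L)"
    unfolding alpha_Psi1[folded u'_def] by Groebner_Basis.algebra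
  then have e: "(v - u') * (u'^3 * v^12 - u') * b = ((w - q') * (w * u' - q' * v)) * (v^12 + u'^4)
      + v^4 * (- ((v^2 + u'^2) * (w * v^5 - q' * u'^5) * (w * u'^6 - q' * v^6)))"
    unfolding d_L unfolding L_poly u'_def q'_def .
  have "(v - u') * (v^4 * (v^5 - u'^5)) * (b - (w * v^2 + q' * u'^2) * (w * u'^3 + q' * v^3) * (v^2 + 1 + u'^2)) = 0"
    using e vu wq by Groebner_Basis.algebra
  then show ?thesis using Psi1_nonzero v5 v_nonzero unfolding u'_def q'_def by simp
qed

text \<open>As for \<open>b_eq\<close>, from \<open>jacobi_split\<close>; solving for
  \<open>t\<close> divides by a multiple of Psi4.\<close>

lemma t_eq: "t = (v + u) * ((v + u) * (w^2 * u + q^2 * v) + v^4 - v^2 - 1 - u^2 + u^4)"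
proof -
  define u' q' where "u' = u" and "q' = q"
  have vu: "v * u' = 1" and wq: "w * q' = 1" using vu wq by (simp_all add: u'_def q'_def)
  have "u'^3 * (- (v^6) * t) + v * b - u' * t + \<alpha> * (- (v^6) + u'^4) = 0"
    using jacobi_split by (simp add: u'_def)
  then have "(v - u') * (u'^3 * (- (v^6) * t) + v * b - u' * t) + (\<alpha> * (v - u')) * (- (v^6) + u'^4) = 0"
    by Groebner_Basis.algebra
  then have e: "(v - u') * (u'^3 * (- (v^6) * t) +
      v * ((w * v^2 + q' * u'^2) * (w * u'^3 + q' * v^3) * (v^2 + 1 + u'^2)) - u' * t)
      + (- ((w - q') * (w * u' - q' * v))) * (- (v^6) + u'^4) = 0"
    unfolding alpha_Psi1[folded u'_def] unfolding L_poly b_eq u'_def q'_def .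
  have "(v - u') * (v * (v^2 + u'^2)) *
      (t - (v + u') * ((v + u') * (w^2 * u' + q'^2 * v) + v^4 - v^2 - 1 - u'^2 + u'^4)) = 0"
    using e vu wq by Groebner_Basis.algebra
  then show ?thesis using Psi1_nonzero Psi4_nonzero v_nonzero unfolding u'_def q'_def by simp
qed

lemma b_qexc: "b = qexc_b v w"
  unfolding b_eq qexc_b_def qnum_simps Psi_simps ..

lemma t_qexc: "t = qexc_t v w"
  unfolding t_eq qexc_t_def qnum_simps Psi_simps by (simp add: power_int_minus power_inverse)

text \<open>Normalises \<open>crossing_relation\<close> by its first coefficient \<open>e\<close>.
  With the known \<alpha> and \<open>b\<close> one finds e Psi1 = c Psi6, which is the second
  coefficient; \<open>arel_split\<close> supplies the third.\<close>

lemma crossing_arel: "arel 1 (\<Psi>1 v / \<Psi>6 v) (\<Psi>1 v * L / \<Psi>6 v)"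
proof -
  define u' q' where "u' = u" and "q' = q"
  have vu: "v * u' = 1" and wq: "w * q' = 1" using vu wq by (simp_all add: u'_def q'_def)
  have al: "\<alpha> * (v - u') = - ((w - q') * (w * u' - q' * v))"
    using alpha_Psi1 by (simp add: L_poly u'_def q'_def)
  have b: "b = (w * v^2 + q' * u'^2) * (w * u'^3 + q' * v^3) * (v^2 + 1 + u'^2)"
    using b_eq by (simp add: u'_def q'_def)
  have t: "t = (v + u') * ((v + u') * (w^2 * u' + q'^2 * v) + v^4 - v^2 - 1 - u'^2 + u'^4)"
    using t_eq by (simp add: u'_def q'_def)
  define e c where "e = b + \<alpha> * (v^3 - u'^3)" and "c = v^6 - u'^6 + v^4 - u'^4 + v^2 - u'^2"
  have e: "e \<noteq> 0" using crossing_coefficient_nonzero by (simp add: e_def u'_def)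
  obtain z where "arel e c z" using crossing_relation unfolding e_def c_def u'_def by blast
  from arel_scale[OF this, of "inverse e"] have "arel 1 (inverse e * c) (inverse e * z)"
    using e by simp
  \<comment> \<open>The factorisation v^3 - v^-3 = (v - v^-1) (v^2 + 1 + v^-2) isolates \<alpha> (v
    - v^-1), which is known.\<close>
  moreover have "e = (v^4 + v^2 + 1 + u'^2 + u'^4) * 0 + b + (v^2 + 1 + u'^2) * (\<alpha> * (v - u'))"
    using vu unfolding e_def by Groebner_Basis.algebra
  then have "e * (v - u') = c * (v^2 - 1 + u'^2)"
    unfolding al b c_def using vu wq by Groebner_Basis.algebra
  then have y: "inverse e * c = \<Psi>1 v / \<Psi>6 v"
    using e Psi6_nonzero by (simp add: Psi_simps u'_def field_simps)
  ultimately have r: "arel 1 (\<Psi>1 v / \<Psi>6 v) (inverse e * z)" by simp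
  have "inverse e * z = (v^6 - u'^6) - (b - t) * (\<Psi>1 v / \<Psi>6 v)"
    using arel_split[OF r] by (simp add: u'_def)
  moreover have "(v^6 - u'^6) * (v^2 - 1 + u'^2) - (b - t) * (v - u') = (v - u') * ((w - q') * (w * u' - q' * v))"
    unfolding b t using vu wq by Groebner_Basis.algebra
  then have "(v^6 - u'^6) - (b - t) * (\<Psi>1 v / \<Psi>6 v) = \<Psi>1 v * L / \<Psi>6 v"
    using divide_combination[of "\<Psi>6 v"] Psi6_nonzero by (simp add: Psi_simps L_poly u'_def q'_def)
  ultimately show ?thesis using r by simp
qed

lemma x_poly:
  "qexc_x1 v w = q^2 * (1 - v^2 - v^4) + (u^4 - 2 * u^2 + 3 * v^2) + w^2 * (u^2 - 1 - v^2)"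
  "qexc_x2 v w = q^2 * (u^2 + 1 - v^2) + (- 3 * u^2 + 2 * v^2 - v^4) + w^2 * (u^4 + u^2 - 1)"
  "qexc_x3 v w = q^4 * (u^2 - 1) + q^2 * (- 2 * u^4 - u^2 + 2 - v^4)
     + (u^6 + 4 * u^4 - 2 * u^2 - 1 + v^2 + v^4)
     + w^2 * (- 2 * u^6 - u^4 + 2 * u^2 - v^2) + w^4 * (u^6 - u^4)"
  "qexc_x4 v w = q^4 * (- (v^4) + v^6) + q^2 * (- (u^2) + 2 * v^2 - v^4 - 2 * v^6)
     + (u^4 + u^2 - 1 - 2 * v^2 + 4 * v^4 + v^6)
     + w^2 * (- (u^4) + 2 - v^2 - 2 * v^4) + w^4 * (- 1 + v^2)"
  by (simp_all add: qexc_x1_def qexc_x2_def qexc_x3_def qexc_x4_def power_int_minus power_inverse)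

text \<open>Composing the crossing relation with \<open>H\<close> produces the square.\<close>

lemma square_rel:
  "rel (qexc_x3 v w / (\<Psi>1 v)^2) (qexc_x4 v w / (\<Psi>1 v)^2) (qexc_x1 v w / \<Psi>1 v) (qexc_x2 v w / \<Psi>1 v)
    (- (\<Psi>2 v * (\<Psi>6 v)^2 * L / (\<Psi>1 v)^2)) 0 1"
proof -
  define u' q' where "u' = u" and "q' = q"
  have vu: "v * u' = 1" and wq: "w * q' = 1" using vu wq by (simp_all add: u'_def q'_def)
  have b: "b = (w * v^2 + q' * u'^2) * (w * u'^3 + q' * v^3) * (v^2 + 1 + u'^2)"
    using b_eq by (simp add: u'_def q'_def)
  have t: "t = (v + u') * ((v + u') * (w^2 * u' + q'^2 * v) + v^4 - v^2 - 1 - u'^2 + u'^4)"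
    using t_eq by (simp add: u'_def q'_def)
  define p1 p6 l where "p1 = \<Psi>1 v" and "p6 = \<Psi>6 v" and "l = L"
  have l: "l = (w - q') * (w * u' - q' * v)" by (simp add: l_def L_poly u'_def q'_def)
  have p1: "p1 = v - u'" "p1 \<noteq> 0" and p6: "p6 = v^2 - 1 + u'^2" "p6 \<noteq> 0"
    using Psi1_nonzero Psi6_nonzero by (simp_all add: p1_def p6_def Psi_simps u'_def)
  have al: "\<alpha> = - (l / p1)" by (simp add: alpha_eq l_def L_def p1_def)
  define i1 i6 where i_defs: "i1 = inverse p1" "i6 = inverse p6"
  have i1: "p1 * i1 = 1" and i6: "p6 * i6 = 1" using p1 p6 by (simp_all add: i_defs)
  note divs = al divide_inverse power_inverse[symmetric] i_defs[symmetric]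
  let ?y = "p1 / p6" and ?z = "p1 * l / p6"
  have r: "rel ?z (- ?z) ?y (- ?y) 1 (- 1) 0"
    using crossing_arel by (simp add: arel_def p1_def p6_def l_def)
  \<comment> \<open>In the composite with \<open>H\<close> the square has coefficient - p1 / p6, so
    \<open>?k\<close> normalises it to 1. Adding \<open>?m\<close> times the original relation then
    cancels the coefficient of \<open>P\<close>.\<close>
  let ?k = "- (p6 / p1)" and ?m = "p6 / p1 * \<alpha> * u'^3"
  have main: "rel (?k * (\<alpha> * v * - 1 - \<alpha> * u' * 1) + ?m * ?z)
      (?k * (b * - ?z - \<alpha> * v ^ 7 * 1 + \<alpha> * u' ^ 7 * - 1) + ?m * - ?z)
      (?k * (t * ?y - v ^ 4 * 1 - u' ^ 4 * - 1) + ?m * ?y)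
      (?k * (?z + v\<^sup>2 * 1 + u'\<^sup>2 * - 1) + ?m * - ?y)
      (?k * (- \<alpha> * v ^ 3 * 1) + ?m * 1) (?k * (\<alpha> * u' ^ 3 * - 1) + ?m * - 1) (?k * - ?y + ?m * 0)"
    using rel_plus[OF rel_scale[OF rel_H[OF r], of ?k] rel_scale[OF r, of ?m]] unfolding u'_def .
  \<comment> \<open>The tabulated polynomials are rewritten through \<open>l\<close>,
    \<open>p1\<close>, \<open>p6\<close>, \<open>b\<close> and \<open>t\<close>. In these terms, and
    with \<open>i1\<close>, \<open>i6\<close> as formal inverses, each coefficient of
    \<open>main\<close> is compared by a polynomial identity.\<close>
  have "qexc_x3 v w = - l * (v + u') * p6 - l * l * u'^3 * p1"
    unfolding x_poly u'_def[symmetric] q'_def[symmetric] l p1(1) p6(1) using vu wq by Groebner_Basis.algebra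
  then have 0: "?k * (\<alpha> * v * - 1 - \<alpha> * u' * 1) + ?m * ?z = qexc_x3 v w / p1^2"
    unfolding divs using i1 i6 by Groebner_Basis.algebra
  have "qexc_x4 v w = b * l * p1^2 - l * (v^7 + u'^7) * p6 + l * l * u'^3 * p1"
    unfolding x_poly u'_def[symmetric] q'_def[symmetric] b l p1(1) p6(1) using vu wq by Groebner_Basis.algebra
  then have 1: "?k * (b * - ?z - \<alpha> * v ^ 7 * 1 + \<alpha> * u' ^ 7 * - 1) + ?m * - ?z = qexc_x4 v w / p1^2"
    unfolding divs using i1 i6 by Groebner_Basis.algebra
  have "qexc_x1 v w = - t * p1 + p6 * (v^4 - u'^4) - l * u'^3"
    unfolding x_poly u'_def[symmetric] q'_def[symmetric] t l p1(1) p6(1) using vu wq by Groebner_Basis.algebra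
  then have 2: "?k * (t * ?y - v ^ 4 * 1 - u' ^ 4 * - 1) + ?m * ?y = qexc_x1 v w / p1"
    unfolding divs using i1 i6 by Groebner_Basis.algebra
  have "qexc_x2 v w = - l * p1 - p6 * (v^2 - u'^2) + l * u'^3"
    unfolding x_poly u'_def[symmetric] q'_def[symmetric] l p1(1) p6(1) using vu wq by Groebner_Basis.algebra
  then have 3: "?k * (?z + v\<^sup>2 * 1 + u'\<^sup>2 * - 1) + ?m * - ?y = qexc_x2 v w / p1"
    unfolding divs using i1 i6 by Groebner_Basis.algebra
  \<comment> \<open>This supplies Psi2 and the second factor Psi6 in the coefficient of the
    crossing.\<close>
  have "v^3 + u'^3 = (v + u') * p6" unfolding p6(1) using vu by Groebner_Basis.algebra
  then have "?k * (- \<alpha> * v ^ 3 * 1) + ?m * 1 = - (l * p6 * ((v + u') * p6) / p1^2)"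
    unfolding divs using i1 i6 by Groebner_Basis.algebra
  then have 4: "?k * (- \<alpha> * v ^ 3 * 1) + ?m * 1 = - (\<Psi>2 v * p6^2 * l / p1^2)"
    by (simp add: Psi_simps u'_def power2_eq_square mult_ac)
  have 5: "?k * (\<alpha> * u' ^ 3 * - 1) + ?m * - 1 = 0" by simp
  have 6: "?k * - ?y + ?m * 0 = 1" using p1(2) p6(2) by simp
  show ?thesis using main unfolding 0 1 2 3 4 5 6 unfolding p1_def p6_def l_def .
qed

end

section \<open>Rescaling the self-duality\<close>

context exceptional_calculus
begin

text \<open>The cup is scaled inversely to preserve the zigzags, and the vertex is kept. As
  \<open>merge\<close> contains one cup and \<open>split\<close> two, \<open>I\<close> and
  \<open>H\<close> scale by s^-3, and so do \<open>b\<close>, \<open>t\<close> and \<alpha>;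
  \<open>d\<close>, \<open>U\<close> and the crossings do not change.\<close>

lemma trivalent_calculus_rescale:
  assumes "s \<noteq> 0"
  shows "trivalent_calculus idn comp tens nul plus scale arr (s *\<^sub>a cap) (inverse s *\<^sub>a cup) vtx N P
    v d (inverse s ^ 3 * b)"
proof unfold_locales
  show "((s *\<^sub>a cap) ** idn 1) @@ (idn 1 ** (inverse s *\<^sub>a cup)) = idn 1"
    "(idn 1 ** (s *\<^sub>a cap)) @@ ((inverse s *\<^sub>a cup) ** idn 1) = idn 1"
    using assms
    by (simp_all add: scale_tens tens_scale scale_comp comp_scale zigzag_left zigzag_right
        scale_mult[symmetric] scale_1)
  show "((s *\<^sub>a cap) ** idn 1) @@ (idn 1 ** x) @@ (x ** idn 1) = idn 1 ** (s *\<^sub>a cap)"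
    if x: "x \<in> {N, P}" for x
  proof -
    have "arr x" "src x = 2" "tgt x = 2" using x by auto
    then show ?thesis by (simp add: scale_tens tens_scale scale_comp slide_cap[OF x])
  qed
  show "\<exists>c. f = c *\<^sub>a s *\<^sub>a cap" if f: "arr f" "src f = 2" "tgt f = 0" for f
  proof -
    obtain c where "f = c *\<^sub>a cap" using hom_2_0[OF f] by blast
    then have "f = (c * inverse s) *\<^sub>a s *\<^sub>a cap"
      using assms by (simp add: scale_mult[symmetric] mult.assoc)
    then show ?thesis by blast
  qed
  show "s *\<^sub>a cap \<noteq> nul 2 0" using scale_eq_nul[of cap s] assms cap_nonzero by auto
qed (use NP PN reidemeister3 slide_vtx hom_3_0 vtx_nonzero v_nonzero d_nonzero b_nonzero assms in
    \<open>simp_all\<close>)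

lemma exceptional_calculus_rescale:
  assumes s: "s \<noteq> 0"
  shows "exceptional_calculus idn comp tens nul plus scale (s *\<^sub>a cap) (inverse s *\<^sub>a cup) vtx N P
    v d (inverse s ^ 3 * b) (inverse s ^ 3 * t) (inverse s ^ 3 * \<alpha>) arr K \<phi>"
proof -
  interpret S: trivalent_calculus idn comp tens nul plus scale arr "s *\<^sub>a cap" "inverse s *\<^sub>a cup" vtx N P
    v d "inverse s ^ 3 * b"
    by (rule trivalent_calculus_rescale[OF s])
  have merge: "S.merge = inverse s *\<^sub>a merge"
    by (simp add: S.merge_def merge_def tens_scale comp_scale)
  have split: "S.split = (inverse s ^ 2) *\<^sub>a split"
    by (simp add: S.split_def split_def merge scale_tens tens_scale scale_comp comp_scale
        scale_mult[symmetric] power2_eq_square)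
  have U: "S.U = U"
    using s by (simp add: S.U_def U_def scale_comp comp_scale scale_mult[symmetric] scale_1)
  have I: "S.I = (inverse s ^ 3) *\<^sub>a I"
    by (simp add: S.I_def I_def merge split scale_comp comp_scale
        scale_mult[symmetric] power2_eq_square power3_eq_cube mult_ac)
  have H: "S.H = (inverse s ^ 3) *\<^sub>a H"
    by (simp add: S.H_def H_def merge split scale_tens tens_scale scale_comp comp_scale
        scale_mult[symmetric] power2_eq_square power3_eq_cube mult_ac)
  show ?thesis
  proof unfold_locales
    show "(s *\<^sub>a cap) @@ (inverse s *\<^sub>a cup) = d *\<^sub>a idn 0"
      using s by (simp add: scale_comp comp_scale circle scale_mult[symmetric] mult.assoc[symmetric])
    show "S.merge @@ (inverse s *\<^sub>a cup) = nul 0 1"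
      by (simp add: merge scale_comp comp_scale lollipop scale_nul)
    show "S.merge @@ S.split = (inverse s ^ 3 * b) *\<^sub>a idn 1"
      by (simp add: merge split scale_comp comp_scale bigon scale_mult[symmetric]
          power2_eq_square power3_eq_cube mult_ac)
    show "S.H @@ S.split = (inverse s ^ 3 * t) *\<^sub>a S.split"
      by (simp add: H split scale_comp comp_scale triangle scale_mult[symmetric] mult_ac)
    show "N @@ S.split = (- (v ^ 6)) *\<^sub>a S.split"
      by (simp add: split comp_scale N_split scale_mult[symmetric] mult_ac)
    show "N @@ (inverse s *\<^sub>a cup) = (v ^ 12) *\<^sub>a inverse s *\<^sub>a cup"
      by (simp add: comp_scale N_cup scale_mult[symmetric] mult_ac)
    let ?J = "inverse v ^ 3 *\<^sub>a (H @@ N) +\<^sub>a v *\<^sub>a I +\<^sub>a (- inverse v) *\<^sub>a H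
      +\<^sub>a \<alpha> *\<^sub>a (N +\<^sub>a (v^4) *\<^sub>a U +\<^sub>a (inverse v ^ 4) *\<^sub>a idn 2)"
    have "inverse v ^ 3 *\<^sub>a (S.H @@ N) +\<^sub>a v *\<^sub>a S.I +\<^sub>a (- inverse v) *\<^sub>a S.H
      +\<^sub>a (inverse s ^ 3 * \<alpha>) *\<^sub>a (N +\<^sub>a (v^4) *\<^sub>a S.U +\<^sub>a (inverse v ^ 4) *\<^sub>a idn 2)
      = (inverse s ^ 3) *\<^sub>a ?J"
      by (simp add: H I U scale_comp scale_plus scale_mult[symmetric] mult_ac)
    then show "inverse v ^ 3 *\<^sub>a (S.H @@ N) +\<^sub>a v *\<^sub>a S.I +\<^sub>a (- inverse v) *\<^sub>a S.H
      +\<^sub>a (inverse s ^ 3 * \<alpha>) *\<^sub>a (N +\<^sub>a (v^4) *\<^sub>a S.U +\<^sub>a (inverse v ^ 4) *\<^sub>a idn 2) = nul 2 2"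
      by (simp add: jacobi scale_nul)
  qed (use finite_K card_K \<phi>_plus \<phi>_scale \<phi>_separates in \<open>simp_all\<close>)
qed

end

lemma (in admissible_calculus) exists_qexc_calculus:
  "\<exists>w s. s \<noteq> 0 \<and> qexc_calculus idn comp tens nul plus scale (s *\<^sub>a cap) (inverse s *\<^sub>a cup) vtx N P
    v d (inverse s ^ 3 * b) (inverse s ^ 3 * t) (inverse s ^ 3 * \<alpha>) K \<phi> arr w"
proof -
  obtain w s where ws: "s \<noteq> 0" "qexc_admissible v w" "d = qexc_d v w"
      "\<alpha> = s^3 * (- (qnum v w 1 0 * qnum v w 1 (-1) / \<Psi>1 v))"
    using exists_parameter by blast
  have "qexc_calculus idn comp tens nul plus scale (s *\<^sub>a cap) (inverse s *\<^sub>a cup) vtx N P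
    v d (inverse s ^ 3 * b) (inverse s ^ 3 * t) (inverse s ^ 3 * \<alpha>) K \<phi> arr w"
    unfolding qexc_calculus_def admissible_calculus_def
  proof (intro conjI)
    show "admissible_calculus_axioms v" using v10 v12 by (rule admissible_calculus_axioms.intro)
    show "qexc_calculus_axioms v d (inverse s ^ 3 * \<alpha>) w"
    proof
      show "inverse s ^ 3 * \<alpha> = - (qnum v w 1 0 * qnum v w 1 (- 1) / \<Psi>1 v)"
        using ws(1) unfolding ws(4) by (simp add: power_inverse field_simps)
    qed (fact ws)+
  qed (rule exceptional_calculus_rescale[OF ws(1)])
  then show ?thesis using ws(1) by blast
qed

section \<open>Evaluation of tangle diagrams\<close>

inductive_cases arity_elims:
  "arity (Strands k) m n" "arity Cap m n" "arity Cup m n" "arity Vertex m n" "arity Neg m n" "arity Pos m n"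
  "arity (f \<cdot> g) m n" "arity (f \<parallel> g) m n" "arity (Null k l) m n" "arity (f +\<^sub>t g) m n" "arity (c *\<^sub>t f) m n"

context trivalent_calculus
begin

primrec eval_tangle :: "tangle \<Rightarrow> (nat, 'm) arrow" where
  "eval_tangle (Strands n) = idn n"
| "eval_tangle Cap = cap"
| "eval_tangle Cup = cup"
| "eval_tangle Vertex = vtx"
| "eval_tangle Neg = N"
| "eval_tangle Pos = P"
| "eval_tangle (f \<cdot> g) = eval_tangle f @@ eval_tangle g"
| "eval_tangle (f \<parallel> g) = eval_tangle f ** eval_tangle g"
| "eval_tangle (Null m n) = nul m n"
| "eval_tangle (f +\<^sub>t g) = eval_tangle f +\<^sub>a eval_tangle g"
| "eval_tangle (c *\<^sub>t f) = c *\<^sub>a eval_tangle f"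

lemma eval_tangle_type:
  "arity f m n \<Longrightarrow> arr (eval_tangle f) \<and> src (eval_tangle f) = m \<and> tgt (eval_tangle f) = n"
  by (induction rule: arity.induct) auto

lemma eval_monoidal_axiom:
  "\<lbrakk>monoidal_axiom f g; arity f m n; arity g m n\<rbrakk> \<Longrightarrow> eval_tangle f = eval_tangle g"
proof (induction rule: monoidal_axiom.induct)
  case 1 from 1(1) show ?case unfolding eval_tangle.simps
    by (intro comp_assoc; elim arity_elims; auto dest!: eval_tangle_type)
next
  case 2 from 2(1) show ?case unfolding eval_tangle.simps
    by (intro idn_comp; elim arity_elims; auto dest!: eval_tangle_type)
next
  case 3 from 3(1) show ?case unfolding eval_tangle.simps
    by (intro comp_idn; elim arity_elims; auto dest!: eval_tangle_type)
next
  case 4 from 4(1) show ?case unfolding eval_tangle.simps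
    by (intro tens_assoc; elim arity_elims; auto dest!: eval_tangle_type)
next
  case 5 from 5(1) show ?case unfolding eval_tangle.simps
    by (intro idn0_tens; elim arity_elims; auto dest!: eval_tangle_type)
next
  case 6 from 6(1) show ?case unfolding eval_tangle.simps
    by (intro tens_idn0; elim arity_elims; auto dest!: eval_tangle_type)
next
  case 7 then show ?case by (simp add: idn_tens_idn)
next
  case 8 from 8(1-4) show ?case unfolding eval_tangle.simps
    by (intro interchange; auto dest!: eval_tangle_type)
qed

lemma eval_linear_axiom:
  "\<lbrakk>linear_axiom f g; arity f m n; arity g m n\<rbrakk> \<Longrightarrow> eval_tangle f = eval_tangle g"
proof (induction rule: linear_axiom.induct)
  case 1 from 1(1) show ?case unfolding eval_tangle.simps
    by (intro plus_assoc; elim arity_elims; auto dest!: eval_tangle_type)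
next
  case 2 from 2(1) show ?case unfolding eval_tangle.simps
    by (intro plus_comm; elim arity_elims; auto dest!: eval_tangle_type)
next
  case 3 from 3(1) show ?case unfolding eval_tangle.simps
    by (intro nul_plus; elim arity_elims; auto dest!: eval_tangle_type)
next
  case 4 from 4 show ?case unfolding eval_tangle.simps
    by (intro scale_0; elim arity_elims; auto dest!: eval_tangle_type)
next
  case 5 from 5(1) show ?case unfolding eval_tangle.simps
    by (intro scale_1; elim arity_elims; auto dest!: eval_tangle_type)
next
  case 6 from 6(1) show ?case unfolding eval_tangle.simps
    by (intro scale_mult; elim arity_elims; auto dest!: eval_tangle_type)
next
  case 7 from 7(1) show ?case unfolding eval_tangle.simps
    by (intro scale_add; elim arity_elims; auto dest!: eval_tangle_type)
next
  case 8 from 8(1) show ?case unfolding eval_tangle.simps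
    by (intro scale_plus; elim arity_elims; auto dest!: eval_tangle_type)
next
  case 9 from 9(1) show ?case unfolding eval_tangle.simps
    by (intro plus_comp; elim arity_elims; auto dest!: eval_tangle_type)
next
  case 10 from 10(1) show ?case unfolding eval_tangle.simps
    by (intro comp_plus; elim arity_elims; auto dest!: eval_tangle_type)
next
  case 11 from 11(1) show ?case unfolding eval_tangle.simps
    by (intro scale_comp; elim arity_elims; auto dest!: eval_tangle_type)
next
  case 12 from 12(1) show ?case unfolding eval_tangle.simps
    by (intro comp_scale; elim arity_elims; auto dest!: eval_tangle_type)
next
  case 13 from 13(1) show ?case unfolding eval_tangle.simps
    by (intro plus_tens; elim arity_elims; auto dest!: eval_tangle_type)
next
  case 14 from 14(1) show ?case unfolding eval_tangle.simps
    by (intro tens_plus; elim arity_elims; auto dest!: eval_tangle_type)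
next
  case 15 from 15(1) show ?case unfolding eval_tangle.simps
    by (intro scale_tens; elim arity_elims; auto dest!: eval_tangle_type)
next
  case 16 from 16(1) show ?case unfolding eval_tangle.simps
    by (intro tens_scale; elim arity_elims; auto dest!: eval_tangle_type)
qed

lemma eval_merge [simp]: "eval_tangle t_merge = merge"
  by (simp add: t_merge_def merge_def)

lemma eval_split [simp]: "eval_tangle t_split = split"
  by (simp add: t_split_def split_def)

lemma eval_UIH [simp]: "eval_tangle t_U = U" "eval_tangle t_I = I" "eval_tangle t_H = H"
  by (simp_all add: t_U_def U_def t_I_def I_def t_H_def H_def)

text \<open>\<open>B\<close> will be the braiding of tensor powers. Only its values at small
  arguments and the recursions coming from the two hexagons matter here.\<close>

lemma eval_braid:
  assumes "B 1 1 = P" "B 1 0 = idn 1" "\<And>n. B 0 n = idn n"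
    and "\<And>n. B 1 (Suc n) = (idn n ** B 1 1) @@ (B 1 n ** idn 1)"
    and "\<And>m n. B (Suc m) n = (B m n ** idn 1) @@ (idn m ** B 1 n)"
  shows "eval_tangle (t_braid m n) = B m n"
proof -
  have 1: "eval_tangle (t_braid1 n) = B 1 n" for n
  proof (induction n)
    case (Suc n)
    then show ?case using assms(4)[of n] by (simp add: assms(1))
  qed (simp add: assms)
  show ?thesis
  proof (induction m)
    case (Suc m)
    then show ?case using assms(5)[of m n] by (simp add: 1)
  qed (simp add: assms)
qed

end

context elementary_calculus
begin

lemma eval_isotopy_move: "isotopy_move f g \<Longrightarrow> eval_tangle f = eval_tangle g"
  by (induction rule: isotopy_move.induct)
    (auto simp: zigzag_left zigzag_right cap_merge_right NP PN reidemeister3 framed_reidemeister1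
      slide_cap slide_vtx)

lemma eval_twist1: "eval_tangle t_twist1 = (v^12) *\<^sub>a idn 1"
  by (simp add: t_twist1_def curl_P)

lemma eval_twist:
  assumes braid: "\<And>m n. eval_tangle (t_braid m n) = B m n"
    and "T 0 = idn 0" "T 1 = (v^12) *\<^sub>a idn 1"
    and "\<And>n. T (Suc n) = B 1 n @@ B n 1 @@ (T n ** T 1)"
  shows "eval_tangle (t_twist n) = T n"
proof (induction n)
  case (Suc n)
  have "eval_tangle (t_twist (Suc n)) = B 1 n @@ B n 1 @@ (T n ** T 1)"
    by (simp only: t_twist.simps eval_tangle.simps braid Suc eval_twist1 assms)
  then show ?case using assms(4)[of n] by simp
qed (simp add: assms)

end

context qexc_calculus
begin

lemma eval_skein: "skein v w f g \<Longrightarrow> eval_tangle f = eval_tangle g"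
proof (induction rule: skein.induct)
  case skein_jacobi
  then show ?case using jacobi by (simp add: alpha_eq[symmetric] power_int_minus power_inverse)
next
  case skein_square
  define y where "y = - (\<Psi>2 v * (\<Psi>6 v)^2 * L / (\<Psi>1 v)^2)"
  define x1 x2 x3 x4 where "x1 = qexc_x1 v w / \<Psi>1 v" and "x2 = qexc_x2 v w / \<Psi>1 v"
    and "x3 = qexc_x3 v w / (\<Psi>1 v)^2" and "x4 = qexc_x4 v w / (\<Psi>1 v)^2"
  have r: "rel x3 x4 x1 x2 y 0 1"
    using square_rel unfolding y_def x1_def x2_def x3_def x4_def .
  \<comment> \<open>The summands stand in another order than in \<open>comb\<close>, so the relation
    is transferred through coordinates.\<close>
  have "(H @@ H) +\<^sub>a y *\<^sub>a N +\<^sub>a x1 *\<^sub>a I +\<^sub>a x2 *\<^sub>a H +\<^sub>a x4 *\<^sub>a U +\<^sub>a x3 *\<^sub>a idn 2 = nul 2 2"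
    by (rule co_separates) (use r in \<open>simp_all add: rel_iff co_simps add_ac\<close>)
  then show ?case
    by (simp add: t_S_def y_def x1_def x2_def x3_def x4_def L_def mult.assoc)
next
  case skein_crossing
  define y z where "y = \<Psi>1 v / \<Psi>6 v" and "z = \<Psi>1 v * L / \<Psi>6 v"
  have r: "rel z (- z) y (- y) 1 (- 1) 0"
    using crossing_arel unfolding arel_def y_def z_def .
  have "N +\<^sub>a (- 1) *\<^sub>a P +\<^sub>a y *\<^sub>a (I +\<^sub>a (- 1) *\<^sub>a H) +\<^sub>a z *\<^sub>a (idn 2 +\<^sub>a (- 1) *\<^sub>a U) = nul 2 2"
    by (rule co_separates) (use r in \<open>simp_all add: rel_iff co_simps algebra_simps\<close>)
  then show ?case
    by (simp add: y_def z_def L_def mult.assoc)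
qed (simp_all add: circle lollipop bigon triangle N_split N_cup d_eq b_qexc[symmetric] t_qexc[symmetric])

text \<open>Soundness of the evaluation, which makes it well defined on the morphisms of
  \<open>QExc\<close>.\<close>

lemma eval_qexc_eq: "qexc_eq v w m n f g \<Longrightarrow> eval_tangle f = eval_tangle g"
  by (induction rule: qexc_eq.induct)
    (auto dest: eval_monoidal_axiom eval_linear_axiom eval_isotopy_move eval_skein)

end

section \<open>Coherence in a monoidal category\<close>

context monoidal_linear_category
begin

definition tarr where
  "tarr f \<longleftrightarrow> src f \<in> objs C \<and> tgt f \<in> objs C \<and> mor f \<in> HOM (src f) (tgt f)"

definition tcomp (infixr \<open>@@\<close> 70) where
  "f @@ g = Arrow (src g) (tgt f) (mor f \<^bold>\<circ> mor g)"

definition ttens (infixr \<open>**\<close> 75) where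
  "f ** g = Arrow (src f \<^bold>\<star> src g) (tgt f \<^bold>\<star> tgt g) (mor f \<^bold>\<otimes> mor g)"

definition "tid a = Arrow a a (\<^bold>i\<^bold>d a)"
definition "tassoc a b c = Arrow ((a \<^bold>\<star> b) \<^bold>\<star> c) (a \<^bold>\<star> (b \<^bold>\<star> c)) (\<a> a b c)"
definition "tassoc' a b c = Arrow (a \<^bold>\<star> (b \<^bold>\<star> c)) ((a \<^bold>\<star> b) \<^bold>\<star> c) (assoc_inv a b c)"
definition "tlunit a = Arrow (\<^bold>1 \<^bold>\<star> a) a (\<l> a)"
definition "tlunit' a = Arrow a (\<^bold>1 \<^bold>\<star> a) (lunit_inv a)"
definition "trunit a = Arrow (a \<^bold>\<star> \<^bold>1) a (\<r> a)"
definition "trunit' a = Arrow a (a \<^bold>\<star> \<^bold>1) (runit_inv a)"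

lemmas tdefs = tcomp_def ttens_def tid_def tassoc_def tassoc'_def tlunit_def tlunit'_def
  trunit_def trunit'_def

lemma inverse_mor_unique:
  assumes "a \<in> objs C" "b \<in> objs C" "inverse_mor a b f g" "inverse_mor a b f h"
  shows "g = h"
proof -
  have m: "f \<in> HOM a b" "g \<in> HOM b a" "h \<in> HOM b a" and e: "g \<^bold>\<circ> f = \<^bold>i\<^bold>d a" "f \<^bold>\<circ> h = \<^bold>i\<^bold>d b"
    using assms by (auto simp: inverse_mor_def)
  have "g = g \<^bold>\<circ> (f \<^bold>\<circ> h)" unfolding e by (rule comp_id[OF assms(2,1) m(2), symmetric])
  also have "\<dots> = (g \<^bold>\<circ> f) \<^bold>\<circ> h" by (rule comp_assoc[OF assms(2,1,2,1) m(2,1,3), symmetric])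
  also have "\<dots> = h" unfolding e by (rule id_comp[OF assms(2,1) m(3)])
  finally show ?thesis .
qed

lemma inv_mor:
  assumes "a \<in> objs C" "b \<in> objs C" "is_iso a b f"
  shows "inverse_mor a b f (inv_mor a b f)"
proof -
  obtain g where g: "inverse_mor a b f g" using assms by (auto simp: is_iso_def)
  show ?thesis unfolding inv_mor_def
    by (rule theI[of _ g]) (rule g, rule inverse_mor_unique[OF assms(1,2) _ g])
qed

lemma obj_closed [simp]: "\<^bold>1 \<in> objs C" "\<lbrakk>a \<in> objs C; b \<in> objs C\<rbrakk> \<Longrightarrow> a \<^bold>\<star> b \<in> objs C"
  by (rule unit_in) (rule tens_ob_in)

lemma tsrc_ttgt [simp]:
  "src (f @@ g) = src g" "tgt (f @@ g) = tgt f"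
  "src (f ** g) = src f \<^bold>\<star> src g" "tgt (f ** g) = tgt f \<^bold>\<star> tgt g"
  "src (tid a) = a" "tgt (tid a) = a"
  "src (tassoc a b c) = (a \<^bold>\<star> b) \<^bold>\<star> c" "tgt (tassoc a b c) = a \<^bold>\<star> (b \<^bold>\<star> c)"
  "src (tassoc' a b c) = a \<^bold>\<star> (b \<^bold>\<star> c)" "tgt (tassoc' a b c) = (a \<^bold>\<star> b) \<^bold>\<star> c"
  "src (tlunit a) = \<^bold>1 \<^bold>\<star> a" "tgt (tlunit a) = a" "src (tlunit' a) = a" "tgt (tlunit' a) = \<^bold>1 \<^bold>\<star> a"
  "src (trunit a) = a \<^bold>\<star> \<^bold>1" "tgt (trunit a) = a" "src (trunit' a) = a" "tgt (trunit' a) = a \<^bold>\<star> \<^bold>1"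
  by (simp_all add: tdefs)

lemma tarr_comp [simp]: "\<lbrakk>tarr f; tarr g; src f = tgt g\<rbrakk> \<Longrightarrow> tarr (f @@ g)"
  using comp_in[of "src g" "tgt g" "tgt f" "mor f" "mor g"] by (simp add: tarr_def tcomp_def)

lemma tarr_tens [simp]: "\<lbrakk>tarr f; tarr g\<rbrakk> \<Longrightarrow> tarr (f ** g)"
  unfolding tarr_def ttens_def using tens_in tens_ob_in by simp

lemma tarr_id [simp]: "a \<in> objs C \<Longrightarrow> tarr (tid a)"
  by (simp add: tarr_def tid_def id_in)

lemma assoc_inverse: "\<lbrakk>a \<in> objs C; b \<in> objs C; c \<in> objs C\<rbrakk>
    \<Longrightarrow> inverse_mor ((a \<^bold>\<star> b) \<^bold>\<star> c) (a \<^bold>\<star> (b \<^bold>\<star> c)) (\<a> a b c) (assoc_inv a b c)"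
  unfolding assoc_inv_def by (intro inv_mor assoc_iso) simp_all

lemma lunit_inverse: "a \<in> objs C \<Longrightarrow> inverse_mor (\<^bold>1 \<^bold>\<star> a) a (\<l> a) (lunit_inv a)"
  unfolding lunit_inv_def by (intro inv_mor lunit_iso) simp_all

lemma runit_inverse: "a \<in> objs C \<Longrightarrow> inverse_mor (a \<^bold>\<star> \<^bold>1) a (\<r> a) (runit_inv a)"
  unfolding runit_inv_def by (intro inv_mor runit_iso) simp_all

lemma tarr_structure [simp]:
  "\<lbrakk>a \<in> objs C; b \<in> objs C; c \<in> objs C\<rbrakk> \<Longrightarrow> tarr (tassoc a b c)"
  "\<lbrakk>a \<in> objs C; b \<in> objs C; c \<in> objs C\<rbrakk> \<Longrightarrow> tarr (tassoc' a b c)"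
  "a \<in> objs C \<Longrightarrow> tarr (tlunit a)" "a \<in> objs C \<Longrightarrow> tarr (tlunit' a)"
  "a \<in> objs C \<Longrightarrow> tarr (trunit a)" "a \<in> objs C \<Longrightarrow> tarr (trunit' a)"
  using assoc_inverse[of a b c] lunit_inverse[of a] runit_inverse[of a]
  by (simp_all add: tarr_def tdefs inverse_mor_def)

lemma tinverse:
  "\<lbrakk>a \<in> objs C; b \<in> objs C; c \<in> objs C\<rbrakk> \<Longrightarrow> tassoc a b c @@ tassoc' a b c = tid (a \<^bold>\<star> (b \<^bold>\<star> c))"
  "\<lbrakk>a \<in> objs C; b \<in> objs C; c \<in> objs C\<rbrakk> \<Longrightarrow> tassoc' a b c @@ tassoc a b c = tid ((a \<^bold>\<star> b) \<^bold>\<star> c)"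
  "a \<in> objs C \<Longrightarrow> tlunit a @@ tlunit' a = tid a" "a \<in> objs C \<Longrightarrow> tlunit' a @@ tlunit a = tid (\<^bold>1 \<^bold>\<star> a)"
  "a \<in> objs C \<Longrightarrow> trunit a @@ trunit' a = tid a" "a \<in> objs C \<Longrightarrow> trunit' a @@ trunit a = tid (a \<^bold>\<star> \<^bold>1)"
  using assoc_inverse[of a b c] lunit_inverse[of a] runit_inverse[of a]
  by (simp_all add: tdefs inverse_mor_def)

lemma tcomp_assoc: "\<lbrakk>tarr f; tarr g; tarr h; src f = tgt g; src g = tgt h\<rbrakk> \<Longrightarrow> (f @@ g) @@ h = f @@ g @@ h"
  using comp_assoc[of "src h" "tgt h" "tgt g" "tgt f" "mor f" "mor g" "mor h"]
  by (simp add: tarr_def tcomp_def)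

lemma tid_comp: "\<lbrakk>tarr f; tgt f = a\<rbrakk> \<Longrightarrow> tid a @@ f = f"
  using id_comp[of "src f" "tgt f" "mor f"] by (cases f) (simp add: tarr_def tcomp_def tid_def)

lemma tcomp_id: "\<lbrakk>tarr f; src f = a\<rbrakk> \<Longrightarrow> f @@ tid a = f"
  using comp_id[of "src f" "tgt f" "mor f"] by (cases f) (simp add: tarr_def tcomp_def tid_def)

lemma ttens_id: "\<lbrakk>a \<in> objs C; b \<in> objs C\<rbrakk> \<Longrightarrow> tid a ** tid b = tid (a \<^bold>\<star> b)"
  by (simp add: tid_def ttens_def tens_id)

lemma tinterchange:
  "\<lbrakk>tarr f; tarr g; tarr f'; tarr g'; src f = tgt g; src f' = tgt g'\<rbrakk>
    \<Longrightarrow> (f ** f') @@ (g ** g') = (f @@ g) ** (f' @@ g')"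
  using interchange[of "src g" "tgt g" "tgt f" "src g'" "tgt g'" "tgt f'" "mor g" "mor f" "mor g'" "mor f'"]
  by (simp add: tarr_def tcomp_def ttens_def)

lemma tassoc_natural:
  "\<lbrakk>tarr f; tarr g; tarr h; src f = a; src g = b; src h = c; tgt f = a'; tgt g = b'; tgt h = c'\<rbrakk>
    \<Longrightarrow> tassoc a' b' c' @@ ((f ** g) ** h) = (f ** g ** h) @@ tassoc a b c"
  using assoc_natural[of "src f" "src g" "src h" "tgt f" "tgt g" "tgt h" "mor f" "mor g" "mor h"]
  by (auto simp: tarr_def tcomp_def ttens_def tassoc_def)

lemma tlunit_natural: "\<lbrakk>tarr f; src f = a; tgt f = b\<rbrakk> \<Longrightarrow> tlunit b @@ (tid \<^bold>1 ** f) = f @@ tlunit a"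
  using lunit_natural[of "src f" "tgt f" "mor f"]
  by (auto simp: tarr_def tcomp_def ttens_def tid_def tlunit_def)

lemma trunit_natural: "\<lbrakk>tarr f; src f = a; tgt f = b\<rbrakk> \<Longrightarrow> trunit b @@ (f ** tid \<^bold>1) = f @@ trunit a"
  using runit_natural[of "src f" "tgt f" "mor f"]
  by (auto simp: tarr_def tcomp_def ttens_def tid_def trunit_def)

lemma tpentagon:
  "\<lbrakk>a \<in> objs C; b \<in> objs C; c \<in> objs C; d \<in> objs C\<rbrakk>
    \<Longrightarrow> (tid a ** tassoc b c d) @@ tassoc a (b \<^bold>\<star> c) d @@ (tassoc a b c ** tid d) =
      tassoc a b (c \<^bold>\<star> d) @@ tassoc (a \<^bold>\<star> b) c d"
  by (simp add: tcomp_def ttens_def tid_def tassoc_def pentagon)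

lemma ttriangle:
  "\<lbrakk>a \<in> objs C; b \<in> objs C\<rbrakk> \<Longrightarrow> (tid a ** tlunit b) @@ tassoc a \<^bold>1 b = trunit a ** tid b"
  by (simp add: tcomp_def ttens_def tid_def tassoc_def tlunit_def trunit_def triangle)

lemma tarr_objs [simp]: "tarr f \<Longrightarrow> src f \<in> objs C" "tarr f \<Longrightarrow> tgt f \<in> objs C"
  by (simp_all add: tarr_def)

lemma tcancel_left:
  assumes "i @@ e = tid (src e)" "tarr e" "tarr i" "src i = tgt e" "tgt i = src e"
    and "tarr f" "tarr g" "tgt f = src e" "tgt g = src e" "e @@ f = e @@ g"
  shows "f = g"
proof -
  have "f = (i @@ e) @@ f" using assms(1-9) by (simp add: tid_comp)
  also have "\<dots> = i @@ e @@ f" using assms(2-9) by (simp add: tcomp_assoc)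
  also have "\<dots> = i @@ e @@ g" by (simp only: assms(10))
  also have "\<dots> = (i @@ e) @@ g" using assms(2-9) by (simp add: tcomp_assoc)
  also have "\<dots> = g" using assms by (simp add: tid_comp)
  finally show ?thesis .
qed

lemma tcancel_right:
  assumes "e @@ i = tid (tgt e)" "tarr e" "tarr i" "src i = tgt e" "tgt i = src e"
    and "tarr f" "tarr g" "src f = tgt e" "src g = tgt e" "f @@ e = g @@ e"
  shows "f = g"
proof -
  have "f = f @@ e @@ i" using assms by (simp add: tcomp_id)
  also have "\<dots> = (f @@ e) @@ i" using assms(2-9) by (simp add: tcomp_assoc)
  also have "\<dots> = g @@ e @@ i" unfolding assms(10) using assms(2-9) by (simp add: tcomp_assoc)
  also have "\<dots> = g" using assms by (simp add: tcomp_id)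
  finally show ?thesis .
qed

lemma tens_unit_right_inject:
  assumes "tarr f" "tarr g" "src f = src g" "tgt f = tgt g" "f ** tid \<^bold>1 = g ** tid \<^bold>1"
  shows "f = g"
proof (rule tcancel_right[where e = "trunit (src f)" and i = "trunit' (src f)"])
  show "f @@ trunit (src f) = g @@ trunit (src f)"
    using assms trunit_natural[of f] trunit_natural[of g] by metis
qed (use assms in \<open>simp_all add: tinverse\<close>)

lemma tens_unit_left_inject:
  assumes "tarr f" "tarr g" "src f = src g" "tgt f = tgt g" "tid \<^bold>1 ** f = tid \<^bold>1 ** g"
  shows "f = g"
proof (rule tcancel_right[where e = "tlunit (src f)" and i = "tlunit' (src f)"])
  show "f @@ tlunit (src f) = g @@ tlunit (src f)"
    using assms tlunit_natural[of f] tlunit_natural[of g] by metis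
qed (use assms in \<open>simp_all add: tinverse\<close>)

text \<open>Kelly's argument: tensored with the unit, the identity follows from the pentagon for
  \<open>a\<close>, \<open>b\<close> and two units together with two triangles.\<close>

lemma trunit_tens:
  assumes [simp]: "a \<in> objs C" "b \<in> objs C"
  shows "trunit (a \<^bold>\<star> b) = (tid a ** trunit b) @@ tassoc a b \<^bold>1"
proof (rule tens_unit_right_inject)
  let ?one = "tid \<^bold>1"
  have "tassoc a b \<^bold>1 @@ (trunit (a \<^bold>\<star> b) ** ?one) =
      (tassoc a b \<^bold>1 @@ ((tid a ** tid b) ** tlunit \<^bold>1)) @@ tassoc (a \<^bold>\<star> b) \<^bold>1 \<^bold>1"
    by (simp add: ttriangle[symmetric] tcomp_assoc ttens_id)
  also have "\<dots> = (tid a ** tid b ** tlunit \<^bold>1) @@ tassoc a b (\<^bold>1 \<^bold>\<star> \<^bold>1) @@ tassoc (a \<^bold>\<star> b) \<^bold>1 \<^bold>1"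
    by (subst tassoc_natural[where a = a and b = b and c = "\<^bold>1 \<^bold>\<star> \<^bold>1"]) (simp_all add: tcomp_assoc)
  also have "\<dots> = ((tid a ** tid b ** tlunit \<^bold>1) @@ (tid a ** tassoc b \<^bold>1 \<^bold>1)) @@ tassoc a (b \<^bold>\<star> \<^bold>1) \<^bold>1
      @@ (tassoc a b \<^bold>1 ** ?one)"
    by (simp add: tpentagon[symmetric] tcomp_assoc)
  also have "(tid a ** tid b ** tlunit \<^bold>1) @@ (tid a ** tassoc b \<^bold>1 \<^bold>1) = tid a ** trunit b ** ?one"
    by (simp add: tinterchange ttriangle tid_comp)
  also have "(tid a ** trunit b ** ?one) @@ tassoc a (b \<^bold>\<star> \<^bold>1) \<^bold>1 @@ (tassoc a b \<^bold>1 ** ?one)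
      = ((tid a ** trunit b ** ?one) @@ tassoc a (b \<^bold>\<star> \<^bold>1) \<^bold>1) @@ (tassoc a b \<^bold>1 ** ?one)"
    by (simp add: tcomp_assoc)
  also have "(tid a ** trunit b ** ?one) @@ tassoc a (b \<^bold>\<star> \<^bold>1) \<^bold>1 =
      tassoc a b \<^bold>1 @@ ((tid a ** trunit b) ** ?one)"
    by (rule tassoc_natural[symmetric]) simp_all
  also have "(tassoc a b \<^bold>1 @@ ((tid a ** trunit b) ** ?one)) @@ (tassoc a b \<^bold>1 ** ?one) =
      tassoc a b \<^bold>1 @@ (((tid a ** trunit b) @@ tassoc a b \<^bold>1) ** ?one)"
    by (simp add: tcomp_assoc tinterchange tid_comp)
  finally show "trunit (a \<^bold>\<star> b) ** ?one = ((tid a ** trunit b) @@ tassoc a b \<^bold>1) ** ?one"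
    by (rule tcancel_left[where i = "tassoc' a b \<^bold>1", rotated -1]) (simp_all add: tinverse)
qed simp_all

text \<open>The mirror argument, with two units in front. The isomorphism \<open>?e\<close>, one leg
  of the pentagon, is cancelled at the end.\<close>

lemma tlunit_tens:
  assumes [simp]: "a \<in> objs C" "b \<in> objs C"
  shows "tlunit (a \<^bold>\<star> b) @@ tassoc \<^bold>1 a b = tlunit a ** tid b"
proof (rule tens_unit_left_inject)
  let ?one = "tid \<^bold>1"
  let ?e = "tassoc \<^bold>1 (\<^bold>1 \<^bold>\<star> a) b @@ (tassoc \<^bold>1 \<^bold>1 a ** tid b)"
  let ?i = "(tassoc' \<^bold>1 \<^bold>1 a ** tid b) @@ tassoc' \<^bold>1 (\<^bold>1 \<^bold>\<star> a) b"
  have "(?one ** (tlunit (a \<^bold>\<star> b) @@ tassoc \<^bold>1 a b)) @@ ?e =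
      (?one ** tlunit (a \<^bold>\<star> b)) @@ (?one ** tassoc \<^bold>1 a b) @@ ?e"
    by (simp add: tcomp_assoc[symmetric] tinterchange tid_comp)
  also have "\<dots> = ((?one ** tlunit (a \<^bold>\<star> b)) @@ tassoc \<^bold>1 \<^bold>1 (a \<^bold>\<star> b)) @@ tassoc (\<^bold>1 \<^bold>\<star> \<^bold>1) a b"
    by (simp add: tpentagon tcomp_assoc)
  also have "\<dots> = (trunit \<^bold>1 ** tid a ** tid b) @@ tassoc (\<^bold>1 \<^bold>\<star> \<^bold>1) a b"
    by (simp add: ttriangle ttens_id)
  also have "\<dots> = tassoc \<^bold>1 a b @@ ((trunit \<^bold>1 ** tid a) ** tid b)"
    by (rule tassoc_natural[symmetric]) simp_all
  also have "\<dots> = (tassoc \<^bold>1 a b @@ ((?one ** tlunit a) ** tid b)) @@ (tassoc \<^bold>1 \<^bold>1 a ** tid b)"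
    by (simp add: ttriangle[symmetric] tcomp_assoc tinterchange tid_comp)
  also have "tassoc \<^bold>1 a b @@ ((?one ** tlunit a) ** tid b) =
      (?one ** tlunit a ** tid b) @@ tassoc \<^bold>1 (\<^bold>1 \<^bold>\<star> a) b"
    by (rule tassoc_natural) simp_all
  also have "((?one ** tlunit a ** tid b) @@ tassoc \<^bold>1 (\<^bold>1 \<^bold>\<star> a) b) @@ (tassoc \<^bold>1 \<^bold>1 a ** tid b) =
      (?one ** tlunit a ** tid b) @@ ?e"
    by (simp add: tcomp_assoc)
  finally have eq: "(?one ** (tlunit (a \<^bold>\<star> b) @@ tassoc \<^bold>1 a b)) @@ ?e = (?one ** tlunit a ** tid b) @@ ?e" .
  have "?e @@ ?i = tassoc \<^bold>1 (\<^bold>1 \<^bold>\<star> a) b @@ ((tassoc \<^bold>1 \<^bold>1 a ** tid b) @@ (tassoc' \<^bold>1 \<^bold>1 a ** tid b))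
      @@ tassoc' \<^bold>1 (\<^bold>1 \<^bold>\<star> a) b"
    by (simp add: tcomp_assoc)
  also have "\<dots> = tid (\<^bold>1 \<^bold>\<star> ((\<^bold>1 \<^bold>\<star> a) \<^bold>\<star> b))"
    by (simp add: tinterchange tinverse tid_comp ttens_id)
  finally have "?e @@ ?i = tid (\<^bold>1 \<^bold>\<star> ((\<^bold>1 \<^bold>\<star> a) \<^bold>\<star> b))" .
  then show "?one ** (tlunit (a \<^bold>\<star> b) @@ tassoc \<^bold>1 a b) = ?one ** (tlunit a ** tid b)"
    by (intro tcancel_right[OF _ _ _ _ _ _ _ _ _ eq, where i = ?i]) simp_all
qed simp_all

text \<open>Naturality of the left unitor at itself identifies its tensor with the unit with the
  unitor of the doubled unit; then \<open>tlunit_tens\<close> and the triangle compute the same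
  arrow.\<close>

lemma tlunit_unit: "tlunit \<^bold>1 = trunit \<^bold>1"
proof (rule tens_unit_right_inject)
  have "tlunit \<^bold>1 @@ (tid \<^bold>1 ** tlunit \<^bold>1) = tlunit \<^bold>1 @@ tlunit (\<^bold>1 \<^bold>\<star> \<^bold>1)"
    by (rule tlunit_natural) simp_all
  then have "tid \<^bold>1 ** tlunit \<^bold>1 = tlunit (\<^bold>1 \<^bold>\<star> \<^bold>1)"
    by (rule tcancel_left[where i = "tlunit' \<^bold>1", rotated -1]) (simp_all add: tinverse)
  then show "tlunit \<^bold>1 ** tid \<^bold>1 = trunit \<^bold>1 ** tid \<^bold>1"
    using tlunit_tens[of "\<^bold>1" "\<^bold>1"] ttriangle[of "\<^bold>1" "\<^bold>1"] by simp
qed simp_all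

end

section \<open>Tensor powers of an object\<close>

locale tensor_powers = monoidal_linear_category R C
  for R :: "('r, 'q) ring_scheme" and C :: "('r, 'o, 'm) ribbon_structure" (structure) +
  fixes X :: 'o
  assumes X_obj [simp]: "X \<in> objs C"
begin

abbreviation F :: "nat \<Rightarrow> 'o" where "F \<equiv> tens_power X"

lemma F_obj [simp]: "F n \<in> objs C"
proof (induction n)
  case (Suc n)
  then show ?case by (cases n) simp_all
qed simp

text \<open>Since \<open>F 1\<close> is \<open>X\<close> and not \<open>1 X\<close>, adding a strand to zero strands is a left unitor.\<close>

definition step :: "nat \<Rightarrow> ('o, 'm) arrow" where
  "step n = (case n of 0 \<Rightarrow> tlunit X | Suc k \<Rightarrow> tid (F (Suc k) \<^bold>\<star> X))"

definition step' :: "nat \<Rightarrow> ('o, 'm) arrow" where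
  "step' n = (case n of 0 \<Rightarrow> tlunit' X | Suc k \<Rightarrow> tid (F (Suc k) \<^bold>\<star> X))"

lemma step_type [simp]:
  "src (step n) = F n \<^bold>\<star> X" "tgt (step n) = F (Suc n)" "tarr (step n)"
  "src (step' n) = F (Suc n)" "tgt (step' n) = F n \<^bold>\<star> X" "tarr (step' n)"
  by (simp_all add: step_def step'_def split: nat.splits)

lemma step_inverse: "step n @@ step' n = tid (F (Suc n))" "step' n @@ step n = tid (F n \<^bold>\<star> X)"
  by (simp_all add: step_def step'_def tinverse tid_comp split: nat.splits)

text \<open>The coherence isomorphism that concatenates two tensor powers, built by moving the last
  strand of the second factor out, joining the rest, and adding the strand again.\<close>

primrec J :: "nat \<Rightarrow> nat \<Rightarrow> ('o, 'm) arrow" where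
  "J m 0 = trunit (F m)"
| "J m (Suc n) = step (m + n) @@ (J m n ** tid X) @@ tassoc' (F m) (F n) X @@ (tid (F m) ** step' n)"

primrec J' :: "nat \<Rightarrow> nat \<Rightarrow> ('o, 'm) arrow" where
  "J' m 0 = trunit' (F m)"
| "J' m (Suc n) = (tid (F m) ** step n) @@ tassoc (F m) (F n) X @@ (J' m n ** tid X) @@ step' (m + n)"

lemma J_type [simp]: "src (J m n) = F m \<^bold>\<star> F n" "tgt (J m n) = F (m + n)" "tarr (J m n)"
proof -
  have "src (J m n) = F m \<^bold>\<star> F n \<and> tgt (J m n) = F (m + n) \<and> tarr (J m n)"
    by (induction n) simp_all
  then show "src (J m n) = F m \<^bold>\<star> F n" "tgt (J m n) = F (m + n)" "tarr (J m n)" by blast+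
qed

lemma J'_type [simp]: "src (J' m n) = F (m + n)" "tgt (J' m n) = F m \<^bold>\<star> F n" "tarr (J' m n)"
proof -
  have "src (J' m n) = F (m + n) \<and> tgt (J' m n) = F m \<^bold>\<star> F n \<and> tarr (J' m n)"
    by (induction n) simp_all
  then show "src (J' m n) = F (m + n)" "tgt (J' m n) = F m \<^bold>\<star> F n" "tarr (J' m n)" by blast+
qed

lemma tcomp_rewrite:
  "\<lbrakk>f @@ g = h; tarr f; tarr g; tarr r; src f = tgt g; src g = tgt r\<rbrakk> \<Longrightarrow> f @@ g @@ r = h @@ r"
  using tcomp_assoc by metis

lemma J_inverse: "J m n @@ J' m n = tid (F (m + n))" "J' m n @@ J m n = tid (F m \<^bold>\<star> F n)"
proof (induction n)
  case (Suc n)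
  note cancel = tcomp_rewrite[OF tinverse(1)] tcomp_rewrite[OF tinverse(2)]
    tcomp_rewrite[OF step_inverse(1)] tcomp_rewrite[OF step_inverse(2)]
  have s1: "(tid (F m) ** step' n) @@ (tid (F m) ** step n) = tid (F m \<^bold>\<star> (F n \<^bold>\<star> X))"
    and s2: "(tid (F m) ** step n) @@ (tid (F m) ** step' n) = tid (F m \<^bold>\<star> F (Suc n))"
    by (simp_all add: tinterchange step_inverse tid_comp ttens_id)
  have j1: "(J m n ** tid X) @@ (J' m n ** tid X) = tid (F (m + n) \<^bold>\<star> X)"
    and j2: "(J' m n ** tid X) @@ (J m n ** tid X) = tid ((F m \<^bold>\<star> F n) \<^bold>\<star> X)"
    by (simp_all add: tinterchange Suc tid_comp ttens_id)
  {
    case 1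
    show ?case
      by (simp add: tcomp_assoc tcomp_rewrite[OF s1] tid_comp cancel tcomp_rewrite[OF j1] step_inverse)
  next
    case 2
    show ?case
      by (simp add: tcomp_assoc tcomp_rewrite[OF j2] tid_comp cancel s2)
  }
qed (simp_all add: tinverse)

lemma tassoc'_natural:
  assumes [simp]: "tarr f" "tarr g" "tarr h"
    and [simp]: "src f = a" "src g = b" "src h = c" "tgt f = a'" "tgt g = b'" "tgt h = c'"
  shows "((f ** g) ** h) @@ tassoc' a b c = tassoc' a' b' c' @@ (f ** g ** h)"
proof -
  have [simp]: "a \<in> objs C" "b \<in> objs C" "c \<in> objs C" "a' \<in> objs C" "b' \<in> objs C" "c' \<in> objs C"
    using assms tarr_objs by metis+
  have "((f ** g) ** h) @@ tassoc' a b c =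
      (tassoc' a' b' c' @@ tassoc a' b' c') @@ ((f ** g) ** h) @@ tassoc' a b c"
    by (simp add: tinverse tid_comp)
  also have "\<dots> = tassoc' a' b' c' @@ (tassoc a' b' c' @@ ((f ** g) ** h)) @@ tassoc' a b c"
    by (simp add: tcomp_assoc)
  also have "tassoc a' b' c' @@ ((f ** g) ** h) = (f ** g ** h) @@ tassoc a b c"
    by (rule tassoc_natural) simp_all
  also have "tassoc' a' b' c' @@ ((f ** g ** h) @@ tassoc a b c) @@ tassoc' a b c =
      tassoc' a' b' c' @@ (f ** g ** h)"
    by (simp add: tcomp_assoc tinverse tcomp_id)
  finally show ?thesis .
qed

lemma tpentagon':
  assumes [simp]: "a \<in> objs C" "b \<in> objs C" "c \<in> objs C" "d \<in> objs C"
  shows "tassoc' a (b \<^bold>\<star> c) d @@ (tid a ** tassoc' b c d) @@ tassoc a b (c \<^bold>\<star> d) =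
    (tassoc a b c ** tid d) @@ tassoc' (a \<^bold>\<star> b) c d"
proof -
  have 1: "(tid a ** tassoc' b c d) @@ (tid a ** tassoc b c d) = tid (a \<^bold>\<star> ((b \<^bold>\<star> c) \<^bold>\<star> d))"
    by (simp add: tinterchange tinverse tid_comp ttens_id)
  have "tassoc a b (c \<^bold>\<star> d) = (tassoc a b (c \<^bold>\<star> d) @@ tassoc (a \<^bold>\<star> b) c d) @@ tassoc' (a \<^bold>\<star> b) c d"
    by (simp add: tcomp_assoc tinverse tcomp_id)
  also have "\<dots> = (tid a ** tassoc b c d) @@ tassoc a (b \<^bold>\<star> c) d @@ (tassoc a b c ** tid d) @@ tassoc' (a \<^bold>\<star> b) c d"
    by (simp add: tpentagon[symmetric] tcomp_assoc)
  finally have 2: "tassoc a b (c \<^bold>\<star> d) = (tid a ** tassoc b c d) @@ tassoc a (b \<^bold>\<star> c) d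
      @@ (tassoc a b c ** tid d) @@ tassoc' (a \<^bold>\<star> b) c d" .
  show ?thesis
    unfolding 2
    by (simp add: tcomp_rewrite[OF 1] tid_comp tcomp_rewrite[OF tinverse(2)])
qed

text \<open>Induction on the last factor; the pentagon carries the associators past the added
  strand. This identity makes the tensor product transported along \<open>J\<close> strictly
  associative.\<close>

lemma J_assoc:
  "J (a + b) c @@ (J a b ** tid (F c)) = J a (b + c) @@ (tid (F a) ** J b c) @@ tassoc (F a) (F b) (F c)"
proof (induction c)
  case 0
  have "trunit (F (a + b)) @@ (J a b ** tid \<^bold>1) = J a b @@ trunit (F a \<^bold>\<star> F b)"
    by (rule trunit_natural) simp_all
  then show ?case by (simp add: trunit_tens)
next
  case (Suc c)
  let ?X = "tid X" and ?a = "tid (F a)" and ?b = "tid (F b)"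
  have s1: "(tid (F (a + b)) ** step' c) @@ (J a b ** tid (F (Suc c))) =
      (J a b ** tid (F c) ** ?X) @@ (tid (F a \<^bold>\<star> F b) ** step' c)"
    and s2: "?a ** (step (b + c) @@ (J b c ** ?X) @@ tassoc' (F b) (F c) X @@ (?b ** step' c)) =
      (?a ** step (b + c)) @@ (?a ** J b c ** ?X) @@ (?a ** tassoc' (F b) (F c) X) @@ (?a ** ?b ** step' c)"
    and s3: "(?a ** step' (b + c)) @@ (?a ** step (b + c)) = tid (F a \<^bold>\<star> (F (b + c) \<^bold>\<star> X))"
    by (simp_all add: tinterchange tid_comp tcomp_id ttens_id step_inverse)
  have n1: "tassoc' (F (a + b)) (F c) X @@ (J a b ** tid (F c) ** ?X) =
      ((J a b ** tid (F c)) ** ?X) @@ tassoc' (F a \<^bold>\<star> F b) (F c) X"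
    and n2: "tassoc' (F a) (F (b + c)) X @@ (?a ** J b c ** ?X) =
      ((?a ** J b c) ** ?X) @@ tassoc' (F a) (F b \<^bold>\<star> F c) X"
    by (rule tassoc'_natural[symmetric]; simp)+
  have n3: "(?a ** ?b ** step' c) @@ tassoc (F a) (F b) (F (Suc c)) =
      tassoc (F a) (F b) (F c \<^bold>\<star> X) @@ ((?a ** ?b) ** step' c)"
    by (rule tassoc_natural[symmetric]) simp_all
  have p: "tassoc' (F a) (F b \<^bold>\<star> F c) X @@ (?a ** tassoc' (F b) (F c) X) @@
      tassoc (F a) (F b) (F c \<^bold>\<star> X) @@ r =
      (tassoc (F a) (F b) (F c) ** ?X) @@ tassoc' (F a \<^bold>\<star> F b) (F c) X @@ r"
    if "tarr r" "tgt r = (F a \<^bold>\<star> F b) \<^bold>\<star> (F c \<^bold>\<star> X)" for r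
    using arg_cong[OF tpentagon'[of "F a" "F b" "F c" X], of "\<lambda>f. f @@ r"] that by (simp add: tcomp_assoc)
  have ih: "(J (a + b) c ** ?X) @@ ((J a b ** tid (F c)) ** ?X) =
      (J a (b + c) ** ?X) @@ ((?a ** J b c) ** ?X) @@ (tassoc (F a) (F b) (F c) ** ?X)"
    by (simp add: tinterchange Suc tid_comp)
  show ?case
    by (simp add: tcomp_assoc add.assoc s1 s2 n3 p tcomp_rewrite[OF s3] tid_comp tcomp_rewrite[OF n1]
        tcomp_rewrite[OF n2] tcomp_rewrite[OF ih] ttens_id[of "F a" "F b"])
qed

text \<open>The recursion runs over the right factor, so the right unit law is built in, whereas the
  left one needs induction and \<open>tlunit_tens\<close>.\<close>

lemma J_0_left: "J 0 n = tlunit (F n)"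
proof (induction n)
  case (Suc n)
  have "J 0 (Suc n) = step n @@ (tlunit (F n) ** tid X) @@ tassoc' \<^bold>1 (F n) X @@ (tid \<^bold>1 ** step' n)"
    by (simp add: Suc)
  also have "tlunit (F n) ** tid X = tlunit (F n \<^bold>\<star> X) @@ tassoc \<^bold>1 (F n) X"
    by (simp add: tlunit_tens)
  also have "step n @@ (tlunit (F n \<^bold>\<star> X) @@ tassoc \<^bold>1 (F n) X) @@ tassoc' \<^bold>1 (F n) X @@ (tid \<^bold>1 ** step' n) =
      step n @@ tlunit (F n \<^bold>\<star> X) @@ (tid \<^bold>1 ** step' n)"
    by (simp add: tcomp_assoc tcomp_rewrite[OF tinverse(1)] tid_comp)
  also have "tlunit (F n \<^bold>\<star> X) @@ (tid \<^bold>1 ** step' n) = step' n @@ tlunit (F (Suc n))"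
    by (rule tlunit_natural) simp_all
  also have "step n @@ step' n @@ tlunit (F (Suc n)) = tlunit (F (Suc n))"
    by (simp add: tcomp_rewrite[OF step_inverse(1)] tid_comp)
  finally show ?case .
qed (simp add: tlunit_unit)

lemma J_1_right: "J n 1 = step n"
proof -
  have "J n 1 = step n @@ (trunit (F n) ** tid X) @@ tassoc' (F n) \<^bold>1 X @@ (tid (F n) ** tlunit' X)"
    by (simp add: One_nat_def step'_def)
  also have "trunit (F n) ** tid X = (tid (F n) ** tlunit X) @@ tassoc (F n) \<^bold>1 X"
    by (simp add: ttriangle)
  also have "step n @@ ((tid (F n) ** tlunit X) @@ tassoc (F n) \<^bold>1 X) @@ tassoc' (F n) \<^bold>1 X @@ (tid (F n) ** tlunit' X)
      = step n @@ (tid (F n) ** tlunit X) @@ (tid (F n) ** tlunit' X)"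
    by (simp add: tcomp_assoc tcomp_rewrite[OF tinverse(1)] tid_comp)
  finally show ?thesis by (simp add: tinterchange tinverse tid_comp ttens_id tcomp_id)
qed

end

section \<open>Strict braided categories\<close>

locale strict_braided = strict_linear_monoidal where arr = arr
  for arr :: "(nat, 'm) arrow \<Rightarrow> bool" +
  fixes B B' :: "nat \<Rightarrow> nat \<Rightarrow> (nat, 'm) arrow"
  assumes B_type [simp]: "src (B m n) = m + n" "tgt (B m n) = n + m" "arr (B m n)"
    and B'_type [simp]: "src (B' m n) = n + m" "tgt (B' m n) = m + n" "arr (B' m n)"
    and B_B': "B m n @@ B' m n = idn (n + m)" and B'_B: "B' m n @@ B m n = idn (m + n)"
    and B_natural: "\<lbrakk>arr f; arr g; src f = m; src g = n; tgt f = m'; tgt g = n'\<rbrakk>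
      \<Longrightarrow> B m' n' @@ (f ** g) = (g ** f) @@ B m n"
    and B_hexagon_left: "B a (b + c) = (idn b ** B a c) @@ (B a b ** idn c)"
    and B_hexagon_right: "B (a + b) c = (B a c ** idn b) @@ (idn a ** B b c)"
begin

text \<open>Applied to the braiding with the unit and to the twist of the unit: the hexagons and the
  balancing identity make these idempotent.\<close>

lemma idempotent_iso:
  assumes "e @@ e = e" "e @@ i = idn n" "arr e" "arr i" "src e = n" "tgt e = n" "src i = n" "tgt i = n"
  shows "e = idn n"
proof -
  have "e = e @@ (e @@ i)" using assms(2-8) by (simp add: comp_idn)
  also have "\<dots> = (e @@ e) @@ i" using assms(3-8) by (simp add: comp_assoc)
  also have "\<dots> = idn n" by (simp only: assms)
  finally show ?thesis .
qed

lemma B_0_left: "B 0 n = idn n"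
proof (rule idempotent_iso[where i = "B' 0 n"])
  have "B (0 + 0) n = B 0 n @@ B 0 n"
    unfolding B_hexagon_right[of 0 0 n] by (simp add: idn0_tens tens_idn0)
  then show "B 0 n @@ B 0 n = B 0 n" by simp
qed (simp_all add: B_B')

lemma B_0_right: "B n 0 = idn n"
proof (rule idempotent_iso[where i = "B' n 0"])
  have "B n (0 + 0) = B n 0 @@ B n 0"
    unfolding B_hexagon_left[of n 0 0] by (simp add: idn0_tens tens_idn0)
  then show "B n 0 @@ B n 0 = B n 0" by simp
qed (simp_all add: B_B')

abbreviation P where "P \<equiv> B 1 1"
abbreviation N where "N \<equiv> B' 1 1"

lemma P_type [simp]: "src P = 2" "tgt P = 2" "arr P" and N_type [simp]: "src N = 2" "tgt N = 2" "arr N"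
  by simp_all

lemma PN: "P @@ N = idn 2" and NP: "N @@ P = idn 2"
  using B_B'[of 1 1] B'_B[of 1 1] by simp_all

lemma B_1_Suc: "B 1 (Suc n) = (idn n ** P) @@ (B 1 n ** idn 1)"
  using B_hexagon_left[of 1 n 1] by (simp add: One_nat_def)

lemma B_Suc: "B (Suc m) n = (B m n ** idn 1) @@ (idn m ** B 1 n)"
  using B_hexagon_right[of m 1 n] by (simp add: One_nat_def)

lemma B_1_2: "B 1 2 = (idn 1 ** P) @@ (P ** idn 1)"
  using B_1_Suc[of 1] by (simp add: numeral_2_eq_2 One_nat_def)

lemma B_2_1: "B 2 1 = (P ** idn 1) @@ (idn 1 ** P)"
  using B_Suc[of 1 1] by (simp add: numeral_2_eq_2 One_nat_def)

lemma B_1_3: "B 1 3 = (idn 2 ** P) @@ (idn 1 ** P ** idn 1) @@ (P ** idn 2)"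
proof -
  have "B 1 3 = (idn 2 ** P) @@ (B 1 2 ** idn 1)"
    using B_hexagon_left[of 1 2 1] by simp
  then show ?thesis
    unfolding B_1_2 by (simp add: tens_idn_comp tens_assoc idn_tens_idn)
qed

lemma B_3_1: "B 3 1 = (P ** idn 2) @@ (idn 1 ** P ** idn 1) @@ (idn 2 ** P)"
proof -
  have "B 3 1 = (B 2 1 ** idn 1) @@ (idn 2 ** P)"
    using B_hexagon_right[of 2 1 1] by simp
  then show ?thesis
    unfolding B_2_1 by (simp add: tens_idn_comp tens_assoc idn_tens_idn comp_assoc)
qed

lemma yang_baxter_P:
  "(P ** idn 1) @@ (idn 1 ** P) @@ (P ** idn 1) = (idn 1 ** P) @@ (P ** idn 1) @@ (idn 1 ** P)"
  using B_natural[of "idn 1" P 1 2 1 2] by (simp add: B_1_2 comp_assoc)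

lemma comp_cancel:
  "\<lbrakk>f @@ g = idn n; arr f; arr g; arr r; src f = tgt g; src g = tgt r; tgt r = n\<rbrakk> \<Longrightarrow> f @@ g @@ r = r"
  using comp_assoc[of f g r] idn_comp[of r n] by simp

lemma crossing_cancel:
  "(idn a ** N ** idn c) @@ (idn a ** P ** idn c) = idn (a + (2 + c))"
  "(idn a ** P ** idn c) @@ (idn a ** N ** idn c) = idn (a + (2 + c))"
  "(N ** idn c) @@ (P ** idn c) = idn (2 + c)" "(P ** idn c) @@ (N ** idn c) = idn (2 + c)"
  "(idn a ** N) @@ (idn a ** P) = idn (a + 2)" "(idn a ** P) @@ (idn a ** N) = idn (a + 2)"
  by (simp_all add: interchange[symmetric] PN NP idn_comp idn_tens_idn)

lemma inverse_unique:
  assumes "f @@ g = idn n" "h @@ f = idn n" "arr f" "arr g" "arr h" "src f = n" "tgt f = n"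
    "src g = n" "tgt g = n" "src h = n" "tgt h = n"
  shows "g = h"
proof -
  have "g = (h @@ f) @@ g" unfolding assms(2) using assms(4-) by (simp add: idn_comp)
  also have "\<dots> = h @@ (f @@ g)" using assms(3-) by (simp add: comp_assoc)
  also have "\<dots> = h" unfolding assms(1) using assms(3-) by (simp add: comp_idn)
  finally show ?thesis .
qed

text \<open>Both sides are inverse to the triple product of \<open>P\<close>, which has two forms by
  \<open>yang_baxter_P\<close>.\<close>

lemma yang_baxter_N:
  "(N ** idn 1) @@ (idn 1 ** N) @@ (N ** idn 1) = (idn 1 ** N) @@ (N ** idn 1) @@ (idn 1 ** N)"
proof (rule inverse_unique)
  let ?f = "(P ** idn 1) @@ (idn 1 ** P) @@ (P ** idn 1)"
  show "?f @@ ((N ** idn 1) @@ (idn 1 ** N) @@ (N ** idn 1)) = idn 3"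
    by (simp add: comp_assoc comp_cancel[OF crossing_cancel(4)] comp_cancel[OF crossing_cancel(6)]
        crossing_cancel)
  show "((idn 1 ** N) @@ (N ** idn 1) @@ (idn 1 ** N)) @@ ?f = idn 3"
    unfolding yang_baxter_P
    by (simp add: comp_assoc comp_cancel[OF crossing_cancel(3)] comp_cancel[OF crossing_cancel(5)]
        crossing_cancel)
qed simp_all

lemma slide_over:
  assumes "arr f" "src f = n" "tgt f = 0"
  shows "(f ** idn 1) @@ B 1 n = idn 1 ** f"
  using B_natural[of "idn 1" f 1 n 1 0] assms by (simp add: B_0_right idn_comp)

text \<open>Naturality in the first argument of the braiding moves the strand past \<open>f\<close>
  at the price of \<open>B n 1\<close>, which \<open>i\<close> cancels; in the applications
  \<open>i\<close> is a stack of inverse crossings.\<close>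

lemma slide_under:
  assumes "arr f" "src f = n" "tgt f = 0" "B n 1 @@ i = idn (n + 1)" "arr i" "src i = n + 1" "tgt i = n + 1"
  shows "(f ** idn 1) @@ i = idn 1 ** f"
proof -
  have "f ** idn 1 = (idn 1 ** f) @@ B n 1"
    using B_natural[of f "idn 1" n 1 0 1] assms by (simp add: B_0_left idn_comp)
  then show ?thesis using assms by (simp add: comp_assoc comp_idn add.commute)
qed

lemma slide_2:
  assumes "arr f" "src f = 2" "tgt f = 0" "x \<in> {N, P}"
  shows "(f ** idn 1) @@ (idn 1 ** x) @@ (x ** idn 1) = idn 1 ** f"
proof (cases "x = P")
  case True
  then show ?thesis using slide_over[OF assms(1-3)] by (simp add: B_1_2)
next
  case False
  then have x: "x = N" using assms by simp
  show ?thesis unfolding x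
    by (rule slide_under[OF assms(1-3)])
      (simp_all add: B_2_1 comp_assoc comp_cancel[OF crossing_cancel(6)] crossing_cancel)
qed

lemma slide_3:
  assumes "arr f" "src f = 3" "tgt f = 0" "x \<in> {N, P}"
  shows "(f ** idn 1) @@ (idn 2 ** x) @@ (idn 1 ** x ** idn 1) @@ (x ** idn 2) = idn 1 ** f"
proof (cases "x = P")
  case True
  then show ?thesis using slide_over[OF assms(1-3)] by (simp add: B_1_3)
next
  case False
  then have x: "x = N" using assms by simp
  show ?thesis unfolding x
    by (rule slide_under[OF assms(1-3)])
      (simp_all add: B_3_1 comp_assoc comp_cancel[OF crossing_cancel(6)] comp_cancel[OF crossing_cancel(2)]
        crossing_cancel)
qed

end

section \<open>The strict category of tensor powers\<close>

lemma ring_of_complex [simp]: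
  "carrier (ring_of_type_algebra :: complex ring) = UNIV"
  "\<zero>\<^bsub>(ring_of_type_algebra :: complex ring)\<^esub> = 0" "\<one>\<^bsub>(ring_of_type_algebra :: complex ring)\<^esub> = 1"
  "x \<oplus>\<^bsub>(ring_of_type_algebra :: complex ring)\<^esub> y = x + y"
  "x \<otimes>\<^bsub>(ring_of_type_algebra :: complex ring)\<^esub> y = x * y"
  by (simp_all add: ring_of_type_algebra_def)

locale complex_tensor_powers = tensor_powers "ring_of_type_algebra :: complex ring" C X
  for C :: "(complex, 'o, 'm) ribbon_structure" (structure) and X :: 'o
begin

definition tplus where
  "tplus f g = Arrow (src f) (tgt f) (mor f \<oplus>\<^bsub>hom_mod C (src f) (tgt f)\<^esub> mor g)"

definition tscale where
  "tscale c f = Arrow (src f) (tgt f) (c \<odot>\<^bsub>hom_mod C (src f) (tgt f)\<^esub> mor f)"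

definition tzero where "tzero a b = Arrow a b \<zero>\<^bsub>hom_mod C a b\<^esub>"

lemma tlinear_src [simp]:
  "src (tplus f g) = src f" "tgt (tplus f g) = tgt f" "src (tscale c f) = src f" "tgt (tscale c f) = tgt f"
  "src (tzero a b) = a" "tgt (tzero a b) = b"
  by (simp_all add: tplus_def tscale_def tzero_def)

lemma hom_abelian: "\<lbrakk>a \<in> objs C; b \<in> objs C\<rbrakk> \<Longrightarrow> abelian_group (hom_mod C a b)"
  using hom_module module.axioms(2) by blast

lemma hom_abelian_monoid: "\<lbrakk>a \<in> objs C; b \<in> objs C\<rbrakk> \<Longrightarrow> abelian_monoid (hom_mod C a b)"
  using hom_abelian abelian_group.axioms(1) by blast

lemma tarr_linear [simp]:
  "\<lbrakk>tarr f; tarr g; src f = src g; tgt f = tgt g\<rbrakk> \<Longrightarrow> tarr (tplus f g)"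
  "tarr f \<Longrightarrow> tarr (tscale c f)"
  "\<lbrakk>a \<in> objs C; b \<in> objs C\<rbrakk> \<Longrightarrow> tarr (tzero a b)"
  by (simp_all del: tarr_objs add: tarr_def tplus_def tscale_def tzero_def
      abelian_monoid.a_closed[OF hom_abelian_monoid] abelian_monoid.zero_closed[OF hom_abelian_monoid]
      module.smult_closed[OF hom_module])

lemma tplus_assoc:
  "\<lbrakk>tarr f; tarr g; tarr h; src f = src g; tgt f = tgt g; src f = src h; tgt f = tgt h\<rbrakk>
    \<Longrightarrow> tplus (tplus f g) h = tplus f (tplus g h)"
  by (simp del: tarr_objs add: tarr_def tplus_def abelian_monoid.a_assoc[OF hom_abelian_monoid])

lemma tplus_comm:
  "\<lbrakk>tarr f; tarr g; src f = src g; tgt f = tgt g\<rbrakk> \<Longrightarrow> tplus f g = tplus g f"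
  by (simp del: tarr_objs add: tarr_def tplus_def abelian_monoid.a_comm[OF hom_abelian_monoid])

lemma tzero_plus: "\<lbrakk>tarr f; src f = a; tgt f = b\<rbrakk> \<Longrightarrow> tplus (tzero a b) f = f"
  by (cases f) (simp del: tarr_objs add: tarr_def tplus_def tzero_def
      abelian_monoid.l_zero[OF hom_abelian_monoid])

lemma tscale_0: "\<lbrakk>tarr f; src f = a; tgt f = b\<rbrakk> \<Longrightarrow> tscale 0 f = tzero a b"
  using module.smult_l_null[OF hom_module, of "src f" "tgt f" "mor f"]
  by (auto simp del: tarr_objs simp: tarr_def tscale_def tzero_def)

lemma tscale_1: "tarr f \<Longrightarrow> tscale 1 f = f"
  using module.smult_one[OF hom_module, of "src f" "tgt f" "mor f"]
  by (cases f) (auto simp del: tarr_objs simp: tarr_def tscale_def)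

lemma tscale_mult: "tarr f \<Longrightarrow> tscale (c * d) f = tscale c (tscale d f)"
  using module.smult_assoc1[OF hom_module, of "src f" "tgt f" c d "mor f"]
  by (auto simp del: tarr_objs simp: tarr_def tscale_def)

lemma tscale_add: "tarr f \<Longrightarrow> tscale (c + d) f = tplus (tscale c f) (tscale d f)"
  using module.smult_l_distr[OF hom_module, of "src f" "tgt f" c d "mor f"]
  by (auto simp del: tarr_objs simp: tarr_def tscale_def tplus_def)

lemma tscale_plus: "\<lbrakk>tarr f; tarr g; src f = src g; tgt f = tgt g\<rbrakk>
    \<Longrightarrow> tscale c (tplus f g) = tplus (tscale c f) (tscale c g)"
  using module.smult_r_distr[OF hom_module, of "src f" "tgt f" c "mor f" "mor g"]
  by (auto simp del: tarr_objs simp: tarr_def tscale_def tplus_def)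

lemma tplus_comp: "\<lbrakk>tarr f; tarr g; tarr h; src f = src g; tgt f = tgt g; src f = tgt h\<rbrakk>
    \<Longrightarrow> tplus f g @@ h = tplus (f @@ h) (g @@ h)"
  using comp_add_left[of "src h" "src f" "tgt f" "mor f" "mor g" "mor h"]
  by (auto simp del: tarr_objs simp: tarr_def tplus_def tcomp_def)

lemma tcomp_plus: "\<lbrakk>tarr f; tarr g; tarr h; src f = src g; tgt f = tgt g; src h = tgt f\<rbrakk>
    \<Longrightarrow> h @@ tplus f g = tplus (h @@ f) (h @@ g)"
  using comp_add_right[of "src f" "tgt f" "tgt h" "mor h" "mor f" "mor g"]
  by (auto simp del: tarr_objs simp: tarr_def tplus_def tcomp_def)

lemma tscale_comp: "\<lbrakk>tarr f; tarr g; src f = tgt g\<rbrakk> \<Longrightarrow> tscale c f @@ g = tscale c (f @@ g)"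
  using comp_smult_left[of "src g" "src f" "tgt f" c "mor f" "mor g"]
  by (auto simp del: tarr_objs simp: tarr_def tscale_def tcomp_def)

lemma tcomp_scale: "\<lbrakk>tarr f; tarr g; src f = tgt g\<rbrakk> \<Longrightarrow> f @@ tscale c g = tscale c (f @@ g)"
  using comp_smult_right[of "src g" "src f" "tgt f" c "mor f" "mor g"]
  by (auto simp del: tarr_objs simp: tarr_def tscale_def tcomp_def)

lemma tplus_tens: "\<lbrakk>tarr f; tarr g; tarr h; src f = src g; tgt f = tgt g\<rbrakk>
    \<Longrightarrow> tplus f g ** h = tplus (f ** h) (g ** h)"
  using tens_add_left[of "src f" "tgt f" "src h" "tgt h" "mor f" "mor g" "mor h"]
  by (auto simp del: tarr_objs simp: tarr_def tplus_def ttens_def)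

lemma ttens_plus: "\<lbrakk>tarr f; tarr g; tarr h; src f = src g; tgt f = tgt g\<rbrakk>
    \<Longrightarrow> h ** tplus f g = tplus (h ** f) (h ** g)"
  using tens_add_right[of "src h" "tgt h" "src f" "tgt f" "mor h" "mor f" "mor g"]
  by (auto simp del: tarr_objs simp: tarr_def tplus_def ttens_def)

lemma tscale_tens: "\<lbrakk>tarr f; tarr g\<rbrakk> \<Longrightarrow> tscale c f ** g = tscale c (f ** g)"
  using tens_smult_left[of "src f" "tgt f" "src g" "tgt g" c "mor f" "mor g"]
  by (auto simp del: tarr_objs simp: tarr_def tscale_def ttens_def)

lemma ttens_scale: "\<lbrakk>tarr f; tarr g\<rbrakk> \<Longrightarrow> f ** tscale c g = tscale c (f ** g)"
  using tens_smult_right[of "src f" "tgt f" "src g" "tgt g" c "mor f" "mor g"]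
  by (auto simp del: tarr_objs simp: tarr_def tscale_def ttens_def)

text \<open>Strictification: \<open>up\<close> places an arrow between numbers into the given
  category, where each strict operation becomes the given one, conjugated by \<open>J\<close> in the
  case of tensor products. Equations are checked after \<open>up\<close>, which is injective for
  fixed arities.\<close>

definition up :: "(nat, 'm) arrow \<Rightarrow> ('o, 'm) arrow" where
  "up f = Arrow (F (src f)) (F (tgt f)) (mor f)"

definition "down m n f = Arrow m n (mor f)"

definition "darr f \<longleftrightarrow> tarr (up f)"
definition "didn n = down n n (tid (F n))"
definition "dcomp f g = down (src g) (tgt f) (up f @@ up g)"
definition "dtens f g = down (src f + src g) (tgt f + tgt g)
  (J (tgt f) (tgt g) @@ (up f ** up g) @@ J' (src f) (src g))"
definition "dnul m n = down m n (tzero (F m) (F n))"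
definition "dplus f g = down (src f) (tgt f) (tplus (up f) (up g))"
definition "dscale c f = down (src f) (tgt f) (tscale c (up f))"

lemma down_type [simp]: "src (down m n f) = m" "tgt (down m n f) = n"
  by (simp_all add: down_def)

lemma up_type [simp]: "src (up f) = F (src f)" "tgt (up f) = F (tgt f)"
  by (simp_all add: up_def)

lemma up_down: "\<lbrakk>src f = F m; tgt f = F n\<rbrakk> \<Longrightarrow> up (down m n f) = f"
  by (cases f) (simp add: up_def down_def)

lemma dtype [simp]:
  "src (didn n) = n" "tgt (didn n) = n" "src (dcomp f g) = src g" "tgt (dcomp f g) = tgt f"
  "src (dtens f g) = src f + src g" "tgt (dtens f g) = tgt f + tgt g"
  "src (dnul m n) = m" "tgt (dnul m n) = n" "src (dplus f g) = src f" "tgt (dplus f g) = tgt f"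
  "src (dscale c f) = src f" "tgt (dscale c f) = tgt f"
  by (simp_all add: didn_def dcomp_def dtens_def dnul_def dplus_def dscale_def)

lemma up_simps:
  "up (didn n) = tid (F n)" "up (dcomp f g) = up f @@ up g"
  "up (dtens f g) = J (tgt f) (tgt g) @@ (up f ** up g) @@ J' (src f) (src g)"
  "up (dnul m n) = tzero (F m) (F n)" "up (dplus f g) = tplus (up f) (up g)"
  "up (dscale c f) = tscale c (up f)"
  by (simp_all add: didn_def dcomp_def dtens_def dnul_def dplus_def dscale_def up_down)

lemma up_inject: "\<lbrakk>up f = up g; src f = src g; tgt f = tgt g\<rbrakk> \<Longrightarrow> f = g"
  by (cases f; cases g) (simp add: up_def)

lemma J_cancel:
  "\<lbrakk>tarr r; tgt r = F (m + n)\<rbrakk> \<Longrightarrow> J m n @@ J' m n @@ r = r"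
  "\<lbrakk>tarr r; tgt r = F m \<^bold>\<star> F n\<rbrakk> \<Longrightarrow> J' m n @@ J m n @@ r = r"
  using tcomp_rewrite[OF J_inverse(1), where r = r] tcomp_rewrite[OF J_inverse(2), where r = r] by (simp_all add: tid_comp)

lemma J'_assoc:
  "tassoc (F a) (F b) (F c) @@ (J' a b ** tid (F c)) @@ J' (a + b) c = (tid (F a) ** J' b c) @@ J' a (b + c)"
proof -
  have 1: "(tid (F a) ** J' b c) @@ (tid (F a) ** J b c) = tid (F a \<^bold>\<star> (F b \<^bold>\<star> F c))"
    and 2: "(J a b ** tid (F c)) @@ (J' a b ** tid (F c)) = tid (F (a + b) \<^bold>\<star> F c)"
    by (simp_all add: tinterchange J_inverse tid_comp ttens_id)
  have "tassoc (F a) (F b) (F c) @@ (J' a b ** tid (F c)) @@ J' (a + b) c =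
      (tid (F a) ** J' b c) @@ J' a (b + c) @@
      (J a (b + c) @@ (tid (F a) ** J b c) @@ tassoc (F a) (F b) (F c)) @@ (J' a b ** tid (F c)) @@ J' (a + b) c"
    by (simp add: tcomp_assoc J_cancel tcomp_rewrite[OF 1] tid_comp)
  also have "\<dots> = (tid (F a) ** J' b c) @@ J' a (b + c)"
    unfolding J_assoc[symmetric]
    by (simp add: tcomp_assoc tcomp_rewrite[OF 2] tid_comp J_inverse add.assoc tcomp_id)
  finally show ?thesis .
qed

text \<open>Reassociating the outer coherence isomorphisms leaves one associator above and one
  below; naturality lets them cancel.\<close>

lemma dtens_assoc:
  assumes "darr f" "darr g" "darr h"
  shows "dtens (dtens f g) h = dtens f (dtens g h)"
proof (rule up_inject)
  have [simp]: "tarr (up f)" "tarr (up g)" "tarr (up h)" using assms by (simp_all add: darr_def)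
  define a b c d e k where defs: "a = src f" "b = tgt f" "c = src g" "d = tgt g" "e = src h" "k = tgt h"
  have t [simp]: "src f = a" "tgt f = b" "src g = c" "tgt g = d" "src h = e" "tgt h = k"
    by (simp_all add: defs)
  let ?f = "up f" and ?g = "up g" and ?h = "up h"
  have 1: "(J b d @@ (?f ** ?g) @@ J' a c) ** ?h =
      (J b d ** tid (F k)) @@ ((?f ** ?g) ** ?h) @@ (J' a c ** tid (F e))"
    by (simp add: tinterchange tid_comp tcomp_id)
  have 2: "?f ** (J d k @@ (?g ** ?h) @@ J' c e) =
      (tid (F b) ** J d k) @@ (?f ** ?g ** ?h) @@ (tid (F a) ** J' c e)"
    by (simp add: tinterchange tid_comp tcomp_id)
  have "up (dtens (dtens f g) h) = (J (b + d) k @@ (J b d ** tid (F k))) @@ ((?f ** ?g) ** ?h) @@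
      (J' a c ** tid (F e)) @@ J' (a + c) e"
    by (simp add: up_simps 1 tcomp_assoc)
  also have "\<dots> = J b (d + k) @@ (tid (F b) ** J d k) @@ (tassoc (F b) (F d) (F k) @@ ((?f ** ?g) ** ?h)) @@
      (J' a c ** tid (F e)) @@ J' (a + c) e"
    unfolding J_assoc by (simp add: tcomp_assoc)
  also have "tassoc (F b) (F d) (F k) @@ ((?f ** ?g) ** ?h) = (?f ** ?g ** ?h) @@ tassoc (F a) (F c) (F e)"
    by (rule tassoc_natural) simp_all
  also have "J b (d + k) @@ (tid (F b) ** J d k) @@ ((?f ** ?g ** ?h) @@ tassoc (F a) (F c) (F e)) @@
      (J' a c ** tid (F e)) @@ J' (a + c) e =
      J b (d + k) @@ (tid (F b) ** J d k) @@ (?f ** ?g ** ?h) @@ (tid (F a) ** J' c e) @@ J' a (c + e)"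
    by (simp add: tcomp_assoc J'_assoc)
  also have "\<dots> = up (dtens f (dtens g h))"
    by (simp add: up_simps 2 tcomp_assoc)
  finally show "up (dtens (dtens f g) h) = up (dtens f (dtens g h))" .
qed simp_all

lemma J'_0_left: "J' 0 n = tlunit' (F n)"
proof (rule tcancel_left[where e = "J 0 n" and i = "J' 0 n"])
  show "J 0 n @@ J' 0 n = J 0 n @@ tlunit' (F n)"
    unfolding J_inverse by (simp add: J_0_left tinverse)
qed (simp_all add: J_inverse)

lemma strict_tensor_powers:
  "strict_linear_monoidal darr didn dcomp dtens dnul dplus dscale"
proof unfold_locales
  show "dtens (didn 0) f = f" if "darr f" for f
  proof (rule up_inject)
    have [simp]: "tarr (up f)" using that by (simp add: darr_def)
    have "up (dtens (didn 0) f) = (tlunit (F (tgt f)) @@ (tid \<^bold>1 ** up f)) @@ tlunit' (F (src f))"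
      by (simp add: up_simps J_0_left J'_0_left tcomp_assoc)
    also have "tlunit (F (tgt f)) @@ (tid \<^bold>1 ** up f) = up f @@ tlunit (F (src f))"
      by (rule tlunit_natural) simp_all
    finally show "up (dtens (didn 0) f) = up f" by (simp add: tcomp_assoc tinverse tcomp_id)
  qed simp_all
  show "dtens f (didn 0) = f" if "darr f" for f
  proof (rule up_inject)
    have [simp]: "tarr (up f)" using that by (simp add: darr_def)
    have "up (dtens f (didn 0)) = (trunit (F (tgt f)) @@ (up f ** tid \<^bold>1)) @@ trunit' (F (src f))"
      by (simp add: up_simps tcomp_assoc)
    also have "trunit (F (tgt f)) @@ (up f ** tid \<^bold>1) = up f @@ trunit (F (src f))"
      by (rule trunit_natural) simp_all
    finally show "up (dtens f (didn 0)) = up f" by (simp add: tcomp_assoc tinverse tcomp_id)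
  qed simp_all
  show "dtens (didn m) (didn n) = didn (m + n)" for m n
    by (rule up_inject) (simp_all add: up_simps ttens_id tid_comp J_inverse)
  show "dtens (dcomp f g) (dcomp f' g') = dcomp (dtens f f') (dtens g g')"
    if "darr f" "darr g" "darr f'" "darr g'" "src f = tgt g" "src f' = tgt g'" for f g f' g'
  proof (rule up_inject)
    have "tarr (up f)" "tarr (up g)" "tarr (up f')" "tarr (up g')" using that by (simp_all add: darr_def)
    then show "up (dtens (dcomp f g) (dcomp f' g')) = up (dcomp (dtens f f') (dtens g g'))"
      using that(5,6) by (simp add: up_simps tcomp_assoc J_cancel tinterchange[symmetric])
  qed simp_all
qed (auto intro!: up_inject dtens_assoc tplus_comm simp: darr_def up_simps tcomp_assoc tid_comp tcomp_id tplus_assoc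
    tzero_plus tscale_0 tscale_1 tscale_mult tscale_add tscale_plus tplus_comp tcomp_plus tscale_comp
    tcomp_scale tplus_tens ttens_plus tscale_tens ttens_scale)

end

locale complex_ribbon_powers = complex_tensor_powers C X + ribbon_category "ring_of_type_algebra :: complex ring" C
  for C :: "(complex, 'o, 'm) ribbon_structure" (structure) and X :: 'o
begin

section \<open>Braiding and twist of the tensor powers\<close>

definition "tbraid a b = Arrow (a \<^bold>\<star> b) (b \<^bold>\<star> a) (\<c> a b)"
definition "tbraid' a b = Arrow (b \<^bold>\<star> a) (a \<^bold>\<star> b) (braid_inv a b)"
definition "ttwist a = Arrow a a (\<theta> a)"
definition "ttwist' a = Arrow a a (twist_inv a)"

lemma tbraid_src [simp]:
  "src (tbraid a b) = a \<^bold>\<star> b" "tgt (tbraid a b) = b \<^bold>\<star> a" "src (tbraid' a b) = b \<^bold>\<star> a" "tgt (tbraid' a b) = a \<^bold>\<star> b"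
  "src (ttwist a) = a" "tgt (ttwist a) = a" "src (ttwist' a) = a" "tgt (ttwist' a) = a"
  by (simp_all add: tbraid_def tbraid'_def ttwist_def ttwist'_def)

lemma braid_inverse: "\<lbrakk>a \<in> objs C; b \<in> objs C\<rbrakk>
    \<Longrightarrow> inverse_mor (a \<^bold>\<star> b) (b \<^bold>\<star> a) (\<c> a b) (braid_inv a b)"
  unfolding braid_inv_def by (intro inv_mor braid_iso) simp_all

lemma twist_inverse: "a \<in> objs C \<Longrightarrow> inverse_mor a a (\<theta> a) (twist_inv a)"
  unfolding twist_inv_def by (intro inv_mor twist_iso) simp_all

lemma tarr_braid [simp]:
  "\<lbrakk>a \<in> objs C; b \<in> objs C\<rbrakk> \<Longrightarrow> tarr (tbraid a b)" "\<lbrakk>a \<in> objs C; b \<in> objs C\<rbrakk> \<Longrightarrow> tarr (tbraid' a b)"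
  "a \<in> objs C \<Longrightarrow> tarr (ttwist a)" "a \<in> objs C \<Longrightarrow> tarr (ttwist' a)"
  using braid_inverse[of a b] twist_inverse[of a]
  by (simp_all del: tarr_objs add: tarr_def tbraid_def tbraid'_def ttwist_def ttwist'_def inverse_mor_def)

lemma tbraid_inverse:
  "\<lbrakk>a \<in> objs C; b \<in> objs C\<rbrakk> \<Longrightarrow> tbraid a b @@ tbraid' a b = tid (b \<^bold>\<star> a)"
  "\<lbrakk>a \<in> objs C; b \<in> objs C\<rbrakk> \<Longrightarrow> tbraid' a b @@ tbraid a b = tid (a \<^bold>\<star> b)"
  "a \<in> objs C \<Longrightarrow> ttwist a @@ ttwist' a = tid a" "a \<in> objs C \<Longrightarrow> ttwist' a @@ ttwist a = tid a"
  using braid_inverse[of a b] twist_inverse[of a]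
  by (simp_all add: tcomp_def tid_def tbraid_def tbraid'_def ttwist_def ttwist'_def inverse_mor_def)

lemma tbraid_natural:
  "\<lbrakk>tarr f; tarr g; src f = a; src g = b; tgt f = a'; tgt g = b'\<rbrakk>
    \<Longrightarrow> tbraid a' b' @@ (f ** g) = (g ** f) @@ tbraid a b"
  using braid_natural[of "src f" "src g" "tgt f" "tgt g" "mor f" "mor g"]
  by (auto simp del: tarr_objs simp: tarr_def tcomp_def ttens_def tbraid_def)

lemma ttwist_natural:
  "\<lbrakk>tarr f; src f = a; tgt f = b\<rbrakk> \<Longrightarrow> ttwist b @@ f = f @@ ttwist a"
  using twist_natural[of "src f" "tgt f" "mor f"]
  by (auto simp del: tarr_objs simp: tarr_def tcomp_def ttwist_def)

lemma thexagon_left: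
  "\<lbrakk>a \<in> objs C; b \<in> objs C; c \<in> objs C\<rbrakk>
    \<Longrightarrow> tassoc b c a @@ tbraid a (b \<^bold>\<star> c) @@ tassoc a b c =
      (tid b ** tbraid a c) @@ tassoc b a c @@ (tbraid a b ** tid c)"
  by (simp add: tcomp_def ttens_def tid_def tassoc_def tbraid_def hexagon_left)

lemma thexagon_right:
  "\<lbrakk>a \<in> objs C; b \<in> objs C; c \<in> objs C\<rbrakk>
    \<Longrightarrow> tassoc' c a b @@ tbraid (a \<^bold>\<star> b) c @@ tassoc' a b c =
      (tbraid a c ** tid b) @@ tassoc' a c b @@ (tid a ** tbraid b c)"
  by (simp add: tcomp_def ttens_def tid_def tassoc'_def tbraid_def hexagon_right)

lemma ttwist_tens:
  "\<lbrakk>a \<in> objs C; b \<in> objs C\<rbrakk> \<Longrightarrow> ttwist (a \<^bold>\<star> b) = tbraid b a @@ tbraid a b @@ (ttwist a ** ttwist b)"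
  by (simp add: tcomp_def ttens_def ttwist_def tbraid_def twist_tens)

definition "dbraid m n = down (m + n) (n + m) (J n m @@ tbraid (F m) (F n) @@ J' m n)"
definition "dbraid' m n = down (n + m) (m + n) (J m n @@ tbraid' (F m) (F n) @@ J' n m)"
definition "dtwist n = down n n (ttwist (F n))"

lemma dbraid_type [simp]:
  "src (dbraid m n) = m + n" "tgt (dbraid m n) = n + m" "src (dbraid' m n) = n + m" "tgt (dbraid' m n) = m + n"
  "src (dtwist n) = n" "tgt (dtwist n) = n"
  by (simp_all add: dbraid_def dbraid'_def dtwist_def)

lemma up_braid:
  "up (dbraid m n) = J n m @@ tbraid (F m) (F n) @@ J' m n"
  "up (dbraid' m n) = J m n @@ tbraid' (F m) (F n) @@ J' n m" "up (dtwist n) = ttwist (F n)"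
  by (simp_all add: dbraid_def dbraid'_def dtwist_def up_down)

text \<open>The hexagon conjugated by \<open>J\<close>: its three associators are exactly those
  produced by reassociating the coherence isomorphisms.\<close>

lemma dbraid_hexagon_left:
  "dbraid a (b + c) = dcomp (dtens (didn b) (dbraid a c)) (dtens (dbraid a b) (didn c))"
proof (rule up_inject)
  let ?a = "F a" and ?b = "F b" and ?c = "F c"
  have 1: "tid ?b ** (J c a @@ tbraid ?a ?c @@ J' a c) =
      (tid ?b ** J c a) @@ (tid ?b ** tbraid ?a ?c) @@ (tid ?b ** J' a c)"
    and 2: "(J b a @@ tbraid ?a ?b @@ J' a b) ** tid ?c =
      (J b a ** tid ?c) @@ (tbraid ?a ?b ** tid ?c) @@ (J' a b ** tid ?c)"
    by (simp_all add: tinterchange tid_comp)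
  have 3: "(tid ?b ** J' a c) @@ (tid ?b ** J a c) = tid (?b \<^bold>\<star> (?a \<^bold>\<star> ?c))"
    and 4: "(tid ?a ** J b c) @@ (tid ?a ** J' b c) = tid (?a \<^bold>\<star> F (b + c))"
    by (simp_all add: tinterchange J_inverse tid_comp ttens_id)
  have hex: "(tid ?b ** tbraid ?a ?c) @@ tassoc ?b ?a ?c @@ (tbraid ?a ?b ** tid ?c) @@ r =
      tassoc ?b ?c ?a @@ tbraid ?a (?b \<^bold>\<star> ?c) @@ tassoc ?a ?b ?c @@ r"
    if "tarr r" "tgt r = (?a \<^bold>\<star> ?b) \<^bold>\<star> ?c" for r
    using arg_cong[OF thexagon_left[of ?a ?b ?c], of "\<lambda>f. f @@ r"] that by (simp add: tcomp_assoc)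
  have nat: "(J b c ** tid ?a) @@ tbraid ?a (?b \<^bold>\<star> ?c) = tbraid ?a (F (b + c)) @@ (tid ?a ** J b c)"
    by (rule tbraid_natural[symmetric]) simp_all
  have lhs: "up (dbraid a (b + c)) =
      (J (b + c) a @@ (J b c ** tid ?a)) @@ tbraid ?a (?b \<^bold>\<star> ?c) @@ (tid ?a ** J' b c) @@ J' a (b + c)"
    by (simp add: up_braid tcomp_assoc tcomp_rewrite[OF nat] tcomp_rewrite[OF 4] tid_comp)
  show "up (dbraid a (b + c)) = up (dcomp (dtens (didn b) (dbraid a c)) (dtens (dbraid a b) (didn c)))"
    unfolding lhs J_assoc
    by (simp add: up_simps up_braid 1 2 tcomp_assoc add.assoc tcomp_rewrite[OF J_assoc] J_cancel
        tcomp_rewrite[OF 3] tid_comp hex J'_assoc)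
qed simp_all

lemma J_assoc':
  "J a (b + c) @@ (tid (F a) ** J b c) = J (a + b) c @@ (J a b ** tid (F c)) @@ tassoc' (F a) (F b) (F c)"
proof -
  have "J (a + b) c @@ (J a b ** tid (F c)) @@ tassoc' (F a) (F b) (F c) =
      (J (a + b) c @@ (J a b ** tid (F c))) @@ tassoc' (F a) (F b) (F c)"
    by (simp add: tcomp_assoc)
  also have "\<dots> = J a (b + c) @@ (tid (F a) ** J b c)"
    unfolding J_assoc by (simp add: tcomp_assoc tinverse tcomp_id)
  finally show ?thesis ..
qed

lemma J'_assoc':
  "tassoc' (F a) (F b) (F c) @@ (tid (F a) ** J' b c) @@ J' a (b + c) = (J' a b ** tid (F c)) @@ J' (a + b) c"
  unfolding J'_assoc[symmetric] by (simp add: tcomp_rewrite[OF tinverse(2)] tid_comp)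

lemma dbraid_hexagon_right:
  "dbraid (a + b) c = dcomp (dtens (dbraid a c) (didn b)) (dtens (didn a) (dbraid b c))"
proof (rule up_inject)
  let ?a = "F a" and ?b = "F b" and ?c = "F c"
  have 1: "tid ?a ** (J c b @@ tbraid ?b ?c @@ J' b c) =
      (tid ?a ** J c b) @@ (tid ?a ** tbraid ?b ?c) @@ (tid ?a ** J' b c)"
    and 2: "(J c a @@ tbraid ?a ?c @@ J' a c) ** tid ?b =
      (J c a ** tid ?b) @@ (tbraid ?a ?c ** tid ?b) @@ (J' a c ** tid ?b)"
    by (simp_all add: tinterchange tid_comp)
  have 3: "(J' a c ** tid ?b) @@ (J a c ** tid ?b) = tid ((?a \<^bold>\<star> ?c) \<^bold>\<star> ?b)"
    and 4: "(J a b ** tid ?c) @@ (J' a b ** tid ?c) = tid (F (a + b) \<^bold>\<star> ?c)"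
    by (simp_all add: tinterchange J_inverse tid_comp ttens_id)
  have hex: "(tbraid ?a ?c ** tid ?b) @@ tassoc' ?a ?c ?b @@ (tid ?a ** tbraid ?b ?c) @@ r =
      tassoc' ?c ?a ?b @@ tbraid (?a \<^bold>\<star> ?b) ?c @@ tassoc' ?a ?b ?c @@ r"
    if "tarr r" "tgt r = ?a \<^bold>\<star> (?b \<^bold>\<star> ?c)" for r
    using arg_cong[OF thexagon_right[of ?a ?b ?c], of "\<lambda>f. f @@ r"] that by (simp add: tcomp_assoc)
  have nat: "(tid ?c ** J a b) @@ tbraid (?a \<^bold>\<star> ?b) ?c = tbraid (F (a + b)) ?c @@ (J a b ** tid ?c)"
    by (rule tbraid_natural[symmetric]) simp_all
  have lhs: "up (dbraid (a + b) c) =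
      (J c (a + b) @@ (tid ?c ** J a b)) @@ tbraid (?a \<^bold>\<star> ?b) ?c @@ (J' a b ** tid ?c) @@ J' (a + b) c"
    by (simp add: up_braid tcomp_assoc tcomp_rewrite[OF nat] tcomp_rewrite[OF 4] tid_comp)
  show "up (dbraid (a + b) c) = up (dcomp (dtens (dbraid a c) (didn b)) (dtens (didn a) (dbraid b c)))"
    unfolding lhs J_assoc'
    by (simp add: up_simps up_braid 1 2 tcomp_assoc add.assoc tcomp_rewrite[OF J_assoc'] J_cancel
        tcomp_rewrite[OF 3] tid_comp hex J'_assoc')
qed simp_all

lemma strict_braided_powers:
  "strict_braided didn dcomp dtens dnul dplus dscale darr dbraid dbraid'"
proof -
  interpret strict_linear_monoidal darr didn dcomp dtens dnul dplus dscale
    by (rule strict_tensor_powers)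
  show ?thesis
  proof unfold_locales
    show "dcomp (dbraid m n) (dbraid' m n) = didn (n + m)" for m n
      by (rule up_inject) (simp_all add: up_simps up_braid tcomp_assoc J_cancel
          tcomp_rewrite[OF tbraid_inverse(1)] tid_comp J_inverse)
    show "dcomp (dbraid' m n) (dbraid m n) = didn (m + n)" for m n
      by (rule up_inject) (simp_all add: up_simps up_braid tcomp_assoc J_cancel
          tcomp_rewrite[OF tbraid_inverse(2)] tid_comp J_inverse)
    show "dcomp (dbraid m' n') (dtens f g) = dcomp (dtens g f) (dbraid m n)"
      if "darr f" "darr g" "src f = m" "src g = n" "tgt f = m'" "tgt g = n'" for f g m n m' n'
    proof (rule up_inject)
      have [simp]: "tarr (up f)" "tarr (up g)" and [simp]: "src f = m" "src g = n" "tgt f = m'" "tgt g = n'"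
        using that by (simp_all add: darr_def)
      have "up (dcomp (dbraid m' n') (dtens f g)) =
          J n' m' @@ (tbraid (F m') (F n') @@ (up f ** up g)) @@ J' m n"
        by (simp add: up_simps up_braid tcomp_assoc J_cancel)
      also have "tbraid (F m') (F n') @@ (up f ** up g) = (up g ** up f) @@ tbraid (F m) (F n)"
        by (rule tbraid_natural) simp_all
      finally show "up (dcomp (dbraid m' n') (dtens f g)) = up (dcomp (dtens g f) (dbraid m n))"
        by (simp add: up_simps up_braid tcomp_assoc J_cancel)
    qed (use that in simp_all)
  qed (auto simp: darr_def up_braid dbraid_hexagon_left dbraid_hexagon_right)
qed

lemma dtwist_natural: "\<lbrakk>darr f; src f = m; tgt f = n\<rbrakk> \<Longrightarrow> dcomp (dtwist n) f = dcomp f (dtwist m)"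
  by (rule up_inject) (auto simp: up_simps up_braid darr_def intro!: ttwist_natural)

lemma dtwist_add:
  "dtwist (m + n) = dcomp (dbraid n m) (dcomp (dbraid m n) (dtens (dtwist m) (dtwist n)))"
proof (rule up_inject)
  have "up (dcomp (dbraid n m) (dcomp (dbraid m n) (dtens (dtwist m) (dtwist n)))) =
      J m n @@ (tbraid (F n) (F m) @@ tbraid (F m) (F n) @@ (ttwist (F m) ** ttwist (F n))) @@ J' m n"
    by (simp add: up_simps up_braid tcomp_assoc J_cancel)
  also have "tbraid (F n) (F m) @@ tbraid (F m) (F n) @@ (ttwist (F m) ** ttwist (F n)) = ttwist (F m \<^bold>\<star> F n)"
    by (simp add: ttwist_tens)
  also have "ttwist (F m \<^bold>\<star> F n) @@ J' m n = J' m n @@ ttwist (F (m + n))"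
    by (rule ttwist_natural) simp_all
  finally show "up (dtwist (m + n)) = up (dcomp (dbraid n m) (dcomp (dbraid m n) (dtens (dtwist m) (dtwist n))))"
    by (simp add: up_braid J_cancel)
qed simp_all

lemma darr_twist: "darr (dtwist n)"
  by (simp add: darr_def up_braid)

lemma dtwist_0: "dtwist 0 = didn 0"
proof -
  interpret strict_braided didn dcomp dtens dnul dplus dscale darr dbraid dbraid'
    by (rule strict_braided_powers)
  have t [simp]: "darr (dtwist 0)" by (rule darr_twist)
  show ?thesis
  proof (rule idempotent_iso[where i = "down 0 0 (ttwist' \<^bold>1)"])
    have "dtwist 0 = dtens (dtwist 0) (dtwist 0)"
      using dtwist_add[of 0 0] by (simp add: B_0_left idn_comp)
    also have "\<dots> = dcomp (dtens (dtwist 0) (didn 0)) (dtens (didn 0) (dtwist 0))"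
      by (rule tens_eq_left_first) simp_all
    finally show "dcomp (dtwist 0) (dtwist 0) = dtwist 0"
      by (simp add: tens_idn0 idn0_tens)
    show "dcomp (dtwist 0) (down 0 0 (ttwist' \<^bold>1)) = didn 0"
      by (rule up_inject) (simp_all add: up_simps up_braid up_down tbraid_inverse)
  qed (simp_all add: darr_def up_down up_braid)
qed

end

section \<open>Evaluation in a trivalent ribbon category\<close>

lemma (in trivalent_calculus) hom_1_1: "\<lbrakk>arr f; src f = 1; tgt f = 1\<rbrakk> \<Longrightarrow> \<exists>c. f = c *\<^sub>a idn 1"
proof -
  assume f: "arr f" "src f = 1" "tgt f = 1"
  then obtain c where "bend f = c *\<^sub>a cap" using hom_2_0[of "bend f"] by auto
  then have "bend f = bend (c *\<^sub>a idn 1)" by (simp add: bend_scale bend_idn)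
  then show ?thesis using f bend_inject[of f "c *\<^sub>a idn 1"] by auto
qed

text \<open>The twist is a scalar on the generating object; its naturality with respect to the split
  determines that scalar.\<close>

lemma (in elementary_calculus) twist_generator:
  assumes [simp]: "arr T" "src T = 1" "tgt T = 1" "arr T'" "src T' = 1" "tgt T' = 1"
    and inv: "T @@ T' = idn 1" and nat: "(P @@ P @@ (T ** T)) @@ split = split @@ T"
  shows "T = (v^12) *\<^sub>a idn 1"
proof -
  obtain c where c: "T = c *\<^sub>a idn 1" using hom_1_1[of T] by auto
  define e where "e = inverse (- (v^6))"
  have P: "P @@ split = e *\<^sub>a split" using P_split by (simp add: e_def)
  have "(c * c * e * e) *\<^sub>a split = (P @@ P @@ (T ** T)) @@ split"
    by (simp add: c comp_assoc scale_tens tens_scale idn_tens_idn scale_comp comp_scale idn_comp P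
        scale_mult[symmetric] mult_ac)
  also have "\<dots> = c *\<^sub>a split"
    unfolding nat by (simp add: c comp_scale comp_idn)
  finally have e: "c * c * e * e = c" by (rule scale_split_inject)
  have "c \<noteq> 0"
  proof
    assume "c = 0"
    then have "T = nul 1 1" using c by (simp add: scale_0)
    then have "idn 1 = nul 1 1" using inv by (simp add: nul_comp)
    then have "1 *\<^sub>a idn 1 = 0 *\<^sub>a idn 1" by (simp add: scale_0 scale_1)
    then show False using scale_idn1_inject by fastforce
  qed
  moreover have "c * (c * (e * e) - 1) = 0" using e by (simp add: algebra_simps)
  ultimately have "c * (e * e) = 1" by simp
  then have "c = v^12" using v_nonzero by (simp add: e_def field_simps power_add[symmetric])
  then show ?thesis using c by simp
qed

lemma finite_basis_coordinates:
  fixes M :: "(complex, 'm) module" and K :: "'m set"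
  assumes M: "module (ring_of_type_algebra :: complex ring) M"
    and K: "finite_basis (ring_of_type_algebra :: complex ring) M K"
  shows "\<exists>\<psi> :: 'm \<Rightarrow> 'm \<Rightarrow> complex.
    (\<forall>k\<in>K. \<forall>x\<in>carrier M. \<forall>y\<in>carrier M. \<psi> k (x \<oplus>\<^bsub>M\<^esub> y) = \<psi> k x + \<psi> k y) \<and>
    (\<forall>k\<in>K. \<forall>c. \<forall>x\<in>carrier M. \<psi> k (c \<odot>\<^bsub>M\<^esub> x) = c * \<psi> k x) \<and>
    (\<forall>x\<in>carrier M. (\<forall>k\<in>K. \<psi> k x = 0) \<longrightarrow> x = \<zero>\<^bsub>M\<^esub>)"
proof -
  interpret module "ring_of_type_algebra :: complex ring" M by (rule M)
  have fin: "finite K" and sub: "K \<subseteq> carrier M"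
    and unique: "\<And>x. x \<in> carrier M \<Longrightarrow> \<exists>!f. f \<in> K \<rightarrow>\<^sub>E (UNIV :: complex set) \<and> x = (\<Oplus>\<^bsub>M\<^esub>b\<in>K. f b \<odot>\<^bsub>M\<^esub> b)"
    using K by (simp_all add: finite_basis_def)
  have cl: "f b \<odot>\<^bsub>M\<^esub> b \<in> carrier M" if "b \<in> K" for f :: "'m \<Rightarrow> complex" and b
    using that sub by auto
  define co where "co x = (THE f. f \<in> K \<rightarrow>\<^sub>E (UNIV :: complex set) \<and> x = (\<Oplus>\<^bsub>M\<^esub>b\<in>K. f b \<odot>\<^bsub>M\<^esub> b))" for x
  have co: "x = (\<Oplus>\<^bsub>M\<^esub>b\<in>K. co x b \<odot>\<^bsub>M\<^esub> b)" if "x \<in> carrier M" for x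
    using theI'[OF unique[OF that]] unfolding co_def by blast
  \<comment> \<open>The coefficient functions of a basis are extensional, so an arbitrary expansion
    is restricted to \<open>K\<close> before uniqueness can be applied.\<close>
  have co_eq: "co x k = f k" if "x \<in> carrier M" "x = (\<Oplus>\<^bsub>M\<^esub>b\<in>K. f b \<odot>\<^bsub>M\<^esub> b)" "k \<in> K" for x f k
  proof -
    have "(\<Oplus>\<^bsub>M\<^esub>b\<in>K. restrict f K b \<odot>\<^bsub>M\<^esub> b) = (\<Oplus>\<^bsub>M\<^esub>b\<in>K. f b \<odot>\<^bsub>M\<^esub> b)"
      by (rule finsum_cong') (use cl in auto)
    then have "restrict f K \<in> K \<rightarrow>\<^sub>E (UNIV :: complex set) \<and> x = (\<Oplus>\<^bsub>M\<^esub>b\<in>K. restrict f K b \<odot>\<^bsub>M\<^esub> b)"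
      using that(2) by simp
    then have "co x = restrict f K"
      unfolding co_def by (rule the1_equality[OF unique[OF that(1)]])
    then show ?thesis using that(3) by simp
  qed
  show ?thesis
  proof (intro exI[of _ "\<lambda>k x. co x k"] conjI ballI allI impI)
    fix k x y assume k: "k \<in> K" and xy: "x \<in> carrier M" "y \<in> carrier M"
    have "x \<oplus>\<^bsub>M\<^esub> y = (\<Oplus>\<^bsub>M\<^esub>b\<in>K. co x b \<odot>\<^bsub>M\<^esub> b) \<oplus>\<^bsub>M\<^esub> (\<Oplus>\<^bsub>M\<^esub>b\<in>K. co y b \<odot>\<^bsub>M\<^esub> b)"
      using co[OF xy(1)] co[OF xy(2)] by simp
    also have "\<dots> = (\<Oplus>\<^bsub>M\<^esub>b\<in>K. co x b \<odot>\<^bsub>M\<^esub> b \<oplus>\<^bsub>M\<^esub> co y b \<odot>\<^bsub>M\<^esub> b)"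
      by (rule finsum_addf[symmetric]) (use cl in auto)
    also have "\<dots> = (\<Oplus>\<^bsub>M\<^esub>b\<in>K. (co x b + co y b) \<odot>\<^bsub>M\<^esub> b)"
      by (rule finsum_cong') (use cl sub smult_l_distr in \<open>auto simp: subset_iff\<close>)
    finally have e: "x \<oplus>\<^bsub>M\<^esub> y = (\<Oplus>\<^bsub>M\<^esub>b\<in>K. (co x b + co y b) \<odot>\<^bsub>M\<^esub> b)" .
    show "co (x \<oplus>\<^bsub>M\<^esub> y) k = co x k + co y k" by (rule co_eq[OF M.a_closed[OF xy] e k])
  next
    fix k c x assume k: "k \<in> K" and x: "x \<in> carrier M"
    have "c \<odot>\<^bsub>M\<^esub> x = c \<odot>\<^bsub>M\<^esub> (\<Oplus>\<^bsub>M\<^esub>b\<in>K. co x b \<odot>\<^bsub>M\<^esub> b)" using co[OF x] by simp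
    also have "\<dots> = (\<Oplus>\<^bsub>M\<^esub>b\<in>K. c \<odot>\<^bsub>M\<^esub> (co x b \<odot>\<^bsub>M\<^esub> b))"
      by (rule finsum_smult_ldistr) (use fin cl in auto)
    also have "\<dots> = (\<Oplus>\<^bsub>M\<^esub>b\<in>K. (c * co x b) \<odot>\<^bsub>M\<^esub> b)"
      by (rule finsum_cong') (use cl sub smult_assoc1 in \<open>auto simp: subset_iff\<close>)
    finally have e: "c \<odot>\<^bsub>M\<^esub> x = (\<Oplus>\<^bsub>M\<^esub>b\<in>K. (c * co x b) \<odot>\<^bsub>M\<^esub> b)" .
    show "co (c \<odot>\<^bsub>M\<^esub> x) k = c * co x k"
      by (rule co_eq[OF _ e k]) (use smult_closed[of c x] x in simp)
  next
    fix x assume x: "x \<in> carrier M" and z: "\<forall>k\<in>K. co x k = 0"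
    have "(\<Oplus>\<^bsub>M\<^esub>b\<in>K. co x b \<odot>\<^bsub>M\<^esub> b) = (\<Oplus>\<^bsub>M\<^esub>b\<in>K. \<zero>\<^bsub>M\<^esub>)"
      by (rule finsum_cong') (use z sub smult_l_null in \<open>auto simp: subset_iff\<close>)
    then show "x = \<zero>\<^bsub>M\<^esub>" using co[OF x] by simp
  qed
qed

locale exceptional_category =
  trivalent_ribbon_category "ring_of_type_algebra :: complex ring" C X ev coev \<tau> +
  complex_trivalent_signature C X ev coev \<tau>
  for C :: "(complex, 'o, 'm) ribbon_structure" (structure)
    and X :: 'o and ev coev \<tau> :: 'm +
  fixes v \<alpha> :: complex
  assumes dim_hom_4: "dim_at_most (ring_of_type_algebra :: complex ring) (hom_pow 4) 5"
    and QEJac: "QEJac v \<alpha>" and v10: "v ^ 10 \<noteq> 1" and v12: "v ^ 12 \<noteq> 1"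

sublocale exceptional_category \<subseteq> complex_ribbon_powers C X
  by unfold_locales (rule X_in)

context exceptional_category
begin

lemma F_small [simp]:
  "F 1 = X" "F 2 = X \<^bold>\<star> X" "F 3 = (X \<^bold>\<star> X) \<^bold>\<star> X" "F 4 = ((X \<^bold>\<star> X) \<^bold>\<star> X) \<^bold>\<star> X"
  by (simp_all add: eval_nat_numeral One_nat_def)

text \<open>For the arities of the basic diagrams the coherence isomorphisms are identities, unitors
  or, in \<open>J_2_right\<close>, single associators. The strict diagrams thereby unfold to the
  formulas written in the given category.\<close>

lemma J_small:
  "J 0 1 = tlunit X" "J 1 1 = tid (X \<^bold>\<star> X)" "J 2 1 = tid ((X \<^bold>\<star> X) \<^bold>\<star> X)"
  "J 3 1 = tid (((X \<^bold>\<star> X) \<^bold>\<star> X) \<^bold>\<star> X)" "J 1 0 = trunit X" "J 2 0 = trunit (X \<^bold>\<star> X)"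
proof -
  show "J 0 1 = tlunit X" unfolding J_1_right by (simp add: step_def)
  show "J 1 1 = tid (X \<^bold>\<star> X)" unfolding J_1_right by (simp add: step_def One_nat_def)
  show "J 2 1 = tid ((X \<^bold>\<star> X) \<^bold>\<star> X)" unfolding J_1_right
    by (simp add: step_def eval_nat_numeral One_nat_def)
  show "J 3 1 = tid (((X \<^bold>\<star> X) \<^bold>\<star> X) \<^bold>\<star> X)" unfolding J_1_right
    by (simp add: step_def eval_nat_numeral One_nat_def)
qed simp_all

lemma J_2_right:
  assumes "n > 0"
  shows "J n 2 = tassoc' (F n) X X"
proof -
  have s: "step (n + 1) = tid (F (n + 1) \<^bold>\<star> X)" "step' 1 = tid (X \<^bold>\<star> X)"
    by (simp_all add: step_def step'_def One_nat_def)
  have "J n 1 = tid (F n \<^bold>\<star> X)"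
    unfolding J_1_right using assms by (cases n) (simp_all add: step_def)
  moreover have "F (n + 1) = F n \<^bold>\<star> X" using assms by (cases n) (simp_all add: Suc_eq_plus1[symmetric])
  moreover have "J n 2 = step (n + 1) @@ (J n 1 ** tid X) @@ tassoc' (F n) (F 1) X @@ (tid (F n) ** step' 1)"
    using J.simps(2)[of n 1] by (simp add: numeral_2_eq_2 One_nat_def)
  ultimately show ?thesis using s by (simp add: ttens_id tid_comp tcomp_id)
qed

lemma J'_eq:
  assumes "J m n @@ i = tid (F (m + n))" "tarr i" "src i = F (m + n)" "tgt i = F m \<^bold>\<star> F n"
  shows "J' m n = i"
proof (rule tcancel_left[where e = "J m n" and i = "J' m n"])
  show "J m n @@ J' m n = J m n @@ i" using assms(1) by (simp add: J_inverse)
qed (use assms in \<open>simp_all add: J_inverse\<close>)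

lemma J'_small:
  "J' 0 1 = tlunit' X" "J' 1 1 = tid (X \<^bold>\<star> X)" "J' 2 1 = tid ((X \<^bold>\<star> X) \<^bold>\<star> X)"
  "J' 3 1 = tid (((X \<^bold>\<star> X) \<^bold>\<star> X) \<^bold>\<star> X)" "J' 1 0 = trunit' X" "J' 2 0 = trunit' (X \<^bold>\<star> X)"
  "J' 1 2 = tassoc X X X"
  by (rule J'_eq; simp add: J_small J_2_right tinverse tid_comp)+

lemma J_2_small: "J 1 2 = tassoc' X X X" "J 2 2 = tassoc' (X \<^bold>\<star> X) X X"
  by (simp_all add: J_2_right)

section \<open>The generators as arrows between tensor powers\<close>

definition "dcap = Arrow (2::nat) (0::nat) ev"
definition "dcup = Arrow (0::nat) (2::nat) coev"
definition "dvtx = Arrow (3::nat) (0::nat) \<tau>"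

lemma generator_type [simp]:
  "src dcap = 2" "tgt dcap = 0" "src dcup = 0" "tgt dcup = 2" "src dvtx = 3" "tgt dvtx = 0"
  by (simp_all add: dcap_def dcup_def dvtx_def)

lemma generator_in: "ev \<in> HOM (X \<^bold>\<star> X) \<^bold>1" "coev \<in> HOM \<^bold>1 (X \<^bold>\<star> X)" "\<tau> \<in> HOM ((X \<^bold>\<star> X) \<^bold>\<star> X) \<^bold>1"
  using self_dual hom_pow_3 by (simp_all add: is_dual_def free_rank1_on_def hom_pow_def)

lemma darr_generator [simp]: "darr dcap" "darr dcup" "darr dvtx"
  using generator_in
  by (simp_all del: tarr_objs add: darr_def tarr_def up_def dcap_def dcup_def dvtx_def)

lemma darr_up [simp]: "darr f \<Longrightarrow> tarr (up f)"
  by (simp add: darr_def)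

lemma mor_simps:
  "mor (didn n) = \<^bold>i\<^bold>d (F n)" "mor (dcomp f g) = mor f \<^bold>\<circ> mor g"
  "mor (dplus f g) = mor f \<oplus>\<^bsub>hom_mod C (F (src f)) (F (tgt f))\<^esub> mor g"
  "mor (dscale c f) = c \<odot>\<^bsub>hom_mod C (F (src f)) (F (tgt f))\<^esub> mor f"
  "mor (dnul m n) = \<zero>\<^bsub>hom_mod C (F m) (F n)\<^esub>"
  by (simp_all add: didn_def dcomp_def dplus_def dscale_def dnul_def down_def up_def tid_def tcomp_def
      tplus_def tscale_def tzero_def)

lemma mor_generator [simp]: "mor dcap = ev" "mor dcup = coev" "mor dvtx = \<tau>"
  by (simp_all add: dcap_def dcup_def dvtx_def)

lemma darr_mor: "darr f \<Longrightarrow> mor f \<in> HOM (F (src f)) (F (tgt f))"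
  by (simp del: tarr_objs add: darr_def tarr_def up_def)

lemma hom_generated:
  assumes free: "free_rank1_on (ring_of_type_algebra :: complex ring) (hom_pow n) (mor g)"
    and g: "darr g" "src g = n" "tgt g = 0"
  shows "g \<noteq> dnul n 0" "\<lbrakk>darr f; src f = n; tgt f = 0\<rbrakk> \<Longrightarrow> \<exists>c. f = dscale c g"
proof -
  interpret M: module "ring_of_type_algebra :: complex ring" "hom_mod C (F n) \<^bold>1"
    by (rule hom_module) simp_all
  have bij: "bij_betw (\<lambda>r. r \<odot>\<^bsub>hom_mod C (F n) \<^bold>1\<^esub> mor g) UNIV (HOM (F n) \<^bold>1)"
    and in_hom: "mor g \<in> HOM (F n) \<^bold>1"
    using free by (simp_all add: free_rank1_on_def hom_pow_def)
  show "g \<noteq> dnul n 0"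
  proof
    assume "g = dnul n 0"
    then have "mor g = \<zero>\<^bsub>hom_mod C (F n) \<^bold>1\<^esub>" by (simp add: mor_simps)
    then have "1 \<odot>\<^bsub>hom_mod C (F n) \<^bold>1\<^esub> mor g = 0 \<odot>\<^bsub>hom_mod C (F n) \<^bold>1\<^esub> mor g"
      using M.smult_one[OF in_hom] M.smult_l_null[OF in_hom] by simp
    then have "(1::complex) = 0"
      by (intro inj_onD[OF bij_betw_imp_inj_on[OF bij]]) simp_all
    then show False by simp
  qed
  assume f: "darr f" "src f = n" "tgt f = 0"
  then have "mor f \<in> HOM (F n) \<^bold>1" using darr_mor[of f] by simp
  then obtain c where "mor f = c \<odot>\<^bsub>hom_mod C (F n) \<^bold>1\<^esub> mor g"
    using bij by (auto simp: bij_betw_def image_iff)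
  then have "f = dscale c g"
    using f g by (intro arrow.expand) (simp_all add: mor_simps)
  then show "\<exists>c. f = dscale c g" ..
qed

lemma darr_braid [simp]: "darr (dbraid m n)" "darr (dbraid' m n)"
  by (simp_all add: darr_def up_braid)

lemma trivalent_powers:
  assumes "v \<noteq> 0" "d \<noteq> 0" "b \<noteq> 0"
  shows "trivalent_calculus didn dcomp dtens dnul dplus dscale darr dcap dcup dvtx (dbraid' 1 1) (dbraid 1 1) v d b"
proof -
  interpret strict_braided didn dcomp dtens dnul dplus dscale darr dbraid dbraid'
    by (rule strict_braided_powers)
  note dual = self_dual[unfolded is_dual_def]
  show ?thesis
  proof unfold_locales
    have "up (dcomp (dtens dcap (didn 1)) (dtens (didn 1) dcup)) =
        tlunit X @@ (up dcap ** tid X) @@ tassoc' X X X @@ (tid X ** up dcup) @@ trunit' X"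
      by (simp add: up_simps J_small J'_small J_2_small tcomp_assoc tid_comp)
    also have "\<dots> = tid X"
      using dual by (simp add: tdefs up_def)
    finally show "dcomp (dtens dcap (didn 1)) (dtens (didn 1) dcup) = didn 1"
      by (intro up_inject) (simp_all add: up_simps)
    have "up (dcomp (dtens (didn 1) dcap) (dtens dcup (didn 1))) =
        trunit X @@ (tid X ** up dcap) @@ tassoc X X X @@ (up dcup ** tid X) @@ tlunit' X"
      by (simp add: up_simps J_small J'_small tcomp_assoc tid_comp)
    also have "\<dots> = tid X"
      using dual by (simp add: tdefs up_def)
    finally show "dcomp (dtens (didn 1) dcap) (dtens dcup (didn 1)) = didn 1"
      by (intro up_inject) (simp_all add: up_simps)
    show "dcap \<noteq> dnul 2 0" and "\<And>f. \<lbrakk>darr f; src f = 2; tgt f = 0\<rbrakk> \<Longrightarrow> \<exists>c. f = dscale c dcap"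
      using hom_generated[of 2 dcap] hom_pow_2 by auto
    show "dvtx \<noteq> dnul 3 0" and "\<And>f. \<lbrakk>darr f; src f = 3; tgt f = 0\<rbrakk> \<Longrightarrow> \<exists>c. f = dscale c dvtx"
      using hom_generated[of 3 dvtx] hom_pow_3 by auto
    show "dcomp (dtens dcap (didn 1)) (dcomp (dtens (didn 1) x) (dtens x (didn 1))) = dtens (didn 1) dcap"
      if "x \<in> {dbraid' 1 1, dbraid 1 1}" for x
      using that by (rule slide_2[rotated -1]) simp_all
    show "dcomp (dtens dvtx (didn 1)) (dcomp (dtens (didn 2) x)
        (dcomp (dtens (didn 1) (dtens x (didn 1))) (dtens x (didn 2)))) = dtens (didn 1) dvtx"
      if "x \<in> {dbraid' 1 1, dbraid 1 1}" for x
      using that by (rule slide_3[rotated -1]) simp_all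
  qed (use assms yang_baxter_N PN NP in simp_all)
qed

lemma exists_admissible_calculus:
  "\<exists>d b t K (\<phi> :: 'm \<Rightarrow> _). admissible_calculus didn dcomp dtens dnul dplus dscale dcap dcup dvtx
    (dbraid' 1 1) (dbraid 1 1) v d b t \<alpha> K \<phi> darr"
proof -
  have v: "v \<noteq> 0" and jac: "(v powi (-3)) \<odot>\<^bsub>E2\<^esub> (Hmor \<^bold>\<circ> \<sigma>) \<oplus>\<^bsub>E2\<^esub> v \<odot>\<^bsub>E2\<^esub> Imor \<oplus>\<^bsub>E2\<^esub> (- (v powi (-1))) \<odot>\<^bsub>E2\<^esub> Hmor
       \<oplus>\<^bsub>E2\<^esub> \<alpha> \<odot>\<^bsub>E2\<^esub> (\<sigma> \<oplus>\<^bsub>E2\<^esub> (v ^ 4) \<odot>\<^bsub>E2\<^esub> Umor \<oplus>\<^bsub>E2\<^esub> (v powi (-4)) \<odot>\<^bsub>E2\<^esub> One2) = \<zero>\<^bsub>E2\<^esub>"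
    using QEJac by (simp_all add: QEJac_def)
  obtain d b t where el: "elementary_relations v d b t" using QEJac by (auto simp: QEJac_def)
  note el = el[unfolded elementary_relations_def]
  interpret S: strict_braided didn dcomp dtens dnul dplus dscale darr dbraid dbraid'
    by (rule strict_braided_powers)
  \<comment> \<open>The endomorphisms of the unit are free on the identity, so the value occurring
    in (QEJac) is the circle value known to be nonzero.\<close>
  have d: "d \<noteq> 0"
  proof -
    obtain d' where d': "d' \<noteq> 0" "ev \<^bold>\<circ> coev = d' \<odot>\<^bsub>hom_mod C \<^bold>1 \<^bold>1\<^esub> \<^bold>i\<^bold>d \<^bold>1"
      using circle_nonzero by auto
    moreover have "inj (\<lambda>r. r \<odot>\<^bsub>hom_mod C \<^bold>1 \<^bold>1\<^esub> \<^bold>i\<^bold>d \<^bold>1)"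
      using hom_pow_0 by (simp add: free_rank1_on_def hom_pow_def bij_betw_def)
    ultimately have "d = d'" using el by (auto simp: inj_def)
    then show ?thesis using d' by simp
  qed
  \<comment> \<open>For b = 0 the nonzero bigon value of the category would annihilate the identity
    strand, hence also \<open>dcap\<close>.\<close>
  have b: "b \<noteq> 0"
  proof
    assume "b = 0"
    obtain b' where b': "b' \<noteq> 0" "merge \<^bold>\<circ> split = b' \<odot>\<^bsub>hom_mod C X X\<^esub> \<^bold>i\<^bold>d X"
      using bigon_nonzero by auto
    then have "dscale b' (didn 1) = dscale 0 (didn 1)"
      using el \<open>b = 0\<close> by (intro arrow.expand) (simp add: mor_simps)
    then have "didn 1 = dnul 1 1"
      using b' S.scale_eq_nul[of "didn 1" b'] by (simp add: S.scale_0)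
    then have "dtens (didn 1) (didn 1) = dnul 2 2"
      by (simp add: S.nul_tens)
    then have "didn 2 = dnul 2 2" by (simp add: S.idn_tens_idn)
    then have "dcap = dnul 2 0"
      using S.comp_idn[of dcap 2] S.comp_nul[of dcap 2 0 2] by simp
    then show False using hom_generated(1)[of 2 dcap] hom_pow_2 by simp
  qed
  interpret T: trivalent_calculus didn dcomp dtens dnul dplus dscale darr dcap dcup dvtx
    "dbraid' 1 1" "dbraid 1 1" v d b
    by (rule trivalent_powers[OF v d b])
  have "up T.merge = tlunit X @@ (up dvtx ** tid X) @@ tassoc' (X \<^bold>\<star> X) X X @@ (tid (X \<^bold>\<star> X) ** up dcup) @@ trunit' (X \<^bold>\<star> X)"
    by (simp add: T.merge_def up_simps J_small J'_small J_2_small tcomp_assoc tid_comp)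
  also have "\<dots> = Arrow (X \<^bold>\<star> X) X merge" by (simp add: tdefs up_def merge_def)
  finally have merge: "up T.merge = Arrow (X \<^bold>\<star> X) X merge" .
  have "up T.split = (up T.merge ** tid X) @@ tassoc' X X X @@ (tid X ** up dcup) @@ trunit' X"
    by (simp add: T.split_def up_simps J_small J'_small J_2_small tcomp_assoc tid_comp)
  also have "\<dots> = Arrow X (X \<^bold>\<star> X) split" unfolding merge by (simp add: tdefs up_def split_def)
  finally have split: "up T.split = Arrow X (X \<^bold>\<star> X) split" .
  have "up T.H = (tid X ** up T.merge) @@ tassoc X X X @@ (up T.split ** tid X)"
    by (simp add: T.H_def up_simps J_small J'_small J_2_small tcomp_assoc tid_comp tcomp_id)
  also have "\<dots> = Arrow (X \<^bold>\<star> X) (X \<^bold>\<star> X) Hmor" unfolding merge split by (simp add: tdefs Hmor_def)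
  finally have H: "up T.H = Arrow (X \<^bold>\<star> X) (X \<^bold>\<star> X) Hmor" .
  have N: "up (dbraid' 1 1) = Arrow (X \<^bold>\<star> X) (X \<^bold>\<star> X) \<sigma>"
    by (simp add: up_braid J_small J'_small tid_comp tcomp_id) (simp add: tbraid'_def \<sigma>_def)
  have mors: "mor T.merge = merge" "mor T.split = split" "mor T.H = Hmor" "mor (dbraid' 1 1) = \<sigma>"
    using arg_cong[OF merge, of mor] arg_cong[OF split, of mor] arg_cong[OF H, of mor] arg_cong[OF N, of mor]
    by (simp_all add: up_def)
  have mors': "mor T.U = Umor" "mor T.I = Imor"
    by (simp_all add: T.U_def T.I_def mor_simps mors Umor_def Imor_def)
  obtain K where K: "finite_basis (ring_of_type_algebra :: complex ring) (hom_pow 4) K" "card K \<le> 5"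
    using dim_hom_4 by (auto simp: dim_at_most_def)
  have M: "module (ring_of_type_algebra :: complex ring) (hom_pow 4)"
    unfolding hom_pow_def by (rule hom_module) simp_all
  from finite_basis_coordinates[OF M K(1)] obtain \<psi> :: "'m \<Rightarrow> 'm \<Rightarrow> complex" where
    \<psi>: "\<forall>k\<in>K. \<forall>x\<in>carrier (hom_pow 4). \<forall>y\<in>carrier (hom_pow 4).
        \<psi> k (x \<oplus>\<^bsub>hom_pow 4\<^esub> y) = \<psi> k x + \<psi> k y"
      "\<forall>k\<in>K. \<forall>c. \<forall>x\<in>carrier (hom_pow 4). \<psi> k (c \<odot>\<^bsub>hom_pow 4\<^esub> x) = c * \<psi> k x"
      "\<forall>x\<in>carrier (hom_pow 4). (\<forall>k\<in>K. \<psi> k x = 0) \<longrightarrow> x = \<zero>\<^bsub>hom_pow 4\<^esub>"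
    by blast
  have in4: "mor f \<in> carrier (hom_pow 4)" if "darr f" "src f = 4" "tgt f = 0" for f
    using darr_mor[OF that(1)] that(2,3) by (simp add: hom_pow_def)
  have "admissible_calculus didn dcomp dtens dnul dplus dscale dcap dcup dvtx
    (dbraid' 1 1) (dbraid 1 1) v d b t \<alpha> K (\<lambda>k f. \<psi> k (mor f)) darr"
  proof unfold_locales
    show "dcomp dcap dcup = dscale d (didn 0)"
      using el by (intro arrow.expand) (simp add: mor_simps)
    show "dcomp T.merge dcup = dnul 0 1"
      using el by (intro arrow.expand) (simp add: mor_simps mors)
    show "dcomp T.merge T.split = dscale b (didn 1)"
      using el by (intro arrow.expand) (simp add: mor_simps mors)
    show "dcomp T.H T.split = dscale t T.split"
      using el by (intro arrow.expand) (simp add: mor_simps mors)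
    show "dcomp (dbraid' 1 1) T.split = dscale (- (v ^ 6)) T.split"
      using el by (intro arrow.expand) (simp add: mor_simps mors)
    show "dcomp (dbraid' 1 1) dcup = dscale (v ^ 12) dcup"
      using el by (intro arrow.expand) (simp add: mor_simps mors)
    have "mor (dplus (dplus (dplus (dscale (inverse v ^ 3) (dcomp T.H (dbraid' 1 1))) (dscale v T.I))
        (dscale (- inverse v) T.H)) (dscale \<alpha> (dplus (dplus (dbraid' 1 1) (dscale (v ^ 4) T.U))
        (dscale (inverse v ^ 4) (didn 2))))) = mor (dnul 2 2)"
      using jac by (simp add: mor_simps mors mors' E2_def One2_def power_int_minus power_inverse)
    then show "dplus (dplus (dplus (dscale (inverse v ^ 3) (dcomp T.H (dbraid' 1 1))) (dscale v T.I))
        (dscale (- inverse v) T.H)) (dscale \<alpha> (dplus (dplus (dbraid' 1 1) (dscale (v ^ 4) T.U))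
        (dscale (inverse v ^ 4) (didn 2)))) = dnul 2 2"
      by (intro arrow.expand) simp
    show "finite K" using K by (simp add: finite_basis_def)
    show "card K \<le> 5" by (rule K)
    show "\<psi> k (mor (dplus f g)) = \<psi> k (mor f) + \<psi> k (mor g)"
      if "k \<in> K" "darr f" "src f = 4" "tgt f = 0" "darr g" "src g = 4" "tgt g = 0" for k f g
      using \<psi>(1)[rule_format, of k "mor f" "mor g"] that in4[of f] in4[of g] by (simp add: mor_simps hom_pow_def)
    show "\<psi> k (mor (dscale c f)) = c * \<psi> k (mor f)"
      if "k \<in> K" "darr f" "src f = 4" "tgt f = 0" for k c f
      using \<psi>(2)[rule_format, of k "mor f" c] that in4[of f] by (simp add: mor_simps hom_pow_def)
    show "f = dnul 4 0" if "darr f" "src f = 4" "tgt f = 0" "\<forall>k\<in>K. \<psi> k (mor f) = 0" for f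
      using \<psi>(3)[rule_format, of "mor f"] that in4[of f]
      by (intro arrow.expand) (simp add: mor_simps hom_pow_def)
  qed (rule v10, rule v12)
  then show ?thesis by blast
qed

end

section \<open>The evaluation functor\<close>

text \<open>Composition in \<open>QExc\<close> is a union over all arities. As a diagram has at most
  one, a single member of the union is non-empty.\<close>

lemma arity_unique: "\<lbrakk>arity f m n; arity f m' n'\<rbrakk> \<Longrightarrow> m = m' \<and> n = n'"
proof (induction arbitrary: m' n' rule: arity.induct)
  case (7 f l n g m)
  from \<open>arity (f \<cdot> g) m' n'\<close> obtain l' where "arity f l' n'" "arity g m' l'" by (rule arity_elims)
  then show ?case using 7 by blast
next
  case (8 f m n g k l)
  from \<open>arity (f \<parallel> g) m' n'\<close> obtain a b c e where
    "m' = a + c" "n' = b + e" "arity f a b" "arity g c e" by (rule arity_elims) blast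
  then show ?case using 8 by blast
qed (blast elim: arity_elims)+

lemma qexc_eq_arity: "qexc_eq v w m n f g \<Longrightarrow> arity f m n \<and> arity g m n"
  by (induction rule: qexc_eq.induct) (auto intro: arity.intros)

lemma arity_t_braid1: "arity (t_braid1 n) (1 + n) (n + 1)"
proof (induction n)
  case 0
  show ?case using arity.intros(1)[of 1] by simp
next
  case (Suc n)
  have "arity (Strands n \<parallel> Pos) (n + 2) (n + 2)" by (intro arity.intros)
  moreover have "arity (t_braid1 n \<parallel> Strands 1) (1 + n + 1) (n + 1 + 1)" by (intro arity.intros Suc)
  ultimately show ?case by (auto intro!: arity.intros(7) simp: numeral_2_eq_2 One_nat_def)
qed

lemma arity_t_braid: "arity (t_braid m n) (m + n) (n + m)"
proof (induction m)
  case 0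
  show ?case using arity.intros(1)[of n] by simp
next
  case (Suc m)
  have "arity (t_braid m n \<parallel> Strands 1) (m + n + 1) (n + m + 1)" by (intro arity.intros Suc)
  moreover have "arity (Strands m \<parallel> t_braid1 n) (m + (1 + n)) (m + (n + 1))"
    by (intro arity.intros arity_t_braid1)
  ultimately show ?case by (auto intro!: arity.intros(7) simp: add.assoc One_nat_def)
qed

lemma arity_t_twist: "arity (t_twist n) n n"
proof (induction n)
  case 0
  show ?case using arity.intros(1)[of 0] by simp
next
  case (Suc n)
  have "arity t_twist1 1 1"
  proof -
    have "arity (Strands 1 \<parallel> Cap) (1 + 2) (1 + 0)" "arity (Pos \<parallel> Strands 1) (2 + 1) (2 + 1)"
      "arity (Strands 1 \<parallel> Cup) (1 + 0) (1 + 2)" by (intro arity.intros)+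
    then show ?thesis unfolding t_twist1_def by (auto intro!: arity.intros(7))
  qed
  then have "arity (t_twist n \<parallel> t_twist1) (n + 1) (n + 1)" by (intro arity.intros Suc)
  then have "arity (t_braid n 1 \<cdot> (t_twist n \<parallel> t_twist1)) (n + 1) (1 + n)"
    by (rule arity.intros(7)[OF arity_t_braid])
  then have "arity (t_braid 1 n \<cdot> t_braid n 1 \<cdot> (t_twist n \<parallel> t_twist1)) (n + 1) (n + 1)"
    by (rule arity.intros(7)[OF arity_t_braid])
  then show ?case unfolding t_twist.simps by (simp only: Suc_eq_plus1)
qed

lemma mem_qexc_class: "g \<in> qexc_class v w m n f \<longleftrightarrow> qexc_eq v w m n f g"
  by (simp add: qexc_class_def qexc_rel_def)

lemma qexc_class_eq: "qexc_eq v w m n f g \<Longrightarrow> qexc_class v w m n f = qexc_class v w m n g"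
  unfolding qexc_class_def qexc_rel_def by (auto intro: qexc_eq.sym qexc_eq.trans)

lemma qexc_class_self: "arity f m n \<Longrightarrow> f \<in> qexc_class v w m n f"
  by (simp add: mem_qexc_class qexc_eq.refl)

lemma qexc_homE:
  assumes "A \<in> carrier (qexc_hom v w m n)"
  obtains f where "arity f m n" "A = qexc_class v w m n f"
  using assms by (auto simp: qexc_hom_def quotient_def qexc_class_def)

lemma qexc_cmp:
  assumes f: "arity f b c" and g: "arity g a b"
  shows "cmp (QExc v w) (qexc_class v w b c f) (qexc_class v w a b g) = qexc_class v w a c (f \<cdot> g)"
proof -
  have fg: "arity (f \<cdot> g) a c" using f g by (rule arity.intros)
  have *: "qexc_eq v w a c (f \<cdot> g) h"
    if "qexc_eq v w b c f f'" "qexc_eq v w a b g g'" and h: "qexc_eq v w m n (f' \<cdot> g') h" for f' g' m n h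
  proof -
    have e: "qexc_eq v w a c (f \<cdot> g) (f' \<cdot> g')" using that(1,2) by (rule qexc_eq.cong_stack)
    have "m = a \<and> n = c" using arity_unique qexc_eq_arity[OF h] qexc_eq_arity[OF e] by blast
    then show ?thesis using h e by (auto intro: qexc_eq.trans)
  qed
  have "qexc_class v w a c (f \<cdot> g) \<subseteq> cmp (QExc v w) (qexc_class v w b c f) (qexc_class v w a b g)"
    using qexc_class_self[OF f, of v w] qexc_class_self[OF g, of v w] unfolding QExc_def by simp blast
  moreover have "cmp (QExc v w) (qexc_class v w b c f) (qexc_class v w a b g) \<subseteq>
      qexc_class v w a c (f \<cdot> g)"
  proof
    fix h assume "h \<in> cmp (QExc v w) (qexc_class v w b c f) (qexc_class v w a b g)"
    then obtain f' g' m n where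
      "qexc_eq v w b c f f'" "qexc_eq v w a b g g'" "qexc_eq v w m n (f' \<cdot> g') h"
      by (auto simp: QExc_def mem_qexc_class)
    then show "h \<in> qexc_class v w a c (f \<cdot> g)" unfolding mem_qexc_class by (rule *)
  qed
  ultimately show ?thesis by (rule equalityI[rotated])
qed

lemma qexc_tens:
  assumes f: "arity f a b" and g: "arity g c e"
  shows "tens_mor (QExc v w) (qexc_class v w a b f) (qexc_class v w c e g) =
    qexc_class v w (a + c) (b + e) (f \<parallel> g)"
proof -
  have *: "qexc_eq v w (a + c) (b + e) (f \<parallel> g) h"
    if "qexc_eq v w a b f f'" "qexc_eq v w c e g g'" and h: "qexc_eq v w m n (f' \<parallel> g') h" for f' g' m n h
  proof -
    have e: "qexc_eq v w (a + c) (b + e) (f \<parallel> g) (f' \<parallel> g')" using that(1,2) by (rule qexc_eq.cong_beside)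
    have "m = a + c \<and> n = b + e" using arity_unique qexc_eq_arity[OF h] qexc_eq_arity[OF e] by blast
    then show ?thesis using h e by (auto intro: qexc_eq.trans)
  qed
  have "qexc_class v w (a + c) (b + e) (f \<parallel> g) \<subseteq>
      tens_mor (QExc v w) (qexc_class v w a b f) (qexc_class v w c e g)"
    using qexc_class_self[OF f, of v w] qexc_class_self[OF g, of v w] unfolding QExc_def by simp blast
  moreover have "tens_mor (QExc v w) (qexc_class v w a b f) (qexc_class v w c e g) \<subseteq>
      qexc_class v w (a + c) (b + e) (f \<parallel> g)"
  proof
    fix h assume "h \<in> tens_mor (QExc v w) (qexc_class v w a b f) (qexc_class v w c e g)"
    then obtain f' g' m n where
      "qexc_eq v w a b f f'" "qexc_eq v w c e g g'" "qexc_eq v w m n (f' \<parallel> g') h"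
      by (auto simp: QExc_def mem_qexc_class)
    then show "h \<in> qexc_class v w (a + c) (b + e) (f \<parallel> g)" unfolding mem_qexc_class by (rule *)
  qed
  ultimately show ?thesis by (rule equalityI[rotated])
qed

lemma qexc_add:
  assumes f: "arity f m n" and g: "arity g m n"
  shows "add (qexc_hom v w m n) (qexc_class v w m n f) (qexc_class v w m n g) = qexc_class v w m n (f +\<^sub>t g)"
proof -
  have *: "qexc_class v w m n (f' +\<^sub>t g') = qexc_class v w m n (f +\<^sub>t g)"
    if "qexc_eq v w m n f f'" "qexc_eq v w m n g g'" for f' g'
    by (rule qexc_class_eq[symmetric]) (use that in \<open>rule qexc_eq.cong_plus\<close>)
  have "add (qexc_hom v w m n) (qexc_class v w m n f) (qexc_class v w m n g) =
      (\<Union>f'\<in>qexc_class v w m n f. \<Union>g'\<in>qexc_class v w m n g. qexc_class v w m n (f +\<^sub>t g))"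
    unfolding qexc_hom_def ring.select_convs module.select_convs
    by (intro SUP_cong HOL.refl) (rule *; simp only: mem_qexc_class)
  then show ?thesis using qexc_class_self[OF f, of v w] qexc_class_self[OF g, of v w] by auto
qed

lemma qexc_smult:
  assumes f: "arity f m n"
  shows "module.smult (qexc_hom v w m n) c (qexc_class v w m n f) = qexc_class v w m n (c *\<^sub>t f)"
proof -
  have *: "qexc_class v w m n (c *\<^sub>t f') = qexc_class v w m n (c *\<^sub>t f)" if "qexc_eq v w m n f f'" for f'
    by (rule qexc_class_eq[symmetric]) (use that in \<open>rule qexc_eq.cong_scale\<close>)
  have "module.smult (qexc_hom v w m n) c (qexc_class v w m n f) =
      (\<Union>f'\<in>qexc_class v w m n f. qexc_class v w m n (c *\<^sub>t f))"
    unfolding qexc_hom_def ring.select_convs module.select_convs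
    by (intro SUP_cong HOL.refl) (rule *; simp only: mem_qexc_class)
  then show ?thesis using qexc_class_self[OF f, of v w] by auto
qed

context exceptional_category
begin

text \<open>Cap and cup are arbitrary here, but the vertex is \<open>dvtx\<close>: this is why
  \<tau> is hit exactly even after the self-duality has been rescaled.\<close>

lemma evaluation_functor_of_calculus:
  assumes "qexc_calculus didn dcomp dtens dnul dplus dscale cap' cup' dvtx (dbraid' 1 1) (dbraid 1 1)
    v d b t \<beta> (K :: 'm set) \<phi> darr w"
  shows "\<exists>Fo Fm J J0. evaluation_functor v w C X Fo Fm J J0 \<and> sends_vertex_to v w C \<tau> Fo Fm J J0"
proof -
  interpret Q: qexc_calculus didn dcomp dtens dnul dplus dscale cap' cup' dvtx "dbraid' 1 1" "dbraid 1 1"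
    v d b t \<beta> K \<phi> darr w
    by (rule assms)
  interpret S: strict_braided didn dcomp dtens dnul dplus dscale darr dbraid dbraid'
    by (rule strict_braided_powers)
  define ev' where "ev' = Q.eval_tangle"
  have ev_type: "darr (ev' f) \<and> src (ev' f) = m \<and> tgt (ev' f) = n" if "arity f m n" for f m n
    unfolding ev'_def by (rule Q.eval_tangle_type[OF that])
  have braid: "Q.eval_tangle (t_braid m n) = dbraid m n" for m n
    by (rule Q.eval_braid) (simp_all add: S.B_0_left S.B_0_right S.B_1_Suc S.B_Suc)
  have twist1: "dtwist 1 = dscale (v ^ 12) (didn 1)"
  proof (rule Q.twist_generator[where T' = "down 1 1 (ttwist' X)"])
    show "dcomp (dtwist 1) (down 1 1 (ttwist' X)) = didn 1"
      by (rule up_inject) (simp_all add: up_simps up_braid up_down tbraid_inverse)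
    have "dtwist 2 = dcomp (dbraid 1 1) (dcomp (dbraid 1 1) (dtens (dtwist 1) (dtwist 1)))"
      using dtwist_add[of 1 1] by simp
    then show "dcomp (dcomp (dbraid 1 1) (dcomp (dbraid 1 1) (dtens (dtwist 1) (dtwist 1)))) Q.split =
        dcomp Q.split (dtwist 1)"
      using dtwist_natural[of Q.split 1 2] by simp
  qed (simp_all add: darr_def up_down up_braid)
  have twist: "Q.eval_tangle (t_twist n) = dtwist n" for n
  proof (rule Q.eval_twist[OF braid])
    show "dtwist (Suc n) = dcomp (dbraid 1 n) (dcomp (dbraid n 1) (dtens (dtwist n) (dtwist 1)))" for n
      using dtwist_add[of n 1] by (simp add: One_nat_def)
  qed (rule dtwist_0, rule twist1)
  define Fm where "Fm A = mor (ev' (SOME f. f \<in> A))" for A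
  \<comment> \<open>\<open>Fm\<close> evaluates some representative of a class; by
    \<open>eval_qexc_eq\<close> every other one gives the same morphism.\<close>
  have Fm: "Fm (qexc_class v w m n f) = mor (ev' f)" if "arity f m n" for m n f
  proof -
    have "(SOME g. g \<in> qexc_class v w m n f) \<in> qexc_class v w m n f"
      by (rule someI[of _ f]) (rule qexc_class_self[OF that])
    then have "qexc_eq v w m n f (SOME g. g \<in> qexc_class v w m n f)"
      by (simp only: mem_qexc_class)
    then show ?thesis unfolding Fm_def ev'_def using Q.eval_qexc_eq by metis
  qed
  have Fm_Strands: "Fm (qexc_class v w n n (Strands n)) = \<^bold>i\<^bold>d (F n)" for n
    by (simp add: Fm arity.intros ev'_def mor_simps)
  have mor_up: "mor (up f) = mor f" for f :: "(nat, 'm) arrow"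
    by (simp add: up_def)
  have mor_comp: "mor f \<^bold>\<circ> mor g = mor (f @@ g)" for f g :: "('o, 'm) arrow"
    by (simp add: tcomp_def)
  have mor_tens: "mor f \<^bold>\<otimes> mor g = mor (f ** g)" for f g :: "('o, 'm) arrow"
    by (simp add: ttens_def)
  have mor_id: "\<^bold>i\<^bold>d a = mor (tid a)" for a by (simp add: tid_def)
  have mor_structure: "\<a> a b c = mor (tassoc a b c)" "\<l> a = mor (tlunit a)" "\<r> a = mor (trunit a)"
      "\<c> a b = mor (tbraid a b)" for a b c
    by (simp_all add: tassoc_def tlunit_def trunit_def tbraid_def)
  note mor_fold = mor_comp mor_tens mor_id mor_structure
  have "ribbon_functor (ring_of_type_algebra :: complex ring) (QExc v w) C F Fm (\<lambda>a b. mor (J a b)) (\<^bold>i\<^bold>d \<^bold>1)"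
  proof
    fix a b c :: nat
    show "F a \<in> objs C" by simp
    show "Fm (ident (QExc v w) a) = \<^bold>i\<^bold>d (F a)" by (simp add: QExc_def Fm_Strands)
    show "Fm f \<in> HOM (F a) (F b)" if "f \<in> carrier (hom_mod (QExc v w) a b)" for f
    proof -
      from that obtain g where g: "arity g a b" "f = qexc_class v w a b g"
        by (auto simp: QExc_def elim: qexc_homE)
      then show ?thesis using darr_mor[of "ev' g"] ev_type[OF g(1)] by (simp add: Fm)
    qed
    show "Fm (cmp (QExc v w) g f) = Fm g \<^bold>\<circ> Fm f"
      if "g \<in> carrier (hom_mod (QExc v w) b c)" "f \<in> carrier (hom_mod (QExc v w) a b)" for f g
    proof -
      from that obtain f' g' where fg: "arity g' b c" "g = qexc_class v w b c g'"
          "arity f' a b" "f = qexc_class v w a b f'"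
        by (auto simp: QExc_def elim!: qexc_homE)
      then show ?thesis by (simp add: qexc_cmp Fm arity.intros ev'_def mor_simps)
    qed
    show "Fm (f \<oplus>\<^bsub>hom_mod (QExc v w) a b\<^esub> g) = Fm f \<oplus>\<^bsub>hom_mod C (F a) (F b)\<^esub> Fm g"
      if "f \<in> carrier (hom_mod (QExc v w) a b)" "g \<in> carrier (hom_mod (QExc v w) a b)" for f g
    proof -
      from that obtain f' g' where fg: "arity f' a b" "f = qexc_class v w a b f'"
          "arity g' a b" "g = qexc_class v w a b g'"
        by (auto simp: QExc_def elim!: qexc_homE)
      then show ?thesis using ev_type[OF fg(1)]
        by (simp add: QExc_def qexc_add Fm arity.intros ev'_def mor_simps)
    qed
    show "Fm (r \<odot>\<^bsub>hom_mod (QExc v w) a b\<^esub> f) = r \<odot>\<^bsub>hom_mod C (F a) (F b)\<^esub> Fm f"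
      if "f \<in> carrier (hom_mod (QExc v w) a b)" for r f
    proof -
      from that obtain f' where f: "arity f' a b" "f = qexc_class v w a b f'"
        by (auto simp: QExc_def elim!: qexc_homE)
      then show ?thesis using ev_type[OF f(1)]
        by (simp add: QExc_def qexc_smult Fm arity.intros ev'_def mor_simps)
    qed
    have J_hom: "mor (J m n) \<in> HOM (F m \<^bold>\<star> F n) (F (m + n))" "mor (J' m n) \<in> HOM (F (m + n)) (F m \<^bold>\<star> F n)" for m n
      using J_type(3)[of m n] J'_type(3)[of m n] by (simp_all del: tarr_objs J_type(3) J'_type(3) add: tarr_def)
    show "is_iso (F a \<^bold>\<star> F b) (F (tens_ob (QExc v w) a b)) (mor (J a b))"
      unfolding is_iso_def inverse_mor_def
      by (rule exI[of _ "mor (J' a b)"]) (simp add: QExc_def J_hom mor_comp J_inverse mor_id)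
    show "is_iso \<^bold>1 (F (unit_ob (QExc v w))) (\<^bold>i\<^bold>d \<^bold>1)"
      unfolding is_iso_def inverse_mor_def
      by (rule exI[of _ "\<^bold>i\<^bold>d \<^bold>1"]) (simp add: QExc_def id_in comp_id[OF _ _ id_in])
    show "Fm (tens_mor (QExc v w) f g) \<^bold>\<circ> mor (J a b) = mor (J a' b') \<^bold>\<circ> (Fm f \<^bold>\<otimes> Fm g)"
      if "f \<in> carrier (hom_mod (QExc v w) a a')" "g \<in> carrier (hom_mod (QExc v w) b b')" for f g a' b'
    proof -
      from that obtain f' g' where fg: "arity f' a a'" "f = qexc_class v w a a' f'"
          "arity g' b b'" "g = qexc_class v w b b' g'"
        by (auto simp: QExc_def elim!: qexc_homE)
      note t = ev_type[OF fg(1)] ev_type[OF fg(3)]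
      have "Fm (tens_mor (QExc v w) f g) \<^bold>\<circ> mor (J a b) = mor (up (ev' (f' \<parallel> g')) @@ J a b)"
        using fg by (simp add: qexc_tens Fm arity.intros mor_comp[symmetric] mor_up)
      also have "up (ev' (f' \<parallel> g')) @@ J a b = J a' b' @@ (up (ev' f') ** up (ev' g'))"
        using t by (simp add: ev'_def up_simps tcomp_assoc J_inverse tcomp_id)
      finally show ?thesis using fg by (simp add: Fm mor_comp[symmetric] mor_tens[symmetric] mor_up)
    qed
    show "Fm (assoc (QExc v w) a b c) \<^bold>\<circ> mor (J (tens_ob (QExc v w) a b) c) \<^bold>\<circ> (mor (J a b) \<^bold>\<otimes> \<^bold>i\<^bold>d (F c)) =
        mor (J a (tens_ob (QExc v w) b c)) \<^bold>\<circ> (\<^bold>i\<^bold>d (F a) \<^bold>\<otimes> mor (J b c)) \<^bold>\<circ> \<a> (F a) (F b) (F c)"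
      by (simp add: QExc_def Fm_Strands mor_fold J_assoc tid_comp add.assoc)
    show "Fm (lunit (QExc v w) a) \<^bold>\<circ> mor (J (unit_ob (QExc v w)) a) \<^bold>\<circ> (\<^bold>i\<^bold>d \<^bold>1 \<^bold>\<otimes> \<^bold>i\<^bold>d (F a)) = \<l> (F a)"
      by (simp add: QExc_def Fm_Strands mor_fold J_0_left tid_comp ttens_id tcomp_id)
    show "Fm (runit (QExc v w) a) \<^bold>\<circ> mor (J a (unit_ob (QExc v w))) \<^bold>\<circ> (\<^bold>i\<^bold>d (F a) \<^bold>\<otimes> \<^bold>i\<^bold>d \<^bold>1) = \<r> (F a)"
      by (simp add: QExc_def Fm_Strands mor_fold tid_comp ttens_id tcomp_id)
    show "Fm (braid (QExc v w) a b) \<^bold>\<circ> mor (J a b) = mor (J b a) \<^bold>\<circ> \<c> (F a) (F b)"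
    proof -
      have "Fm (braid (QExc v w) a b) \<^bold>\<circ> mor (J a b) = mor (up (dbraid a b) @@ J a b)"
        by (simp add: QExc_def Fm[OF arity_t_braid] ev'_def braid mor_comp[symmetric] mor_up)
      also have "up (dbraid a b) @@ J a b = J b a @@ tbraid (F a) (F b)"
        by (simp add: up_braid tcomp_assoc J_inverse tcomp_id)
      finally show ?thesis by (simp add: mor_fold)
    qed
    show "Fm (twist (QExc v w) a) = \<theta> (F a)"
      by (simp add: QExc_def Fm[OF arity_t_twist] ev'_def twist) (simp add: dtwist_def down_def ttwist_def)
  qed
  then have "evaluation_functor v w C X F Fm (\<lambda>a b. mor (J a b)) (\<^bold>i\<^bold>d \<^bold>1)"
    by (simp add: evaluation_functor_def)
  moreover have "sends_vertex_to v w C \<tau> F Fm (\<lambda>a b. mor (J a b)) (\<^bold>i\<^bold>d \<^bold>1)"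
  proof -
    have "Fm (qexc_class v w 3 0 Vertex) = \<tau>" by (simp add: Fm arity.intros ev'_def)
    then show ?thesis
      unfolding sends_vertex_to_def
      by (simp add: mor_fold J_small tid_comp ttens_id)
        (simp add: mor_id[symmetric] comp_id[OF _ _ generator_in(3)] id_comp[OF _ _ generator_in(3)])
  qed
  ultimately show ?thesis by blast
qed

lemma exists_evaluation:
  "\<exists>w. qexc_admissible v w \<and>
    (\<exists>Fo Fm J J0. evaluation_functor v w C X Fo Fm J J0 \<and> sends_vertex_to v w C \<tau> Fo Fm J J0)"
proof -
  obtain d b t K and \<phi> :: "'m \<Rightarrow> (nat, 'm) arrow \<Rightarrow> complex" where
    "admissible_calculus didn dcomp dtens dnul dplus dscale dcap dcup dvtx
      (dbraid' 1 1) (dbraid 1 1) v d b t \<alpha> K \<phi> darr"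
    using exists_admissible_calculus by blast
  from admissible_calculus.exists_qexc_calculus[OF this] obtain w s where
    q: "qexc_calculus didn dcomp dtens dnul dplus dscale (dscale s dcap) (dscale (inverse s) dcup) dvtx
      (dbraid' 1 1) (dbraid 1 1) v d (inverse s ^ 3 * b) (inverse s ^ 3 * t) (inverse s ^ 3 * \<alpha>) K \<phi> darr w"
    by blast
  moreover have "qexc_admissible v w" by (rule qexc_calculus.admissible[OF q])
  ultimately show ?thesis using evaluation_functor_of_calculus by blast
qed

end

theorem corollary1p20:
  fixes C :: "(complex, 'o, 'm) ribbon_structure"
    and X :: 'o and ev coev \<tau> :: 'm and v \<alpha> :: complex
  assumes "trivalent_ribbon_category (ring_of_type_algebra :: complex ring) C X ev coev \<tau>"
    and "dim_at_most (ring_of_type_algebra :: complex ring) (trivalent_signature.hom_pow C X 4) 5"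
    and "complex_trivalent_signature.QEJac C X ev coev \<tau> v \<alpha>"
    and "v ^ 10 \<noteq> 1" and "v ^ 12 \<noteq> 1"
  shows "\<exists>w. qexc_admissible v w \<and>
    (\<exists>Fo Fm J J0. evaluation_functor v w C X Fo Fm J J0 \<and> sends_vertex_to v w C \<tau> Fo Fm J J0)"
proof -
  interpret trivalent_ribbon_category "ring_of_type_algebra :: complex ring" C X ev coev \<tau>
    by (rule assms(1))
  interpret exceptional_category C X ev coev \<tau> v \<alpha>
    by unfold_locales (fact assms)+
  show ?thesis by (rule exists_evaluation)
qed

end
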